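(* Let $\gamma\in(0,1)$ and let $n\ge2$ be an integer. Let $\mathbf{H}=n\big(\sum_{i=1}^n\mathbf{W}_i^{-1}\big)^{-1}$ be the harmonic mean of the complex Wishart matrices of the matrix model described in the context, and let $\mathbf{\Sigma}=\mathbf{\Sigma}_P$ be a sequence of $P\times P$ positive definite matrices. Suppose that the pair $(\mathbf{H},\mathbf{\Sigma})$, as a pair of non-commutative random variables, converges in distribution to a pair $(\mathfrak{h},\mathfrak{s})$ of freely independent self-adjoint non-commutative random variables, where the law of $\mathfrak{h}$ is the measure with density $$\frac{n}{2\pi\gamma x}\sqrt{(e_+-x)(x-e_-)}\,\mathbf{1}_{[e_-,e_+]}(x),\qquad e_\pm=1-\gamma+\frac{2\gamma}{n}\pm2\sqrt{\frac{\gamma}{n}}\sqrt{1-\gamma+\frac{\gamma}{n}},$$ and the law of $\mathfrak{s}$ is the limiting spectral measure of $\mathbf{\Sigma}$, whose cumulative distribution function is denoted $F$. Assume $F$ is supported on the positive reals $\mathbb{R}^+$. Then the limiting Stieltjes transform $m_{\mathfrak{s}\mathfrak{h}}$ of $\mathbf{\Sigma}^{1/2}\mathbf{H}\mathbf{\Sigma}^{1/2}$ (the Stieltjes transform of the law of $\mathfrak{s}^{1/2}\mathfrak{h}\mathfrak{s}^{1/2}$) satisfies the fixed point equation $$m_{\mathfrak{s}\mathfrak{h}}(z)=\int_{\mathbb{R}^+}\frac{dF(x)}{z-x\left(\frac{\gamma z\,m_{\mathfrak{s}\mathfrak{h}}(z)}{n}+1-\gamma\right)},$$ and the limiting Stieltjes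 transform $m_{\mathfrak{e}}$ of $\mathbf{\Sigma}^{1/2}\mathbf{H}\mathbf{\Sigma}^{1/2}-\mathbf{\Sigma}$ (the Stieltjes transform of the law of $\mathfrak{e}=\mathfrak{s}^{1/2}(\mathfrak{h}-1)\mathfrak{s}^{1/2}$) satisfies the fixed point equation $$m_{\mathfrak{e}}(z)=\int_{\mathbb{R}^+}\frac{dF(x)}{z-\dfrac{x}{S_{\breve{\mathfrak{h}}}\big(z\,m_{\mathfrak{e}}(z)-1\big)}},$$ where $S_{\breve{\mathfrak{h}}}$ is the $S$-transform of $\breve{\mathfrak{h}}=\mathfrak{h}-1$, which satisfies the quadratic equation $$\frac{\gamma z}{n}S_{\breve{\mathfrak{h}}}(z)^2+\gamma\left(\frac{1+z}{n}-1\right)S_{\breve{\mathfrak{h}}}(z)-1=0.$$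
   Context: Matrix model: $N=N(P)$ satisfies $\left|\frac{P}{N}-\gamma\right|\le \frac{K}{P^2}$, where $K>0$ and $\gamma\in(0,1)$ are constants not depending on $P$, $N$ or $n$. For each $P$, $\mathbf{X}_1,\dots,\mathbf{X}_n$ are independent $P\times N$ random matrices whose entries are i.i.d. standard complex Gaussians, i.e. distributed as $(Z_1+\sqrt{-1}\,Z_2)/\sqrt2$ with $Z_1,Z_2$ independent standard real Gaussians, and $\mathbf{W}_i=N^{-1}\mathbf{X}_i\mathbf{X}_i^*$; for $P$ large one has $P<N$ and the $\mathbf{W}_i$ are almost surely invertible. Non-commutative probability: $P\times P$ matrices are regarded as non-commutative random variables in $(\mathrm{Mat}_P(\mathbb{C}),\varphi_P)$ with $\varphi_P(a)=\frac1P\operatorname{Tr}a$. The variables $\mathfrak{h},\mathfrak{s}$ live in a unital $C^*$-algebra $\mathcal{F}$ with unit $1$ and a faithful tracial state $\nu$. Convergence in distribution of $(\mathbf{H},\mathbf{\Sigma})$ to $(\mathfrak{h},\mathfrak{s})$ means $\varphi_P(Q(\mathbf{H},\mathbf{\Sigma}))\to\nu(Q(\mathfrak{h},\mathfrak{s}))$ (almost surely) for every non-commutative polynomial $Q$ in two variables. The law of a self-adjoint $a\in\mathcal{F}$ is identified with the compactly supported probability measure $\mu_a$ on $\mathbb{R}$ with $\nu(a^k)=\int x^k\,\mu_a(dx)$ for all $k\ge0$. Free independence is in the usual sense of Voiculescu. Stieltjes transform (sign convention): $m_\sigma(z)=\int_{\mathbb{R}}\frac{\sigma(dx)}{z-x}$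 for a probability measure $\sigma$. $S$-transform: for $a$ with $\nu(a)\ne0$, let $g_a(z)=\sum_{k\ge1}\nu(a^k)z^k$, let $\ell_a$ be the functional inverse of $g_a$ near $0$ (so $\ell_a(g_a(z))=g_a(\ell_a(z))=z$), and $S_a(z)=\frac{1+z}{z}\ell_a(z)$ (extended analytically to $z=0$). Domain convention: $S_{\breve{\mathfrak{h}}}$ is analytic near $0$ and its quadratic equation is an identity for $z$ near $0$; the fixed point equations are identities of analytic functions of $z$, holding for complex $z$ of sufficiently large modulus (where $z\,m(z)-1$ is close to $0$). *)

theory Defs
  imports
    "HOL-Probability.Probability"
    "Jordan_Normal_Form.Gauss_Jordan_Elimination"
    "Jordan_Normal_Form.Char_Poly"
    "Jordan_Normal_Form.Schur_Decomposition"
begin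

section \<open>Random matrices\<close>

text \<open>The law of \<open>(Z1 + \<i> Z2) / sqrt 2\<close> with \<open>Z1\<close>, \<open>Z2\<close> independent standard real Gaussians.\<close>

definition std_complex_gaussian :: "complex measure" where
  "std_complex_gaussian =
     distr (density lborel std_normal_density \<Otimes>\<^sub>M density lborel std_normal_density) borel
       (\<lambda>(x, y). (complex_of_real x + \<i> * complex_of_real y) / complex_of_real (sqrt 2))"

text \<open>\<open>X 0, \<dots>, X (n - 1)\<close> are independent \<open>p \<times> q\<close> matrices with i.i.d. standard complex Gaussian
  entries; equivalently, the whole family of entries is i.i.d.\<close>

definition iid_gaussian_matrices ::
    "'w measure \<Rightarrow> nat \<Rightarrow> nat \<Rightarrow> nat \<Rightarrow> (nat \<Rightarrow> 'w \<Rightarrow> complex mat) \<Rightarrow> bool" where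
  "iid_gaussian_matrices M n p q X \<longleftrightarrow>
     (\<forall>i<n. \<forall>\<omega>\<in>space M. X i \<omega> \<in> carrier_mat p q) \<and>
     prob_space.indep_vars M (\<lambda>_. borel) (\<lambda>(i, j, l) \<omega>. X i \<omega> $$ (j, l))
       ({..<n} \<times> {..<p} \<times> {..<q}) \<and>
     (\<forall>i<n. \<forall>j<p. \<forall>l<q. distr M borel (\<lambda>\<omega>. X i \<omega> $$ (j, l)) = std_complex_gaussian)"

definition wishart :: "complex mat \<Rightarrow> complex mat" where
  "wishart X = (1 / of_nat (dim_col X)) \<cdot>\<^sub>m (X * mat_adjoint X)"

text \<open>The value is unspecified if one of the inverses involved does not exist.\<close>

definition mat_inv :: "complex mat \<Rightarrow> complex mat" where
  "mat_inv A = the (mat_inverse A)"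

definition mat_harmonic_mean :: "nat \<Rightarrow> nat \<Rightarrow> (nat \<Rightarrow> complex mat) \<Rightarrow> complex mat" where
  "mat_harmonic_mean p n W =
     of_nat n \<cdot>\<^sub>m mat_inv (mat p p (\<lambda>(j, l). \<Sum>i<n. mat_inv (W i) $$ (j, l)))"

definition pos_def_mat :: "nat \<Rightarrow> complex mat \<Rightarrow> bool" where
  "pos_def_mat p A \<longleftrightarrow> A \<in> carrier_mat p p \<and> mat_adjoint A = A \<and>
     (\<forall>v\<in>carrier_vec p. v \<noteq> 0\<^sub>v p \<longrightarrow> 0 < Re ((A *\<^sub>v v) \<bullet>c v))"

definition normalized_trace :: "nat \<Rightarrow> complex mat \<Rightarrow> complex" where
  "normalized_trace p A = (\<Sum>i<p. A $$ (i, i)) / of_nat p"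

text \<open>Cumulative distribution function of the spectral measure of a Hermitian matrix, the
  eigenvalues being counted with multiplicity.\<close>

definition spectral_cdf :: "complex mat \<Rightarrow> real \<Rightarrow> real" where
  "spectral_cdf A x =
     (\<Sum>e | eigenvalue A e \<and> Re e \<le> x. real (Polynomial.order e (char_poly A))) / real (dim_row A)"

section \<open>Non-commutative probability\<close>

class cstar_algebra = real_normed_algebra_1 + complete_space +
  fixes scaleC :: "complex \<Rightarrow> 'a \<Rightarrow> 'a"
    and star :: "'a \<Rightarrow> 'a"
  assumes scaleC_add_right: "scaleC c (x + y) = scaleC c x + scaleC c y"
    and scaleC_add_left: "scaleC (c + d) x = scaleC c x + scaleC d x"
    and scaleC_scaleC: "scaleC c (scaleC d x) = scaleC (c * d) x"
    and scaleC_of_real: "scaleC (complex_of_real r) x = r *\<^sub>R x"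
    and scaleC_mult_left: "scaleC c x * y = scaleC c (x * y)"
    and scaleC_mult_right: "x * scaleC c y = scaleC c (x * y)"
    and norm_scaleC: "norm (scaleC c x) = cmod c * norm x"
    and star_add: "star (x + y) = star x + star y"
    and star_scaleC: "star (scaleC c x) = scaleC (cnj c) (star x)"
    and star_mult: "star (x * y) = star y * star x"
    and star_star: "star (star x) = x"
    and norm_star_mult_self: "norm (star x * x) = (norm x)\<^sup>2"

definition self_adjoint :: "'a::cstar_algebra \<Rightarrow> bool" where
  "self_adjoint a \<longleftrightarrow> star a = a"

definition cstar_positive :: "'a::cstar_algebra \<Rightarrow> bool" where
  "cstar_positive a \<longleftrightarrow> (\<exists>b. a = star b * b)"

text \<open>A positive element has exactly one positive square root, so the choice is immaterial.\<close>

definition cstar_sqrt :: "'a::cstar_algebra \<Rightarrow> 'a" where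
  "cstar_sqrt a = (SOME r. cstar_positive r \<and> r * r = a)"

definition faithful_tracial_state :: "('a::cstar_algebra \<Rightarrow> complex) \<Rightarrow> bool" where
  "faithful_tracial_state \<nu> \<longleftrightarrow>
     (\<forall>a b. \<nu> (a + b) = \<nu> a + \<nu> b) \<and> (\<forall>c a. \<nu> (scaleC c a) = c * \<nu> a) \<and>
     \<nu> 1 = 1 \<and> (\<forall>a. \<nu> (star a * a) \<in> \<real>\<^sub>\<ge>\<^sub>0) \<and>
     (\<forall>a. \<nu> (star a * a) = 0 \<longrightarrow> a = 0) \<and>
     (\<forall>a b. \<nu> (a * b) = \<nu> (b * a))"

text \<open>Terms denoting the non-commutative polynomials in two variables.\<close>

datatype ncpoly = NCConst complex | NCVar1 | NCVar2 | NCAdd ncpoly ncpoly | NCMult ncpoly ncpoly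

primrec nc_eval :: "ncpoly \<Rightarrow> 'a::cstar_algebra \<Rightarrow> 'a \<Rightarrow> 'a" where
  "nc_eval (NCConst c) a b = scaleC c 1"
| "nc_eval NCVar1 a b = a"
| "nc_eval NCVar2 a b = b"
| "nc_eval (NCAdd p q) a b = nc_eval p a b + nc_eval q a b"
| "nc_eval (NCMult p q) a b = nc_eval p a b * nc_eval q a b"

primrec nc_eval_mat :: "nat \<Rightarrow> ncpoly \<Rightarrow> complex mat \<Rightarrow> complex mat \<Rightarrow> complex mat" where
  "nc_eval_mat d (NCConst c) A B = c \<cdot>\<^sub>m 1\<^sub>m d"
| "nc_eval_mat d NCVar1 A B = A"
| "nc_eval_mat d NCVar2 A B = B"
| "nc_eval_mat d (NCAdd p q) A B = nc_eval_mat d p A B + nc_eval_mat d q A B"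
| "nc_eval_mat d (NCMult p q) A B = nc_eval_mat d p A B * nc_eval_mat d q A B"

definition converges_in_distribution_as ::
    "'w measure \<Rightarrow> (nat \<Rightarrow> nat) \<Rightarrow> (nat \<Rightarrow> 'w \<Rightarrow> complex mat) \<Rightarrow> (nat \<Rightarrow> 'w \<Rightarrow> complex mat) \<Rightarrow>
     ('a::cstar_algebra \<Rightarrow> complex) \<Rightarrow> 'a \<Rightarrow> 'a \<Rightarrow> bool" where
  "converges_in_distribution_as M P A B \<nu> a b \<longleftrightarrow>
     (\<forall>Q. AE \<omega> in M.
        (\<lambda>k. normalized_trace (P k) (nc_eval_mat (P k) Q (A k \<omega>) (B k \<omega>)))
          \<longlonglongrightarrow> \<nu> (nc_eval Q a b))"

definition unital_subalgebra :: "'a::cstar_algebra set \<Rightarrow> bool" where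
  "unital_subalgebra A \<longleftrightarrow> 1 \<in> A \<and> (\<forall>x\<in>A. \<forall>y\<in>A. x + y \<in> A \<and> x * y \<in> A) \<and>
     (\<forall>c. \<forall>x\<in>A. scaleC c x \<in> A)"

definition generated_subalgebra :: "'a::cstar_algebra set \<Rightarrow> 'a set" where
  "generated_subalgebra S = \<Inter>{A. unital_subalgebra A \<and> S \<subseteq> A}"

definition free_subalgebras ::
    "('a::cstar_algebra \<Rightarrow> complex) \<Rightarrow> ('i \<Rightarrow> 'a set) \<Rightarrow> 'i set \<Rightarrow> bool" where
  "free_subalgebras \<nu> A I \<longleftrightarrow>
     (\<forall>w :: ('i \<times> 'a) list. w \<noteq> [] \<and> distinct_adj (map fst w) \<and>
        (\<forall>(i, x)\<in>set w. i \<in> I \<and> x \<in> A i \<and> \<nu> x = 0) \<longrightarrow>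
        \<nu> (prod_list (map snd w)) = 0)"

definition freely_independent :: "('a::cstar_algebra \<Rightarrow> complex) \<Rightarrow> 'a \<Rightarrow> 'a \<Rightarrow> bool" where
  "freely_independent \<nu> a b \<longleftrightarrow>
     free_subalgebras \<nu> (\<lambda>i::bool. generated_subalgebra {if i then a else b}) UNIV"

definition has_law :: "('a::cstar_algebra \<Rightarrow> complex) \<Rightarrow> 'a \<Rightarrow> real measure \<Rightarrow> bool" where
  "has_law \<nu> a \<mu> \<longleftrightarrow> real_distribution \<mu> \<and> (\<exists>R. AE x in \<mu>. \<bar>x\<bar> \<le> R) \<and>
     (\<forall>k. \<nu> (a ^ k) = complex_of_real (\<integral>x. x ^ k \<partial>\<mu>))"

text \<open>A self-adjoint element has exactly one law, so the choice is immaterial.\<close>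

definition law :: "('a::cstar_algebra \<Rightarrow> complex) \<Rightarrow> 'a \<Rightarrow> real measure" where
  "law \<nu> a = (SOME \<mu>. has_law \<nu> a \<mu>)"

definition stieltjes :: "real measure \<Rightarrow> complex \<Rightarrow> complex" where
  "stieltjes \<mu> z = (\<integral>x. 1 / (z - complex_of_real x) \<partial>\<mu>)"

definition moment_series :: "('a::cstar_algebra \<Rightarrow> complex) \<Rightarrow> 'a \<Rightarrow> complex \<Rightarrow> complex" where
  "moment_series \<nu> a z = (\<Sum>k. \<nu> (a ^ Suc k) * z ^ Suc k)"

definition is_S_transform ::
    "('a::cstar_algebra \<Rightarrow> complex) \<Rightarrow> 'a \<Rightarrow> (complex \<Rightarrow> complex) \<Rightarrow> bool" where
  "is_S_transform \<nu> a S \<longleftrightarrow>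
     (\<exists>l. l analytic_on {0} \<and> l 0 = 0 \<and>
        (\<forall>\<^sub>F z in nhds 0. l (moment_series \<nu> a z) = z \<and> moment_series \<nu> a (l z) = z) \<and>
        S analytic_on {0} \<and> (\<forall>\<^sub>F z in at 0. S z = (1 + z) / z * l z))"

text \<open>For \<open>\<nu> a \<noteq> 0\<close> such a function exists, and it is unique as a germ at 0. Its values away from
  a neighbourhood of 0 carry no information.\<close>

definition S_transform :: "('a::cstar_algebra \<Rightarrow> complex) \<Rightarrow> 'a \<Rightarrow> complex \<Rightarrow> complex" where
  "S_transform \<nu> a = (SOME S. is_S_transform \<nu> a S)"

section \<open>The limiting law of the harmonic mean\<close>

definition harmonic_edge :: "real \<Rightarrow> real \<Rightarrow> nat \<Rightarrow> real" where
  "harmonic_edge \<epsilon> \<gamma> n =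
     1 - \<gamma> + 2 * \<gamma> / real n + \<epsilon> * 2 * sqrt (\<gamma> / real n) * sqrt (1 - \<gamma> + \<gamma> / real n)"

definition harmonic_law :: "real \<Rightarrow> nat \<Rightarrow> real measure" where
  "harmonic_law \<gamma> n =
     (let e_plus = harmonic_edge 1 \<gamma> n; e_minus = harmonic_edge (-1) \<gamma> n in
      density lborel (\<lambda>x. ennreal (real n / (2 * pi * \<gamma> * x) *
        sqrt ((e_plus - x) * (x - e_minus)) * indicator {e_minus..e_plus} x)))"

end

theory Submission
  imports Defs "HOL-Complex_Analysis.Complex_Analysis"
begin

text \<open>Since \<open>\<nu>\<close> is a trace, \<open>s\<^sup>1\<^sup>/\<^sup>2 a s\<^sup>1\<^sup>/\<^sup>2\<close> has the moments of \<open>a s\<close>, and by multiplicativity of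
  the \<open>S\<close>-transform the moment series of \<open>a s\<close> is locally inverted by \<open>S\<^sub>a(u) \<ell>\<^sub>s(u)\<close>. With \<open>w = 1/z\<close> and
  \<open>u = z m(z) - 1\<close> this says that \<open>w / S\<^sub>a(u) = \<ell>\<^sub>s(u)\<close>, that is, the moment series of \<open>s\<close> at \<open>w / S\<^sub>a(u)\<close>
  equals \<open>u\<close>, which is the fixed point equation. Multiplicativity is proved by Haagerup's
  factorisation of resolvents. The density of \<open>h\<close> is a semicircle divided by \<open>x\<close>, which gives
  \<open>1 / S\<^sub>h(u) = \<gamma> (1 + u) / n + 1 - \<gamma>\<close>; shifting \<open>h\<close> by \<open>1\<close> turns this into the quadratic equation.

  That the laws of self-adjoint elements exist follows from the Hausdorff moment problem, and that \<open>s\<close>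
  has a positive square root follows from faithfulness of \<open>\<nu>\<close>; both only use the power series of
  \<open>sqrt (1 - t)\<close> for \<open>\<parallel>t\<parallel> \<le> 1\<close>.\<close>

section \<open>Square roots in C*-algebras\<close>

text \<open>\<open>law\<close>, \<open>cstar_sqrt\<close> and \<open>S_transform\<close> are
  choices, so nothing can be said about them before existence is proved; this is why a large part of
  the work precedes any free probability. The binomial series takes the place of a functional
  calculus: it converges even on the boundary of the unit ball, and iterating it yields absolute
  values and fourth roots.

  Haagerup's factorisation evaluates the moment series of a product only at the points w = L(u), so
  it gives a right inverse, for u \<noteq> 0. The fixed point equation starts instead from an
  arbitrary small w = 1/z. The gap is closed by local injectivity, that is, by \<nu>(a s) = \<nu>(a)
  \<nu>(s) \<noteq> 0. For a = h - 1 the mean is \<gamma>/n - \<gamma>, and here n \<ge> 2 enters;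
  for s the mean is nonzero because its law is carried by the positive reals.\<close>

instance cstar_algebra \<subseteq> banach ..

section \<open>Scalar multiplication, star and norm\<close>

lemma scaleC_zero_left [simp]: "scaleC 0 x = 0"
  using scaleC_of_real[of 0 x] by simp

lemma scaleC_one [simp]: "scaleC 1 x = x"
  using scaleC_of_real[of 1 x] by simp

lemma scaleC_zero_right [simp]: "scaleC c 0 = 0"
  using norm_scaleC[of c 0] by simp

lemma scaleC_minus_left: "scaleC (- c) x = - scaleC c x"
  using scaleC_add_left[of "- c" c x] by (simp add: eq_neg_iff_add_eq_0)

lemma scaleC_minus_right: "scaleC c (- x) = - scaleC c x"
  using scaleC_add_right[of c "- x" x] by (simp add: eq_neg_iff_add_eq_0)

lemma scaleC_diff_right: "scaleC c (x - y) = scaleC c x - scaleC c y"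
  using scaleC_add_right[of c x "- y"] by (simp add: scaleC_minus_right)

lemma scaleC_diff_left: "scaleC (c - d) x = scaleC c x - scaleC d x"
  using scaleC_add_left[of c "- d" x] by (simp add: scaleC_minus_left)

lemma scaleC_power: "scaleC c x ^ k = scaleC (c ^ k) (x ^ k)"
  by (induction k) (simp_all add: scaleC_mult_left scaleC_mult_right scaleC_scaleC mult.commute)

lemma star_zero [simp]: "star 0 = 0"
  using star_scaleC[of 0 0] by simp

lemma star_one [simp]: "star 1 = 1"
  by (metis mult_1_right star_mult star_star)

lemma star_minus: "star (- x) = - star x"
  using star_add[of "- x" x] by (simp add: eq_neg_iff_add_eq_0)

lemma star_diff: "star (x - y) = star x - star y"
  using star_add[of x "- y"] by (simp add: star_minus)

lemma star_scaleR: "star (r *\<^sub>R x) = r *\<^sub>R star x"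
  unfolding scaleC_of_real[symmetric] by (simp add: star_scaleC)

lemma star_power: "star (x ^ k) = star x ^ k"
  by (induction k) (simp_all add: star_mult power_commutes)

lemma norm_star [simp]: "norm (star x) = norm x"
proof -
  have "norm y \<le> norm (star y)" for y :: 'a
  proof (cases "y = 0")
    case False
    have "norm y * norm y \<le> norm (star y) * norm y"
      using norm_star_mult_self[of y] norm_mult_ineq[of "star y" y] by (simp add: power2_eq_square)
    then show ?thesis using False by simp
  qed simp
  from this[of x] this[of "star x"] show ?thesis by (simp add: star_star)
qed

lemma bounded_linear_star: "bounded_linear star"
  by (rule bounded_linear_intro[where K = 1]) (simp_all add: star_add star_scaleR)

lemma norm_self_adjoint_square:
  assumes "self_adjoint x"
  shows "norm (x * x) = norm x ^ 2"
  using norm_star_mult_self[of x] assms by (simp add: self_adjoint_def)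

lemma self_adjoint_0: "self_adjoint 0"
  and self_adjoint_1: "self_adjoint 1"
  and self_adjoint_add: "self_adjoint x \<Longrightarrow> self_adjoint y \<Longrightarrow> self_adjoint (x + y)"
  and self_adjoint_diff: "self_adjoint x \<Longrightarrow> self_adjoint y \<Longrightarrow> self_adjoint (x - y)"
  and self_adjoint_minus: "self_adjoint x \<Longrightarrow> self_adjoint (- x)"
  and self_adjoint_scaleR: "self_adjoint x \<Longrightarrow> self_adjoint (r *\<^sub>R x)"
  and self_adjoint_power: "self_adjoint x \<Longrightarrow> self_adjoint (x ^ k)"
  by (simp_all add: self_adjoint_def star_add star_diff star_minus star_scaleR star_power)

lemma self_adjoint_mult_commute:
  "self_adjoint x \<Longrightarrow> self_adjoint y \<Longrightarrow> x * y = y * x \<Longrightarrow> self_adjoint (x * y)"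
  by (simp add: self_adjoint_def star_mult)

section \<open>The binomial series of sqrt (1 - t) on the closed unit ball\<close>

definition sqrt_coeff :: "nat \<Rightarrow> real" where
  "sqrt_coeff k = (- 1) ^ k * ((1/2) gchoose k)"

lemma sqrt_coeff_0 [simp]: "sqrt_coeff 0 = 1"
  by (simp add: sqrt_coeff_def)

lemma sqrt_coeff_partial_sum: "(\<Sum>k\<le>m. sqrt_coeff k) = (- 1) ^ m * ((- 1/2) gchoose m)"
  using gbinomial_sum_lower_neg[of "1/2::real" m] by (simp add: sqrt_coeff_def mult.commute)

lemma neg_half_gbinomial_nonneg: "0 \<le> (- 1) ^ m * ((- 1/2 :: real) gchoose m)"
proof -
  have "(- 1) ^ m * (\<Prod>i = 0..<m. - 1/2 - real i) = (\<Prod>i = 0..<m. 1/2 + real i)"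
    by (induction m) (simp_all add: algebra_simps)
  also have "\<dots> \<ge> 0" by (intro prod_nonneg) auto
  finally show ?thesis by (simp add: gbinomial_prod_rev)
qed

lemma sqrt_coeff_Suc_nonpos: "sqrt_coeff (Suc k) \<le> 0"
proof -
  have "real (Suc k) * sqrt_coeff (Suc k) = - (1/2) * ((- 1) ^ k * ((- 1/2) gchoose k))"
  proof -
    have "real (Suc k) * sqrt_coeff (Suc k) = - ((- 1) ^ k * (real (Suc k) * ((1/2) gchoose Suc k)))"
      by (simp add: sqrt_coeff_def)
    also have "\<dots> = - (1/2) * ((- 1) ^ k * ((- 1/2) gchoose k))"
      using gbinomial_absorption[of k "1/2::real"] by (simp del: of_nat_Suc)
    finally show ?thesis .
  qed
  also have "\<dots> \<le> 0" using neg_half_gbinomial_nonneg[of k] by simp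
  finally show ?thesis by (simp add: mult_le_0_iff)
qed

text \<open>All coefficients after the first are nonpositive and all partial sums are nonnegative,
  so the absolute values of the tail never add up to more than the leading 1. Summability gives
  convergence for \<open>norm t = 1\<close> as well; the bound 1 keeps
  \<open>1 - sqrt_one_minus t\<close> in the unit ball, so that square roots can be
  iterated.\<close>

lemma
  shows summable_sqrt_coeff_tail: "summable (\<lambda>k. \<bar>sqrt_coeff (Suc k)\<bar>)"
    and suminf_sqrt_coeff_tail: "(\<Sum>k. \<bar>sqrt_coeff (Suc k)\<bar>) \<le> 1"
proof -
  have bound: "(\<Sum>k<m. \<bar>sqrt_coeff (Suc k)\<bar>) \<le> 1" for m
  proof -
    have "(\<Sum>k<m. \<bar>sqrt_coeff (Suc k)\<bar>) = 1 - (\<Sum>k\<le>m. sqrt_coeff k)"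
      using sqrt_coeff_Suc_nonpos
      by (simp add: sum.atMost_shift sum_negf)
    then show ?thesis
      using neg_half_gbinomial_nonneg[of m] by (simp add: sqrt_coeff_partial_sum)
  qed
  show s: "summable (\<lambda>k. \<bar>sqrt_coeff (Suc k)\<bar>)"
    using bound by (intro summableI_nonneg_bounded[where x = 1]) auto
  show "(\<Sum>k. \<bar>sqrt_coeff (Suc k)\<bar>) \<le> 1"
    using bound by (intro suminf_le_const[OF s]) auto
qed

text \<open>Vandermonde's identity for 1/2 + 1/2 = 1: the square of the series has the coefficients
  of 1 - t.\<close>

lemma sqrt_coeff_convolution:
  "(\<Sum>i\<le>k. sqrt_coeff i * sqrt_coeff (k - i)) = (if k = 0 then 1 else if k = 1 then - 1 else 0)"
proof -
  have "(\<Sum>i\<le>k. sqrt_coeff i * sqrt_coeff (k - i)) =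
      (\<Sum>i\<le>k. (- 1) ^ k * (((1/2) gchoose i) * ((1/2) gchoose (k - i))))"
    by (intro sum.cong refl) (simp add: sqrt_coeff_def flip: power_add)
  also have "\<dots> = (- 1) ^ k * ((1::real) gchoose k)"
    using gbinomial_Vandermonde[of "1/2::real" "1/2" k]
    by (simp add: atMost_atLeast0 flip: sum_distrib_left)
  also have "(1::real) gchoose k = of_nat (1 choose k)"
    by (simp add: binomial_gbinomial)
  finally show ?thesis
    by (cases k) (auto simp: binomial_eq_0)
qed

definition sqrt_one_minus :: "'a::cstar_algebra \<Rightarrow> 'a" where
  "sqrt_one_minus t = (\<Sum>k. sqrt_coeff k *\<^sub>R t ^ k)"

context
  fixes t :: "'a::cstar_algebra"
  assumes norm_le_1: "norm t \<le> 1"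
begin

lemma norm_sqrt_term_le: "norm (sqrt_coeff k *\<^sub>R t ^ k) \<le> \<bar>sqrt_coeff k\<bar>"
proof -
  have "norm (t ^ k) \<le> 1"
    using norm_power_ineq[of t k] power_le_one[OF norm_ge_zero norm_le_1, of k] by simp
  then show ?thesis by (simp add: mult_left_le)
qed

lemma summable_norm_sqrt: "summable (\<lambda>k. norm (sqrt_coeff k *\<^sub>R t ^ k))"
proof (rule summable_comparison_test_ev)
  show "summable (\<lambda>k. \<bar>sqrt_coeff k\<bar>)"
    using summable_sqrt_coeff_tail by (subst summable_Suc_iff[symmetric])
  show "\<forall>\<^sub>F n in sequentially. norm (norm (sqrt_coeff n *\<^sub>R t ^ n)) \<le> \<bar>sqrt_coeff n\<bar>"
    using norm_sqrt_term_le by (intro always_eventually) simp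
qed

lemma summable_sqrt: "summable (\<lambda>k. sqrt_coeff k *\<^sub>R t ^ k)"
  by (rule summable_norm_cancel[OF summable_norm_sqrt])

lemma sqrt_one_minus_square: "sqrt_one_minus t * sqrt_one_minus t = 1 - t"
proof -
  have "(\<lambda>k. \<Sum>i\<le>k. (sqrt_coeff i *\<^sub>R t ^ i) * (sqrt_coeff (k - i) *\<^sub>R t ^ (k - i)))
      sums (sqrt_one_minus t * sqrt_one_minus t)"
    unfolding sqrt_one_minus_def by (intro Cauchy_product_sums summable_norm_sqrt)
  also have "(\<lambda>k. \<Sum>i\<le>k. (sqrt_coeff i *\<^sub>R t ^ i) * (sqrt_coeff (k - i) *\<^sub>R t ^ (k - i))) =
      (\<lambda>k. (if k = 0 then 1 else if k = 1 then - 1 else 0) *\<^sub>R t ^ k)"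
    unfolding sqrt_coeff_convolution[symmetric]
    by (auto simp: fun_eq_iff scaleR_sum_left mult.commute simp flip: power_add intro!: sum.cong)
  finally have 1: "(\<lambda>k. (if k = 0 then 1 else if k = 1 then - 1 else 0) *\<^sub>R t ^ k)
      sums (sqrt_one_minus t * sqrt_one_minus t)" .
  have "(\<lambda>k. (if k = 0 then 1 else if k = 1 then - 1 else 0) *\<^sub>R t ^ k)
      sums (\<Sum>k\<in>{0,1}. (if k = 0 then 1 else if k = 1 then - 1 else 0) *\<^sub>R t ^ k)"
    by (rule sums_finite) auto
  from sums_unique2[OF 1 this] show ?thesis by simp
qed

lemma norm_one_minus_sqrt: "norm (1 - sqrt_one_minus t) \<le> 1"
proof -
  have "sqrt_one_minus t = 1 + (\<Sum>k. sqrt_coeff (Suc k) *\<^sub>R t ^ Suc k)"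
    unfolding sqrt_one_minus_def using suminf_split_head[OF summable_sqrt] by simp
  moreover have "norm (\<Sum>k. sqrt_coeff (Suc k) *\<^sub>R t ^ Suc k) \<le> (\<Sum>k. \<bar>sqrt_coeff (Suc k)\<bar>)"
    using norm_sqrt_term_le summable_sqrt_coeff_tail by (intro norm_suminf_le)
  ultimately show ?thesis
    using suminf_sqrt_coeff_tail by simp
qed

lemma self_adjoint_sqrt_one_minus:
  assumes "self_adjoint t"
  shows "self_adjoint (sqrt_one_minus t)"
proof -
  have "star (sqrt_coeff k *\<^sub>R t ^ k) = sqrt_coeff k *\<^sub>R t ^ k" for k
    using assms by (simp add: self_adjoint_def star_scaleR star_power)
  then show ?thesis
    using bounded_linear.suminf[OF bounded_linear_star summable_sqrt]
    by (simp add: self_adjoint_def sqrt_one_minus_def)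
qed

lemma sqrt_one_minus_commute:
  assumes "y * t = t * y"
  shows "y * sqrt_one_minus t = sqrt_one_minus t * y"
proof -
  have "y * t ^ k = t ^ k * y" for k
    by (induction k) (simp_all add: assms, metis assms mult.assoc)
  then show ?thesis
    unfolding sqrt_one_minus_def
    by (simp add: suminf_mult[OF summable_sqrt, symmetric] suminf_mult2[OF summable_sqrt])
qed

text \<open>Only closedness is asked of \<open>S\<close>, which need not be a subalgebra: later it
  is the solution set of an inequality for \<open>\<nu>\<close>.\<close>

lemma sqrt_one_minus_in_closed:
  assumes "closed S" and "\<And>m. (\<Sum>k<m. sqrt_coeff k *\<^sub>R t ^ k) \<in> S"
  shows "sqrt_one_minus t \<in> S"
  unfolding sqrt_one_minus_def
  by (rule closed_sequentially[OF assms(1) _ summable_LIMSEQ[OF summable_sqrt]]) (rule assms(2))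

end

text \<open>With \<open>r = sqrt (1 - v^2)\<close>, the element \<open>u = v + i r\<close> is unitary and \<open>u^2 + (u^2)^* = 2 (2 v^2 - 1)\<close>.\<close>

lemma norm_one_minus_square_le:
  fixes v :: "'a::cstar_algebra"
  assumes sa: "self_adjoint v" and v: "norm v \<le> 1"
  shows "norm (1 - v * v) \<le> 1"
proof -
  define r where "r = sqrt_one_minus (v * v)"
  have n: "norm (v * v) \<le> 1"
    using v norm_mult_ineq[of v v] by (meson mult_le_one norm_ge_zero order_trans)
  have rr: "r * r = 1 - v * v"
    unfolding r_def by (rule sqrt_one_minus_square[OF n])
  have "self_adjoint (v * v)" using sa by (simp add: self_adjoint_mult_commute)
  then have "self_adjoint r" unfolding r_def by (rule self_adjoint_sqrt_one_minus[OF n])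
  then have sr: "star r = r" "star v = v" using sa by (simp_all add: self_adjoint_def)
  have vr: "v * r = r * v"
    unfolding r_def by (rule sqrt_one_minus_commute[OF n]) (simp add: mult.assoc)
  define u where "u = v + scaleC \<i> r"
  have su: "star u = v - scaleC \<i> r"
    by (simp add: u_def star_add star_scaleC sr scaleC_minus_left)
  have "star u * u = v * v + r * r"
    by (simp add: su) (simp add: u_def algebra_simps scaleC_mult_left scaleC_mult_right vr
        scaleC_scaleC scaleC_minus_left scaleC_diff_right scaleC_add_right)
  then have "norm u = 1"
    using norm_star_mult_self[of u] by (simp add: rr) (metis norm_ge_zero one_power2 power2_eq_iff_nonneg zero_le_one)
  then have uu: "norm (u * u) \<le> 1" using norm_mult_ineq[of u u] by simp
  have "u * u + star u * star u = 2 *\<^sub>R (v * v - r * r)"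
    by (simp only: su) (simp add: u_def algebra_simps scaleC_mult_left scaleC_mult_right vr
        scaleC_scaleC scaleC_minus_left scaleC_diff_right scaleC_add_right scaleR_2)
  then have eq: "u * u + star (u * u) = 2 *\<^sub>R (2 *\<^sub>R (v * v) - 1)"
    by (simp add: rr star_mult scaleR_2)
  \<comment> \<open>This is the average of 1 and an element of norm at most 1, which improves the
    trivial bound 2 to 1.\<close>
  have "1 - v * v = (1/2) *\<^sub>R 1 - (1/4) *\<^sub>R (u * u + star (u * u))"
    by (simp add: eq scaleR_right_diff_distrib) (simp add: algebra_simps flip: scaleR_left.add)
  also have "norm \<dots> \<le> norm ((1/2) *\<^sub>R (1::'a)) + norm ((1/4) *\<^sub>R (u * u + star (u * u)))"
    by (rule norm_triangle_ineq4)
  also have "\<dots> \<le> 1"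
    using uu norm_triangle_ineq[of "u * u" "star (u * u)"] by simp
  finally show ?thesis .
qed

section \<open>The Hausdorff moment problem\<close>

text \<open>The Bernstein weights reproduce the ratio of binomial coefficients exactly, but the
  moment (j/n)^k only in the limit. For \<open>k \<le> j\<close> the ratio is the product of the (j
  - i)/(n - i), and each of these k factors differs from j/n by at most k/(n - k).\<close>

lemma binomial_ratio_bound:
  assumes "j \<le> n" and "k < n"
  shows "\<bar>real (j choose k) / real (n choose k) - (real j / real n) ^ k\<bar> \<le> (real k)\<^sup>2 / (real n - real k)"
proof (cases "j < k")
  case True
  then have k: "k \<ge> 1" by simp
  have "(real j / real n) ^ k \<le> (real j / real n) ^ 1"
    using assms k by (intro power_decreasing) (auto simp: divide_le_eq_1)
  also have "\<dots> \<le> real k / (real n - real k)"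
    using True assms by (simp, intro frac_le) auto
  also have "\<dots> \<le> (real k)\<^sup>2 / (real n - real k)"
    using k assms by (intro divide_right_mono) (auto simp: power2_eq_square)
  finally show ?thesis using True by (simp add: binomial_eq_0)
next
  case False
  then have kj: "k \<le> j" by simp
  have "real (j choose k) / real (n choose k) = (\<Prod>i=0..<k. (real j - real i)) / (\<Prod>i=0..<k. (real n - real i))"
    by (simp add: binomial_gbinomial gbinomial_prod_rev)
  also have "\<dots> = (\<Prod>i=0..<k. (real j - real i) / (real n - real i))"
    by (simp add: prod_dividef)
  finally have "\<bar>real (j choose k) / real (n choose k) - (real j / real n) ^ k\<bar> =
      norm ((\<Prod>i=0..<k. (real j - real i) / (real n - real i)) - (\<Prod>i=0..<k. real j / real n))"
    by simp
  also have "\<dots> \<le> (\<Sum>i=0..<k. norm ((real j - real i) / (real n - real i) - real j / real n))"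
    using assms kj by (intro norm_prod_diff) (auto simp: divide_le_eq_1)
  also have "\<dots> \<le> (\<Sum>i=0..<k. real k / (real n - real k))"
  proof (intro sum_mono)
    fix i assume "i \<in> {0..<k}"
    then have i: "i < k" by simp
    have eq: "(real j - real i) / (real n - real i) - real j / real n =
        - ((real i / (real n - real i)) * ((real n - real j) / real n))"
      using i assms by (simp add: field_simps)
    have "(real i / (real n - real i)) * ((real n - real j) / real n) \<le> (real k / (real n - real k)) * 1"
      using i assms by (intro mult_mono frac_le) (auto simp: divide_le_eq_1)
    then show "norm ((real j - real i) / (real n - real i) - real j / real n) \<le> real k / (real n - real k)"
      using i assms by (simp add: eq abs_mult)
  qed
  also have "\<dots> = (real k)\<^sup>2 / (real n - real k)" by (simp add: power2_eq_square)
  finally show ?thesis .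
qed

text \<open>The weights \<open>w n j\<close> are those of the Bernstein operators; a weak limit point of the
  corresponding discrete measures on \<open>{j/n}\<close> solves the moment problem.\<close>

theorem hausdorff_moment_problem:
  fixes L :: "real poly \<Rightarrow> real"
  assumes add: "\<And>p q. L (p + q) = L p + L q"
    and smult: "\<And>c p. L (Polynomial.smult c p) = c * L p"
    and one: "L 1 = 1"
    and pos: "\<And>j k. 0 \<le> L ([:0, 1:] ^ j * [:1, - 1:] ^ k)"
  obtains \<mu> where "real_distribution \<mu>" and "AE x in \<mu>. 0 \<le> x \<and> x \<le> 1"
    and "\<And>k. (\<integral>x. x ^ k \<partial>\<mu>) = L ([:0, 1:] ^ k)"
proof -
  have L_sum: "L (\<Sum>i\<in>I. f i) = (\<Sum>i\<in>I. L (f i))" for I :: "nat set" and f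
  proof (induction I rule: infinite_finite_induct)
    case (insert i I) then show ?case by (simp add: add)
  qed (use smult[of 0 0] in auto)
  define w where "w n j = real (n choose j) * L ([:0, 1:] ^ j * [:1, - 1:] ^ (n - j))" for n j
  have w_nonneg: "w n j \<ge> 0" for n j using pos by (simp add: w_def)
  have moment: "(\<Sum>j\<le>n. w n j * (real (j choose k) / real (n choose k))) = L ([:0, 1:] ^ k)"
    if kn: "k \<le> n" for n k
  proof -
    \<comment> \<open>Multiplying x^k by (x + (1 - x))^(n - k) = 1 expresses it through the
      Bernstein polynomials of degree n.\<close>
    have "[:0, 1:] + [:1, - 1:] = (1 :: real poly)" by (simp add: one_pCons)
    then have "[:0, 1:] ^ k = [:0, 1::real:] ^ k * ([:0, 1:] + [:1, - 1:]) ^ (n - k)"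
      by (metis mult.right_neutral power_one)
    also have "\<dots> = (\<Sum>i\<le>n - k. Polynomial.smult (real ((n - k) choose i))
        ([:0, 1:] ^ (k + i) * [:1, - 1:] ^ (n - k - i)))"
      unfolding binomial_ring sum_distrib_left
      by (intro sum.cong refl) (simp add: power_add of_nat_poly mult_ac)
    finally have "L ([:0, 1:] ^ k) = (\<Sum>i\<le>n - k. real ((n - k) choose i) *
        L ([:0, 1:] ^ (k + i) * [:1, - 1:] ^ (n - k - i)))"
      by (simp add: L_sum smult)
    also have "\<dots> = (\<Sum>i\<le>n - k. w n (i + k) * (real ((i + k) choose k) / real (n choose k)))"
    proof (intro sum.cong refl)
      fix i assume i: "i \<in> {..n - k}"
      have "real (n choose (i + k)) * real ((i + k) choose k) = real (n choose k) * real ((n - k) choose i)"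
        using choose_mult[of k "i + k" n] i kn by (simp flip: of_nat_mult)
      moreover have "real (n choose k) > 0" using kn by simp
      ultimately have "real ((n - k) choose i) = real (n choose (i + k)) * (real ((i + k) choose k) / real (n choose k))"
        by (simp add: field_simps)
      then show "real ((n - k) choose i) * L ([:0, 1:] ^ (k + i) * [:1, - 1:] ^ (n - k - i)) =
          w n (i + k) * (real ((i + k) choose k) / real (n choose k))"
        by (simp add: w_def add.commute)
    qed
    also have "\<dots> = (\<Sum>j\<in>{k..n}. w n j * (real (j choose k) / real (n choose k)))"
      by (rule sum.reindex_bij_witness[where i = "\<lambda>j. j - k" and j = "\<lambda>i. i + k"]) (use kn in auto)
    also have "\<dots> = (\<Sum>j\<le>n. w n j * (real (j choose k) / real (n choose k)))"
      by (intro sum.mono_neutral_left) (auto simp: binomial_eq_0)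
    finally show ?thesis by simp
  qed
  have w_sum: "(\<Sum>j\<le>n. w n j) = 1" for n using moment[of 0 n] one by simp
  define p where "p n = embed_pmf (\<lambda>j. if j \<le> n then w n j else 0)" for n
  have pmf_p: "pmf (p n) j = (if j \<le> n then w n j else 0)" for n j
    unfolding p_def
  proof (rule pmf_embed_pmf)
    have "(\<integral>\<^sup>+ x. ennreal (if x \<le> n then w n x else 0) \<partial>count_space UNIV) =
        (\<Sum>x\<le>n. ennreal (if x \<le> n then w n x else 0))"
      by (rule nn_integral_count_space') (auto)
    also have "\<dots> = 1" using w_nonneg w_sum[of n] by simp
    finally show "(\<integral>\<^sup>+ x. ennreal (if x \<le> n then w n x else 0) \<partial>count_space UNIV) = 1" .
  qed (use w_nonneg in auto)
  define \<mu> where "\<mu> n = distr (measure_pmf (p n)) borel (\<lambda>j. real j / real n)" for n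
  have rd: "real_distribution (\<mu> n)" for n
    unfolding \<mu>_def by (intro prob_space.real_distribution_distr measure_pmf.prob_space_axioms) simp
  have le1: "j \<le> n" if "j \<in> set_pmf (p n)" for j n
    using that by (auto simp: set_pmf_iff pmf_p split: if_splits)
  have integral: "(\<integral>x. f x \<partial>\<mu> n) = (\<Sum>j\<le>n. w n j * f (real j / real n))"
    if "f \<in> borel_measurable borel" for f :: "real \<Rightarrow> real" and n
  proof -
    have "(\<integral>x. f x \<partial>\<mu> n) = measure_pmf.expectation (p n) (\<lambda>j. f (real j / real n))"
      unfolding \<mu>_def using that by (subst integral_distr) auto
    also have "\<dots> = (\<Sum>j\<le>n. pmf (p n) j *\<^sub>R f (real j / real n))"
      by (rule integral_measure_pmf) (auto dest: le1)
    finally show ?thesis by (simp add: pmf_p)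
  qed
  have supp: "AE x in \<mu> n. 0 \<le> x \<and> x \<le> 1" for n
    unfolding \<mu>_def by (subst AE_distr_iff) (auto simp: AE_measure_pmf_iff divide_le_eq_1 dest: le1)
  have tight: "tight \<mu>"
    unfolding tight_def
  proof (intro conjI allI impI rd)
    fix \<epsilon> :: real assume "\<epsilon> > 0"
    have "measure (\<mu> n) {-1<..1} = 1" for n
    proof -
      interpret real_distribution "\<mu> n" by (rule rd)
      have "AE x in \<mu> n. x \<in> {-1<..1}" using supp[of n] by eventually_elim auto
      then show ?thesis by (subst prob_eq_1) auto
    qed
    then show "\<exists>a b. a < b \<and> (\<forall>n. 1 - \<epsilon> < measure (\<mu> n) {a<..b})"
      using \<open>\<epsilon> > 0\<close> by (intro exI[of _ "-1"] exI[of _ 1]) auto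
  qed
  obtain r M where r: "strict_mono r" and M: "real_distribution M" and conv: "weak_conv_m (\<mu> \<circ> id \<circ> r) M"
    using tight_imp_convergent_subsubsequence[OF tight strict_mono_id] by blast
  interpret M: real_distribution M by fact
  \<comment> \<open>Weak convergence applies to bounded continuous functions, so powers of
    \<open>x\<close> are replaced by powers of its projection to [0, 1].\<close>
  define g where "g x = max 0 (min 1 x)" for x :: real
  have g01: "0 \<le> g x" "g x \<le> 1" for x by (auto simp: g_def)
  have g_cont: "isCont g x" for x unfolding g_def by (intro continuous_intros)
  have [measurable]: "g \<in> borel_measurable borel" unfolding g_def by measurable
  have lim: "(\<lambda>n. \<integral>x. f x \<partial>\<mu> (r n)) \<longlonglongrightarrow> (\<integral>x. f x \<partial>M)"
    if "\<And>x. isCont f x" "\<And>x. norm (f x) \<le> 1" for f :: "real \<Rightarrow> real"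
    using weak_conv_imp_integral_bdd_continuous_conv[of "\<mu> \<circ> id \<circ> r" M f 1] that conv rd M
    by (simp add: o_def)
  have M_supp: "AE x in M. 0 \<le> x \<and> x \<le> 1"
  proof -
    \<comment> \<open>The truncated distance to [0, 1] is a bounded continuous test function that
      vanishes exactly there; its integral is 0 along the sequence and hence in the limit.\<close>
    define f where "f x = min 1 \<bar>x - g x\<bar>" for x
    have f: "isCont f x" "norm (f x) \<le> 1" "0 \<le> f x" for x
      unfolding f_def by (auto intro!: continuous_intros g_cont)
    have fm [measurable]: "f \<in> borel_measurable borel" unfolding f_def by measurable
    have "(\<integral>x. f x \<partial>\<mu> n) = 0" for n
    proof -
      have "(\<integral>x. f x \<partial>\<mu> n) = (\<integral>x. 0 \<partial>\<mu> n)"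
      proof (rule integral_cong_AE)
        show "AE x in \<mu> n. f x = 0"
          using supp[of n] by eventually_elim (auto simp: f_def g_def)
      qed (simp_all add: \<mu>_def)
      then show ?thesis by simp
    qed
    then have "(\<integral>x. f x \<partial>M) = 0" using lim[of f] f LIMSEQ_unique[OF _ tendsto_const] by simp
    moreover have "integrable M f" by (rule M.integrable_const_bound[of _ 1]) (use f in auto)
    ultimately have "AE x in M. f x = 0"
      using f by (subst (asm) integral_nonneg_eq_0_iff_AE) auto
    then show ?thesis by eventually_elim (auto simp: f_def g_def min_def max_def split: if_splits)
  qed
  have M_moment: "(\<integral>x. x ^ k \<partial>M) = L ([:0, 1:] ^ k)" for k
  proof -
    have eq: "(\<integral>x. g x ^ k \<partial>\<mu> n) = (\<Sum>j\<le>n. w n j * (real j / real n) ^ k)" for n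
    proof (subst integral)
      have "g (real j / real n) = real j / real n" if "j \<le> n" for j
      proof -
        have "real j / real n \<le> 1" using that by (auto simp: divide_le_eq_1)
        then show ?thesis by (simp add: g_def)
      qed
      then show "(\<Sum>j\<le>n. w n j * g (real j / real n) ^ k) = (\<Sum>j\<le>n. w n j * (real j / real n) ^ k)"
        by (intro sum.cong) auto
    qed simp
    have "(\<lambda>n. (\<Sum>j\<le>n. w n j * (real j / real n) ^ k)) \<longlonglongrightarrow> L ([:0, 1:] ^ k)"
    proof (rule Lim_transform)
      show "(\<lambda>n. L ([:0, 1:] ^ k)) \<longlonglongrightarrow> L ([:0, 1:] ^ k)" by simp
      show "(\<lambda>n. (\<Sum>j\<le>n. w n j * (real j / real n) ^ k) - L ([:0, 1:] ^ k)) \<longlonglongrightarrow> 0"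
      proof (rule Lim_null_comparison)
        show "(\<lambda>n. (real k)\<^sup>2 / (real n - real k)) \<longlonglongrightarrow> 0"
          by real_asymp
        show "\<forall>\<^sub>F n in sequentially. norm ((\<Sum>j\<le>n. w n j * (real j / real n) ^ k) - L ([:0, 1:] ^ k))
            \<le> (real k)\<^sup>2 / (real n - real k)"
          using eventually_gt_at_top[of k]
        proof eventually_elim
          case (elim n)
          have "(\<Sum>j\<le>n. w n j * (real j / real n) ^ k) - L ([:0, 1:] ^ k) =
              (\<Sum>j\<le>n. w n j * ((real j / real n) ^ k - real (j choose k) / real (n choose k)))"
            using moment[of k n] elim by (simp add: right_diff_distrib sum_subtractf)
          also have "norm \<dots> \<le> (\<Sum>j\<le>n. w n j * ((real k)\<^sup>2 / (real n - real k)))"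
          proof (rule sum_norm_le)
            fix j assume "j \<in> {..n}"
            then have "\<bar>(real j / real n) ^ k - real (j choose k) / real (n choose k)\<bar> \<le> (real k)\<^sup>2 / (real n - real k)"
              using binomial_ratio_bound[of j n k] elim by (simp add: abs_minus_commute)
            then show "norm (w n j * ((real j / real n) ^ k - real (j choose k) / real (n choose k)))
                \<le> w n j * ((real k)\<^sup>2 / (real n - real k))"
              using w_nonneg[of n j] by (simp only: real_norm_def abs_mult abs_of_nonneg mult_left_mono)
          qed
          also have "\<dots> = (real k)\<^sup>2 / (real n - real k)"
            using w_sum[of n] by (simp only: sum_distrib_right[symmetric] mult_1)
          finally show ?case .
        qed
      qed
    qed
    then have "(\<lambda>n. \<integral>x. g x ^ k \<partial>\<mu> (r n)) \<longlonglongrightarrow> L ([:0, 1:] ^ k)"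
      unfolding eq using LIMSEQ_subseq_LIMSEQ[OF _ r] by (fastforce simp: o_def)
    moreover have "(\<lambda>n. \<integral>x. g x ^ k \<partial>\<mu> (r n)) \<longlonglongrightarrow> (\<integral>x. g x ^ k \<partial>M)"
      using g01 by (intro lim) (auto intro!: continuous_intros g_cont power_le_one)
    ultimately have "(\<integral>x. g x ^ k \<partial>M) = L ([:0, 1:] ^ k)" by (rule LIMSEQ_unique[symmetric])
    moreover have "(\<integral>x. g x ^ k \<partial>M) = (\<integral>x. x ^ k \<partial>M)"
    proof (rule integral_cong_AE)
      show "AE x in M. g x ^ k = x ^ k"
        using M_supp by eventually_elim (auto simp: g_def)
    qed simp_all
    ultimately show ?thesis by simp
  qed
  show ?thesis using that[OF M M_supp M_moment] .
qed

lemma poly_functional_eq_integral: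
  fixes L :: "real poly \<Rightarrow> real"
  assumes rd: "real_distribution \<mu>" and supp: "AE x in \<mu>. \<bar>x\<bar> \<le> R"
    and add: "\<And>p q. L (p + q) = L p + L q"
    and smult: "\<And>c p. L (Polynomial.smult c p) = c * L p"
    and moment: "\<And>k. L ([:0, 1:] ^ k) = (\<integral>x. x ^ k \<partial>\<mu>)"
  shows "integrable \<mu> (poly p)" and "(\<integral>x. poly p x \<partial>\<mu>) = L p"
proof -
  interpret real_distribution \<mu> by fact
  have int: "integrable \<mu> (poly p)" for p
  proof -
    have "compact (poly p ` {- R..R})"
      by (intro compact_continuous_image continuous_intros) auto
    then have "bounded (poly p ` {- R..R})" by (rule compact_imp_bounded)
    then obtain B where B: "\<forall>y\<in>poly p ` {- R..R}. norm y \<le> B"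
      unfolding bounded_iff by blast
    show ?thesis
    proof (rule integrable_const_bound)
      show "AE x in \<mu>. norm (poly p x) \<le> B"
        using supp by eventually_elim (use B in \<open>auto simp: abs_le_iff\<close>)
      have "continuous_on UNIV (poly p)" by (intro continuous_intros)
      then have "poly p \<in> borel_measurable borel" by (rule borel_measurable_continuous_onI)
      then show "poly p \<in> borel_measurable \<mu>" by simp
    qed
  qed
  then show "integrable \<mu> (poly p)" .
  \<comment> \<open>The arbitrary power of X strengthens the induction: multiplying c + X p by X^k
    leaves a pure power and p X^(k + 1).\<close>
  have "(\<integral>x. poly (p * [:0, 1:] ^ k) x \<partial>\<mu>) = L (p * [:0, 1:] ^ k)" for p k
  proof (induction p arbitrary: k)
    case 0 then show ?case using smult[of 0 0] by simp
  next
    case (pCons c p)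
    have eq: "pCons c p * [:0, 1:] ^ k = Polynomial.smult c ([:0, 1:] ^ k) + p * [:0, 1:] ^ Suc k"
      by simp
    have "(\<integral>x. poly (pCons c p * [:0, 1:] ^ k) x \<partial>\<mu>) =
        (\<integral>x. poly (Polynomial.smult c ([:0, 1:] ^ k)) x + poly (p * [:0, 1:] ^ Suc k) x \<partial>\<mu>)"
      unfolding eq by simp
    also have "\<dots> = (\<integral>x. poly (Polynomial.smult c ([:0, 1:] ^ k)) x \<partial>\<mu>) + (\<integral>x. poly (p * [:0, 1:] ^ Suc k) x \<partial>\<mu>)"
      by (intro Bochner_Integration.integral_add int)
    also have "\<dots> = c * L ([:0, 1:] ^ k) + L (p * [:0, 1:] ^ Suc k)"
      by (simp only: moment pCons.IH) simp
    also have "\<dots> = L (pCons c p * [:0, 1:] ^ k)"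
      unfolding eq add smult ..
    finally show ?case .
  qed
  from this[of p 0] show "(\<integral>x. poly p x \<partial>\<mu>) = L p" by simp
qed

section \<open>Laws of self-adjoint elements\<close>

text \<open>The evaluation homomorphism at \<open>a\<close> by Horner's scheme. Real coefficients
  commute with \<open>a\<close>, so it is multiplicative although the algebra need not be
  commutative, and they preserve self-adjointness.\<close>

definition alg_poly :: "'a::real_algebra_1 \<Rightarrow> real poly \<Rightarrow> 'a" where
  "alg_poly a p = fold_coeffs (\<lambda>c y. c *\<^sub>R 1 + a * y) p 0"

lemma alg_poly_0 [simp]: "alg_poly a 0 = 0"
  by (simp add: alg_poly_def)

lemma alg_poly_pCons [simp]: "alg_poly a (pCons c p) = c *\<^sub>R 1 + a * alg_poly a p"
  by (cases "c = 0 \<and> p = 0") (auto simp: alg_poly_def)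

lemma alg_poly_add: "alg_poly a (p + q) = alg_poly a p + alg_poly a q"
  by (induction p q rule: poly_induct2) (simp_all add: algebra_simps)

lemma alg_poly_smult: "alg_poly a (Polynomial.smult c p) = c *\<^sub>R alg_poly a p"
  by (induction p) (simp_all add: algebra_simps)

lemma alg_poly_mult: "alg_poly a (p * q) = alg_poly a p * alg_poly a q"
  by (induction p) (simp_all add: algebra_simps alg_poly_add alg_poly_smult)

lemma alg_poly_1 [simp]: "alg_poly a 1 = 1"
  by (simp add: one_pCons)

lemma alg_poly_power: "alg_poly a (p ^ k) = alg_poly a p ^ k"
  by (induction k) (simp_all add: alg_poly_mult)

lemma alg_poly_commute: "x * a = a * x \<Longrightarrow> x * alg_poly a p = alg_poly a p * x"
  by (induction p) (simp_all add: algebra_simps, metis mult.assoc)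

lemma self_adjoint_alg_poly:
  assumes "self_adjoint a"
  shows "self_adjoint (alg_poly a p)"
proof (induction p)
  case (pCons c p)
  then show ?case
    using assms alg_poly_commute[of a a p]
    by (auto intro!: self_adjoint_add self_adjoint_scaleR self_adjoint_1 self_adjoint_mult_commute)
qed (simp add: self_adjoint_0)

section \<open>Positivity and continuity of the trace, existence of laws\<close>

locale faithful_trace =
  fixes \<nu> :: "'a::cstar_algebra \<Rightarrow> complex"
  assumes faithful_tracial_state: "faithful_tracial_state \<nu>"
begin

lemma nu_add: "\<nu> (a + b) = \<nu> a + \<nu> b"
  and nu_scaleC: "\<nu> (scaleC c a) = c * \<nu> a"
  and nu_1 [simp]: "\<nu> 1 = 1"
  and nu_star_mult_self: "\<nu> (star a * a) \<in> \<real>\<^sub>\<ge>\<^sub>0"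
  and nu_faithful: "\<nu> (star a * a) = 0 \<Longrightarrow> a = 0"
  and nu_commute: "\<nu> (a * b) = \<nu> (b * a)"
  using faithful_tracial_state by (auto simp: faithful_tracial_state_def)

lemma nu_scaleR: "\<nu> (r *\<^sub>R a) = complex_of_real r * \<nu> a"
  by (metis nu_scaleC scaleC_of_real)

lemma nu_0 [simp]: "\<nu> 0 = 0"
  using nu_scaleC[of 0 0] by simp

lemma nu_minus: "\<nu> (- a) = - \<nu> a"
  using nu_scaleR[of "-1" a] by simp

lemma nu_diff: "\<nu> (a - b) = \<nu> a - \<nu> b"
  using nu_add[of a "- b"] by (simp add: nu_minus)

lemma nu_square_nonneg: "self_adjoint c \<Longrightarrow> \<nu> (c * c) \<in> \<real>\<^sub>\<ge>\<^sub>0"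
  using nu_star_mult_self[of c] by (simp add: self_adjoint_def)

lemma nu_square_eq_0: "self_adjoint c \<Longrightarrow> \<nu> (c * c) = 0 \<Longrightarrow> c = 0"
  using nu_faithful[of c] by (simp add: self_adjoint_def)

text \<open>Both \<open>1 - x\<close> and \<open>1 + x\<close> are squares of self-adjoint elements,
  so \<open>\<nu>\<close> is real and nonnegative on them.\<close>

lemma nu_self_adjoint_unit_ball:
  assumes "self_adjoint x" and "norm x \<le> 1"
  shows "Im (\<nu> x) = 0" and "\<bar>Re (\<nu> x)\<bar> \<le> 1"
proof -
  have *: "\<nu> (1 - y) \<in> \<real>\<^sub>\<ge>\<^sub>0" if "self_adjoint y" "norm y \<le> 1" for y
    using nu_square_nonneg[OF self_adjoint_sqrt_one_minus[OF that(2,1)]] sqrt_one_minus_square[OF that(2)]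
    by simp
  from *[of x] *[of "- x"] assms show "Im (\<nu> x) = 0" "\<bar>Re (\<nu> x)\<bar> \<le> 1"
    by (auto simp: self_adjoint_minus nu_diff nu_minus nu_add complex_nonneg_Reals_iff)
qed

lemma Im_nu_self_adjoint:
  assumes "self_adjoint x"
  shows "Im (\<nu> x) = 0"
proof (cases "x = 0")
  case False
  have "Im (\<nu> ((1 / norm x) *\<^sub>R x)) = 0"
    using assms by (intro nu_self_adjoint_unit_ball self_adjoint_scaleR) auto
  with False show ?thesis by (simp add: nu_scaleR)
qed simp

text \<open>After normalisation, the self-adjoint real and imaginary parts contribute at most 1
  each. The bound makes \<open>\<nu>\<close> continuous, and its factor 2 enters the constants of
  the free product estimate.\<close>

lemma norm_nu_le: "cmod (\<nu> x) \<le> 2 * norm x"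
proof (cases "x = 0")
  case False
  define y where "y = (1 / norm x) *\<^sub>R x"
  have y: "norm y = 1" using False by (simp add: y_def)
  define u where "u = (1/2) *\<^sub>R (y + star y)"
  define v where "v = scaleC (- \<i> / 2) (y - star y)"
  have u: "self_adjoint u" "norm u \<le> 1"
    using y norm_triangle_ineq[of y "star y"]
    by (auto simp: u_def self_adjoint_def star_scaleR star_add star_star add.commute)
  have v: "self_adjoint v" "norm v \<le> 1"
  proof -
    show "self_adjoint v"
      by (simp add: v_def self_adjoint_def star_scaleC star_diff star_star
          scaleC_diff_right scaleC_minus_left)
    show "norm v \<le> 1"
      using y norm_triangle_ineq4[of y "star y"] by (simp add: v_def norm_scaleC norm_divide)
  qed
  have "y = u + scaleC \<i> v"
  proof -
    have "scaleC \<i> v = (1/2) *\<^sub>R (y - star y)"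
      using scaleC_of_real[of "1/2" "y - star y"] by (simp add: v_def scaleC_scaleC)
    then have "u + scaleC \<i> v = (1/2) *\<^sub>R (y + star y + (y - star y))"
      by (simp only: u_def scaleR_right_distrib)
    also have "y + star y + (y - star y) = y + y" by simp
    finally show ?thesis by (simp only: scaleR_half_double)
  qed
  then have "cmod (\<nu> y) \<le> cmod (\<nu> u) + cmod (\<nu> v)"
    by (metis norm_ii norm_mult norm_triangle_ineq nu_add nu_scaleC mult_1)
  also have "\<dots> \<le> 2"
    using nu_self_adjoint_unit_ball[OF u] nu_self_adjoint_unit_ball[OF v] by (simp add: cmod_eq_Re)
  finally have "cmod (\<nu> y) \<le> 2" .
  moreover have "\<nu> x = complex_of_real (norm x) * \<nu> y"
    using False by (simp add: y_def nu_scaleR)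
  ultimately show ?thesis
    by (simp add: norm_mult mult.commute mult_left_mono)
qed simp

lemma bounded_linear_nu: "bounded_linear \<nu>"
  by (rule bounded_linear_intro[where K = 2])
    (simp_all add: nu_add nu_scaleR scaleR_conv_of_real[where 'a = complex]
      norm_nu_le[unfolded mult.commute[of 2]])

lemmas tendsto_nu = bounded_linear.tendsto[OF bounded_linear_nu]

text \<open>Rescaling moves \<open>a\<close> to \<open>b = (1 + t) / 2\<close>, where
  \<open>1 + t\<close> and \<open>1 - t\<close> have commuting self-adjoint roots \<open>q\<close>
  and \<open>r\<close>. Then \<open>b ^ j * (1 - b) ^ k\<close> is a positive multiple of the square
  of \<open>q ^ j * r ^ k\<close>, which is Hausdorff's positivity condition for the moments of
  \<open>b\<close>. The law of \<open>a\<close> is an affine image of the resulting measure on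
  [0, 1].\<close>

theorem has_law_exists:
  assumes sa: "self_adjoint a"
  shows "\<exists>\<mu>. has_law \<nu> a \<mu>"
proof -
  \<comment> \<open>The summand 1 only keeps the scale nonzero when \<open>a = 0\<close>.\<close>
  define R where "R = norm a + 1"
  have R: "R > 0" using norm_ge_zero[of a] unfolding R_def by linarith
  define t where "t = (1 / R) *\<^sub>R a"
  have t: "self_adjoint t" "norm t \<le> 1" and mt: "self_adjoint (- t)" "norm (- t) \<le> 1"
    using sa R by (auto simp: t_def self_adjoint_scaleR self_adjoint_minus R_def divide_le_eq_1)
  define q r where "q = sqrt_one_minus (- t)" and "r = sqrt_one_minus t"
  have qq: "q * q = 1 + t" and rr: "r * r = 1 - t"
    using sqrt_one_minus_square[OF t(2)] sqrt_one_minus_square[OF mt(2)] by (simp_all add: q_def r_def)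
  have qr_sa: "self_adjoint q" "self_adjoint r"
    unfolding q_def r_def by (intro self_adjoint_sqrt_one_minus t mt)+
  have "t * r = r * t" unfolding r_def by (rule sqrt_one_minus_commute[OF t(2)]) simp
  then have qr: "r * q = q * r"
    unfolding q_def by (intro sqrt_one_minus_commute[OF mt(2)]) simp
  define b where "b = (1/2) *\<^sub>R (1 + t)"
  have b': "1 - b = (1/2) *\<^sub>R (1 - t)"
  proof -
    have "(1/2) *\<^sub>R (1 + t) + (1/2) *\<^sub>R (1 - t) = (1/2) *\<^sub>R (1 + t + (1 - t))"
      by (simp only: scaleR_right_distrib)
    also have "1 + t + (1 - t) = 1 + 1" by simp
    finally show ?thesis unfolding b_def scaleR_half_double by (simp add: algebra_simps)
  qed
  define L where "L p = Re (\<nu> (alg_poly b p))" for p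
  have L_of_real: "\<nu> (alg_poly b p) = complex_of_real (L p)" for p
    using Im_nu_self_adjoint[OF self_adjoint_alg_poly, of b p] t
    by (simp add: L_def complex_eq_iff b_def self_adjoint_scaleR self_adjoint_add self_adjoint_1)
  have pos: "0 \<le> L ([:0, 1:] ^ j * [:1, - 1:] ^ k)" for j k
  proof -
    define c where "c = q ^ j * r ^ k"
    have comm: "r ^ k * q ^ j = q ^ j * r ^ k"
      by (metis power_commuting_commutes qr)
    have square_power: "(y * y) ^ i = y ^ i * y ^ i" for y :: 'a and i
      by (metis mult_2 power2_eq_square power_add power_mult)
    have sc: "self_adjoint c"
      unfolding c_def using comm by (intro self_adjoint_mult_commute self_adjoint_power qr_sa) simp
    have "c * c = q ^ j * (r ^ k * q ^ j) * r ^ k" by (simp only: c_def mult.assoc)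
    also have "\<dots> = q ^ j * q ^ j * (r ^ k * r ^ k)" by (simp only: comm mult.assoc)
    also have "\<dots> = (1 + t) ^ j * (1 - t) ^ k"
      unfolding qq[symmetric] rr[symmetric] square_power ..
    finally have "c * c = (1 + t) ^ j * (1 - t) ^ k" .
    then have "alg_poly b ([:0, 1:] ^ j * [:1, - 1:] ^ k) = ((1/2) ^ j * (1/2) ^ k) *\<^sub>R (c * c)"
    proof -
      assume cc: "c * c = (1 + t) ^ j * (1 - t) ^ k"
      have ev: "alg_poly b [:0, 1:] = (1/2) *\<^sub>R (1 + t)" "alg_poly b [:1, - 1:] = (1/2) *\<^sub>R (1 - t)"
        by (simp_all add: b'[symmetric]) (simp only: b_def)
      show ?thesis unfolding alg_poly_mult alg_poly_power ev scaleR_power cc by simp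
    qed
    then show ?thesis
      using nu_square_nonneg[OF sc] by (simp add: L_def nu_scaleR complex_nonneg_Reals_iff)
  qed
  obtain \<mu> where rd: "real_distribution \<mu>" and supp: "AE x in \<mu>. 0 \<le> x \<and> x \<le> 1"
    and moment: "\<And>k. (\<integral>x. x ^ k \<partial>\<mu>) = L ([:0, 1:] ^ k)"
    using pos by (rule hausdorff_moment_problem[of L, rotated 3])
      (simp_all add: L_def alg_poly_add alg_poly_smult nu_add nu_scaleR)
  interpret real_distribution \<mu> by fact
  have "AE x in \<mu>. \<bar>x\<bar> \<le> 1" using supp by eventually_elim auto
  from poly_functional_eq_integral(2)[OF rd this, of L] moment
  have integral_poly: "(\<integral>x. poly p x \<partial>\<mu>) = L p" for p
    by (simp add: L_def alg_poly_add alg_poly_smult nu_add nu_scaleR)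
  have "has_law \<nu> a (distr \<mu> borel (\<lambda>x. R * (2 * x - 1)))"
    unfolding has_law_def
  proof (intro conjI allI exI)
    show "real_distribution (distr \<mu> borel (\<lambda>x. R * (2 * x - 1)))"
      by (rule real_distribution_distr) simp
    show "AE x in distr \<mu> borel (\<lambda>x. R * (2 * x - 1)). \<bar>x\<bar> \<le> R"
    proof (subst AE_distr_iff)
      show "AE x in \<mu>. \<bar>R * (2 * x - 1)\<bar> \<le> R"
        using supp
      proof eventually_elim
        case (elim x)
        then have "\<bar>2 * x - 1\<bar> \<le> 1" by auto
        then have "R * \<bar>2 * x - 1\<bar> \<le> R * 1" using R by (intro mult_left_mono) auto
        then show ?case using R by (simp add: abs_mult)
      qed
    qed auto
    fix k
    have "a = R *\<^sub>R t" using R by (simp add: t_def)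
    also have "t = 2 *\<^sub>R b - 1" by (simp add: b_def)
    finally have a_eq: "a = R *\<^sub>R (2 *\<^sub>R b - 1)" .
    have "alg_poly b [:- R, 2 * R:] = a"
      unfolding a_eq by (simp add: scaleR_right_diff_distrib mult.commute)
    then have "\<nu> (a ^ k) = complex_of_real (L ([:- R, 2 * R:] ^ k))"
      by (simp add: alg_poly_power flip: L_of_real)
    moreover have "poly ([:- R, 2 * R:] ^ k) = (\<lambda>x. (R * (2 * x - 1)) ^ k)"
      by (simp add: fun_eq_iff algebra_simps)
    then have "L ([:- R, 2 * R:] ^ k) = (\<integral>x. (R * (2 * x - 1)) ^ k \<partial>\<mu>)"
      by (simp only: integral_poly[symmetric])
    moreover have "\<dots> = (\<integral>x. x ^ k \<partial>distr \<mu> borel (\<lambda>x. R * (2 * x - 1)))"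
      by (subst integral_distr) auto
    ultimately show "\<nu> (a ^ k) = complex_of_real (\<integral>x. x ^ k \<partial>distr \<mu> borel (\<lambda>x. R * (2 * x - 1)))"
      by simp
  qed
  then show ?thesis by blast
qed

lemma has_law_law: "self_adjoint a \<Longrightarrow> has_law \<nu> a (law \<nu> a)"
  unfolding law_def by (rule someI_ex[OF has_law_exists])

end

section \<open>Positive square roots\<close>

lemma alg_poly_pcompose: "alg_poly a (pcompose p q) = alg_poly (alg_poly a q) p"
  by (induction p) (simp_all add: pcompose_pCons alg_poly_add alg_poly_mult)

lemma alg_poly_sum: "alg_poly a (\<Sum>i\<in>I. f i) = (\<Sum>i\<in>I. alg_poly a (f i))"
  by (induction I rule: infinite_finite_induct) (simp_all add: alg_poly_add)

text \<open>Here \<open>p\<close> is |v|, the root of 1 - (1 - v^2), and \<open>q\<close> is the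
  root of |v| = 1 - (1 - |v|); the series applies both times because 1 - v^2 and 1 - |v| lie in the
  unit ball. The last two clauses record what the series gives besides: \<open>q\<close> commutes
  with whatever commutes with \<open>v\<close>, and \<open>p\<close> is a norm limit of real
  polynomials in \<open>v\<close>.\<close>

lemma self_adjoint_absolute_value:
  fixes v :: "'a::cstar_algebra"
  assumes sa: "self_adjoint v" and v: "norm v \<le> 1"
  obtains p q where "self_adjoint p" and "self_adjoint q" and "q * q = p" and "p * p = v * v"
    and "\<And>y. y * v = v * y \<Longrightarrow> y * q = q * y"
    and "\<And>S. closed S \<Longrightarrow> range (alg_poly v) \<subseteq> S \<Longrightarrow> p \<in> S"
proof -
  define p where "p = sqrt_one_minus (1 - v * v)"
  define q where "q = sqrt_one_minus (1 - p)"
  note n1 = norm_one_minus_square_le[OF sa v]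
  have sa1: "self_adjoint (1 - v * v)"
    by (intro self_adjoint_diff self_adjoint_1 self_adjoint_mult_commute sa refl)
  have n2: "norm (1 - p) \<le> 1" unfolding p_def by (rule norm_one_minus_sqrt[OF n1])
  have sap: "self_adjoint p" unfolding p_def by (rule self_adjoint_sqrt_one_minus[OF n1 sa1])
  show ?thesis
  proof (rule that)
    show "self_adjoint p" by (rule sap)
    show "self_adjoint q"
      unfolding q_def by (intro self_adjoint_sqrt_one_minus[OF n2] self_adjoint_diff self_adjoint_1 sap)
    show "q * q = p" using sqrt_one_minus_square[OF n2] by (simp add: q_def)
    show "p * p = v * v" using sqrt_one_minus_square[OF n1] by (simp add: p_def)
    show "y * q = q * y" if y: "y * v = v * y" for y
    proof -
      have "y * (v * v) = v * v * y" by (metis mult.assoc y)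
      then have "y * p = p * y"
        unfolding p_def by (intro sqrt_one_minus_commute[OF n1]) (simp add: algebra_simps)
      then show ?thesis
        unfolding q_def by (intro sqrt_one_minus_commute[OF n2]) (simp add: algebra_simps)
    qed
    show "p \<in> S" if S: "closed S" "range (alg_poly v) \<subseteq> S" for S
      unfolding p_def
    proof (rule sqrt_one_minus_in_closed[OF n1 S(1)])
      fix m
      have "(\<Sum>k<m. sqrt_coeff k *\<^sub>R (1 - v * v) ^ k) =
          alg_poly v (\<Sum>k<m. Polynomial.smult (sqrt_coeff k) ([:1, 0, - 1:] ^ k))"
        by (simp add: alg_poly_sum alg_poly_smult alg_poly_power)
      then show "(\<Sum>k<m. sqrt_coeff k *\<^sub>R (1 - v * v) ^ k) \<in> S" using S by auto
    qed
  qed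
qed

context faithful_trace
begin

lemma has_law_poly:
  assumes "self_adjoint a" and "has_law \<nu> a \<mu>"
  shows "\<nu> (alg_poly a p) = complex_of_real (\<integral>x. poly p x \<partial>\<mu>)"
proof -
  obtain R where rd: "real_distribution \<mu>" and supp: "AE x in \<mu>. \<bar>x\<bar> \<le> R"
    and moment: "\<And>k. \<nu> (a ^ k) = complex_of_real (\<integral>x. x ^ k \<partial>\<mu>)"
    using assms by (auto simp: has_law_def)
  have "(\<integral>x. poly p x \<partial>\<mu>) = Re (\<nu> (alg_poly a p))"
    by (rule poly_functional_eq_integral(2)[OF rd supp])
      (simp_all add: alg_poly_add alg_poly_smult alg_poly_power nu_add nu_scaleR moment)
  then show ?thesis
    using Im_nu_self_adjoint[OF self_adjoint_alg_poly[OF assms(1)]] by (simp add: complex_eq_iff)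
qed

text \<open>The negative part \<open>n\<close> of \<open>s\<close> is a limit of real polynomials in \<open>s\<close>, whence
  \<open>\<nu> (n * s * n) \<ge> 0\<close>; as also \<open>\<nu> (n * s * n) \<le> 0\<close>, faithfulness forces \<open>n = 0\<close>.\<close>

theorem positive_square_root_exists:
  assumes sa: "self_adjoint s" and law: "has_law \<nu> s \<mu>" and pos: "AE x in \<mu>. 0 \<le> x"
  shows "\<exists>r. cstar_positive r \<and> r * r = s"
proof -
  define C where "C = norm s + 1"
  have C: "C > 0" using norm_ge_zero[of s] unfolding C_def by linarith
  define v where "v = (1 / C) *\<^sub>R s"
  have v: "self_adjoint v" "norm v \<le> 1"
    using sa C by (auto simp: v_def self_adjoint_scaleR C_def divide_le_eq_1)
  obtain p q where p: "self_adjoint p" and q: "self_adjoint q" and qq: "q * q = p"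
    and pp: "p * p = v * v" and comm: "\<And>y. y * v = v * y \<Longrightarrow> y * q = q * y"
    and appr: "\<And>S. closed S \<Longrightarrow> range (alg_poly v) \<subseteq> S \<Longrightarrow> p \<in> S"
    using self_adjoint_absolute_value[OF v] by metis
  define n where "n = p - v"
  have vq: "v * q = q * v" using comm[of v] by simp
  then have vp: "v * p = p * v" unfolding qq[symmetric] by (metis mult.assoc)
  have nq: "n * q = q * n" by (simp add: n_def algebra_simps vq) (simp add: qq[symmetric] mult.assoc)
  have n: "self_adjoint n" unfolding n_def by (intro self_adjoint_diff p v)
  have pn: "p * n = - (v * n)" by (simp add: n_def algebra_simps pp vp)
  have sub: "range (alg_poly v) \<subseteq> range (alg_poly s)"
  proof safe
    fix f
    have "alg_poly v f = alg_poly s (pcompose f [:0, 1 / C:])"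
      by (simp add: alg_poly_pcompose v_def)
    then show "alg_poly v f \<in> range (alg_poly s)" by simp
  qed
  have "n \<in> {y. 0 \<le> Re (\<nu> (y * v * y))}"
  proof -
    define S where "S = {y. 0 \<le> Re (\<nu> ((y - v) * v * (y - v)))}"
    have "p \<in> S"
    proof (rule appr)
      have "continuous_on UNIV (\<lambda>y. Re (\<nu> ((y - v) * v * (y - v))))"
        by (intro continuous_intros bounded_linear.continuous_on[OF bounded_linear_nu])
      then show "closed S" unfolding S_def by (intro closed_Collect_le) auto
      show "range (alg_poly v) \<subseteq> S"
      proof safe
        fix f
        \<comment> \<open>If f(v) - v = g(s), then g(s) v g(s) corresponds to x g(x)^2 / C under the
          law of \<open>s\<close>, which is nonnegative on its support.\<close>
        have "alg_poly v f - v = alg_poly v (f + [:0, - 1:])"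
          by (simp add: alg_poly_add)
        then obtain g where g: "alg_poly v f - v = alg_poly s g" using sub by (metis UNIV_I image_subset_iff imageE)
        have "(alg_poly v f - v) * v * (alg_poly v f - v) = alg_poly s (Polynomial.smult (1 / C) (g * [:0, 1:] * g))"
          unfolding g alg_poly_mult alg_poly_smult by (simp add: v_def)
        also have "Re (\<nu> \<dots>) = (\<integral>x. poly (Polynomial.smult (1 / C) (g * [:0, 1:] * g)) x \<partial>\<mu>)"
          by (simp only: has_law_poly[OF sa law] Re_complex_of_real)
        also have "\<dots> \<ge> 0"
          using pos by (intro integral_nonneg_AE, eventually_elim) (use C in auto)
        finally show "alg_poly v f \<in> S" by (simp add: S_def)
      qed
    qed
    then show ?thesis by (simp add: S_def n_def)
  qed
  \<comment> \<open>The opposite sign: \<open>p * p = v * v\<close> gives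
    \<open>p * n = - (v * n)\<close>, and \<open>p = q * q\<close> with \<open>q\<close> commuting
    with \<open>n\<close>.\<close>
  moreover have "n * v * n = - ((q * n) * (q * n))"
  proof -
    have "n * v * n = - (n * (p * n))" by (simp add: pn mult.assoc)
    also have "n * (p * n) = (n * q) * (q * n)" by (simp add: qq[symmetric] mult.assoc)
    finally show ?thesis by (simp add: nq)
  qed
  moreover have qn: "self_adjoint (q * n)"
    using q n nq by (intro self_adjoint_mult_commute) auto
  ultimately have "\<nu> ((q * n) * (q * n)) = 0"
    using nu_square_nonneg[OF qn] by (auto simp: nu_minus complex_nonneg_Reals_iff complex_eq_iff)
  then have "q * n = 0" by (rule nu_square_eq_0[OF qn])
  then have "p * n = 0" by (simp add: qq[symmetric] mult.assoc)
  then have "v * n = 0" using pn by simp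
  then have "n * n = 0" using \<open>p * n = 0\<close> by (simp add: n_def algebra_simps)
  then have "n = 0" using norm_self_adjoint_square[OF n] by simp
  then have "q * q = v" by (simp add: n_def qq)
  then have "norm q ^ 2 \<le> 1" using norm_self_adjoint_square[OF q] v by simp
  then have "norm q \<le> 1" by (simp add: power2_nonneg_ge_1_iff abs_square_le_1)
  \<comment> \<open>Although \<open>q * q = v\<close>, the root must be exhibited in the form
    \<open>star b * b\<close>. Replacing \<open>q\<close> by its absolute value \<open>r\<close>
    keeps the square and supplies \<open>b\<close> with \<open>r = b * b\<close>.\<close>
  from self_adjoint_absolute_value[OF q this]
  obtain r b where b: "self_adjoint b" "b * b = r" and r: "r * r = v"
    using \<open>q * q = v\<close> by metis
  show ?thesis
  proof (intro exI conjI)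
    show "cstar_positive (sqrt C *\<^sub>R r)"
      unfolding cstar_positive_def
    proof (rule exI)
      show "sqrt C *\<^sub>R r = star (sqrt (sqrt C) *\<^sub>R b) * (sqrt (sqrt C) *\<^sub>R b)"
        using b C by (simp add: star_scaleR self_adjoint_def)
    qed
    show "(sqrt C *\<^sub>R r) * (sqrt C *\<^sub>R r) = s"
      using C by (simp add: r) (simp add: v_def)
  qed
qed

lemma cstar_sqrt_square:
  assumes "self_adjoint s" and "has_law \<nu> s \<mu>" and "AE x in \<mu>. 0 \<le> x"
  shows "self_adjoint (cstar_sqrt s)" and "cstar_sqrt s * cstar_sqrt s = s"
proof -
  have "cstar_positive (cstar_sqrt s) \<and> cstar_sqrt s * cstar_sqrt s = s"
    unfolding cstar_sqrt_def by (rule someI_ex[OF positive_square_root_exists[OF assms]])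
  then show "self_adjoint (cstar_sqrt s)" "cstar_sqrt s * cstar_sqrt s = s"
    by (auto simp: cstar_positive_def self_adjoint_def star_mult star_star)
qed

end

section \<open>Moment series of free products\<close>

definition neumann_series :: "'a::cstar_algebra \<Rightarrow> 'a" where
  "neumann_series x = (\<Sum>k. x ^ k)"

context
  fixes x :: "'a::cstar_algebra"
  assumes norm_less_1: "norm x < 1"
begin

lemma summable_neumann: "summable (\<lambda>k. x ^ k)"
  by (rule complete_algebra_summable_geometric[OF norm_less_1])

lemma neumann_series_eq: "neumann_series x = 1 + x * neumann_series x"
proof -
  have "neumann_series x = x ^ 0 + (\<Sum>k. x ^ Suc k)"
    unfolding neumann_series_def using suminf_split_head[OF summable_neumann] by simp
  then show ?thesis
    by (simp add: neumann_series_def suminf_mult[OF summable_neumann])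
qed

lemma neumann_series_commute: "x * neumann_series x = neumann_series x * x"
  unfolding neumann_series_def
  by (simp add: suminf_mult[OF summable_neumann, symmetric] suminf_mult2[OF summable_neumann] power_commutes)

lemma one_minus_mult_neumann: "(1 - x) * neumann_series x = 1"
  and neumann_mult_one_minus: "neumann_series x * (1 - x) = 1"
  using neumann_series_eq neumann_series_commute
  by (simp_all add: algebra_simps)

lemma neumann_series_unique:
  assumes "(1 - x) * e = 1"
  shows "e = neumann_series x"
proof -
  have "e = neumann_series x * (1 - x) * e" by (simp only: neumann_mult_one_minus mult_1_left)
  also have "\<dots> = neumann_series x * ((1 - x) * e)" by (rule mult.assoc)
  finally show ?thesis using assms by simp
qed

end

lemma norm_neumann_minus_1:
  assumes "norm x \<le> 1/2"
  shows "norm (neumann_series x - 1) \<le> 2 * norm x"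
proof -
  have x: "norm x < 1" using assms by simp
  define y where "y = neumann_series x - 1"
  have "y = x + x * y" using neumann_series_eq[OF x] by (simp add: y_def algebra_simps)
  then have "norm y \<le> norm x + norm x * norm y"
    by (metis norm_mult_ineq norm_triangle_le add_left_mono)
  also have "norm x * norm y \<le> 1/2 * norm y" using assms by (intro mult_right_mono) auto
  finally show ?thesis by (simp add: y_def)
qed

lemma add_scalar_mult_add_scalar:
  "(scaleC p 1 + x) * (scaleC p 1 + y) = scaleC (p\<^sup>2) 1 + scaleC p x + scaleC p y + x * y"
  by (simp add: distrib_left distrib_right scaleC_mult_left scaleC_mult_right scaleC_add_right
      scaleC_scaleC power2_eq_square add.assoc)

section \<open>Generated subalgebras, their closures and alternating words\<close>

lemma unital_subalgebra_generated: "unital_subalgebra (generated_subalgebra S)"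
  unfolding generated_subalgebra_def unital_subalgebra_def by auto

lemma generated_subalgebra_superset: "S \<subseteq> generated_subalgebra S"
  unfolding generated_subalgebra_def by auto

lemma generated_subalgebra_least: "unital_subalgebra A \<Longrightarrow> S \<subseteq> A \<Longrightarrow> generated_subalgebra S \<subseteq> A"
  unfolding generated_subalgebra_def by auto

lemma generated_subalgebra_closed:
  shows "1 \<in> generated_subalgebra S"
    and "x \<in> generated_subalgebra S \<Longrightarrow> y \<in> generated_subalgebra S \<Longrightarrow> x + y \<in> generated_subalgebra S"
    and "x \<in> generated_subalgebra S \<Longrightarrow> y \<in> generated_subalgebra S \<Longrightarrow> x * y \<in> generated_subalgebra S"
    and "x \<in> generated_subalgebra S \<Longrightarrow> scaleC c x \<in> generated_subalgebra S"
  using unital_subalgebra_generated[of S] unfolding unital_subalgebra_def by auto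

lemma generated_subalgebra_translate: "generated_subalgebra {a - 1} = generated_subalgebra {a}"
proof -
  have *: "b + scaleC c 1 \<in> generated_subalgebra {b}" for b :: 'a and c
    using generated_subalgebra_superset[of "{b}"] by (auto intro!: generated_subalgebra_closed)
  have "generated_subalgebra {b + scaleC c 1} \<subseteq> generated_subalgebra {b}" for b :: 'a and c
    using * by (intro generated_subalgebra_least unital_subalgebra_generated) auto
  from this[of a "-1"] this[of "a - 1" 1] show ?thesis
    by (intro equalityI) (simp_all add: scaleC_minus_left)
qed

text \<open>Freeness speaks of the algebraically generated subalgebras, while resolvents lie only in
  their norm closures; vanishing of traces of alternating words is therefore extended to the
  closures by continuity.\<close>

lemma neumann_series_in_closure:
  assumes "norm (scaleC c a) < 1"
  shows "neumann_series (scaleC c a) \<in> closure (generated_subalgebra {a})"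
proof (rule closed_sequentially[OF closed_closure])
  show "(\<lambda>m. \<Sum>k<m. scaleC c a ^ k) \<longlonglongrightarrow> neumann_series (scaleC c a)"
    unfolding neumann_series_def by (rule summable_LIMSEQ[OF summable_neumann[OF assms]])
  have a: "scaleC c a \<in> generated_subalgebra {a}"
    using generated_subalgebra_superset[of "{a}"] by (auto intro: generated_subalgebra_closed)
  have power: "scaleC c a ^ k \<in> generated_subalgebra {a}" for k
    by (induction k) (auto intro: generated_subalgebra_closed a)
  have zero: "0 \<in> generated_subalgebra {a}"
    using generated_subalgebra_closed(4)[OF generated_subalgebra_closed(1), of 0] by simp
  have "(\<Sum>k<m. scaleC c a ^ k) \<in> generated_subalgebra {a}" for m
    by (induction m) (auto intro: generated_subalgebra_closed zero power)
  then show "(\<Sum>k<m. scaleC c a ^ k) \<in> closure (generated_subalgebra {a})" for m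
    using closure_subset by blast
qed

lemma closure_generated_add_scalar:
  assumes "x \<in> closure (generated_subalgebra S)"
  shows "x + scaleC c 1 \<in> closure (generated_subalgebra S)"
proof -
  obtain f where f: "\<And>m. f m \<in> generated_subalgebra S" "f \<longlonglongrightarrow> x"
    using assms unfolding closure_sequential by blast
  have "(\<lambda>m. f m + scaleC c 1) \<longlonglongrightarrow> x + scaleC c 1" by (intro tendsto_intros f)
  moreover have "f m + scaleC c 1 \<in> generated_subalgebra S" for m
    by (intro generated_subalgebra_closed f)
  ultimately show ?thesis
    unfolding closure_sequential by (intro exI[of _ "\<lambda>m. f m + scaleC c 1"]) auto
qed

text \<open>The tags are the indices used in \<open>freely_independent\<close>: \<open>True\<close>
  for the first variable.\<close>

definition alternating_word :: "'a \<Rightarrow> 'a \<Rightarrow> nat \<Rightarrow> (bool \<times> 'a) list" where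
  "alternating_word x y k = concat (replicate k [(True, x), (False, y)])"

lemma alternating_word:
  fixes x y :: "'a::monoid_mult"
  shows "prod_list (map snd (alternating_word x y k)) = (x * y) ^ k"
    and "distinct_adj (map fst (alternating_word x y k @ [(True, x)]))"
    and "distinct_adj (map fst ((False, y) # alternating_word x y k))"
    and "set (alternating_word x y k) \<subseteq> {(True, x), (False, y)}"
proof -
  have Suc: "alternating_word x y (Suc k) = (True, x) # (False, y) # alternating_word x y k" for k
    by (simp add: alternating_word_def)
  have 0: "alternating_word x y 0 = []" by (simp add: alternating_word_def)
  show "prod_list (map snd (alternating_word x y k)) = (x * y) ^ k"
    by (induction k) (simp_all add: Suc 0 mult.assoc)
  show "set (alternating_word x y k) \<subseteq> {(True, x), (False, y)}"
    by (induction k) (simp_all add: Suc 0)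
  show "distinct_adj (map fst (alternating_word x y k @ [(True, x)]))"
    by (induction k) (simp_all add: Suc 0, metis (no_types, lifting) Suc 0 append_Cons append_Nil distinct_adj_Cons fst_conv hd_append2 list.map(2) list.sel(1) list.distinct(1) not0_implies_Suc list.map_disc_iff)
  show "distinct_adj (map fst ((False, y) # alternating_word x y k))"
    by (induction k) (simp_all add: Suc 0)
qed

context faithful_trace
begin

text \<open>These are the shapes that arise, up to cyclic permutation, when the Neumann series in
  \<open>x * y\<close> multiplies 1, \<open>x\<close>, \<open>y\<close> or \<open>x * y\<close>. The
  first has exponent \<open>Suc k\<close> because the empty word has trace 1; the other two are
  nonempty already for \<open>k = 0\<close>.\<close>

lemma free_words:
  assumes free: "freely_independent \<nu> a b"
    and x: "x \<in> generated_subalgebra {a}" "\<nu> x = 0"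
    and y: "y \<in> generated_subalgebra {b}" "\<nu> y = 0"
  shows "\<nu> ((x * y) ^ Suc k) = 0" and "\<nu> ((x * y) ^ k * x) = 0" and "\<nu> (y * (x * y) ^ k) = 0"
proof -
  have F: "\<nu> (prod_list (map snd w)) = 0"
    if "w \<noteq> []" "distinct_adj (map fst w)" "set w \<subseteq> {(True, x), (False, y)}" for w
  proof -
    have "\<forall>(i, z)\<in>set w. i \<in> UNIV \<and> z \<in> generated_subalgebra {if i then a else b} \<and> \<nu> z = 0"
      using that(3) x y by auto
    then show ?thesis
      using free that(1,2) unfolding freely_independent_def free_subalgebras_def by blast
  qed
  note w = alternating_word[where x = x and y = y]
  have "distinct_adj (map fst (alternating_word x y (Suc k)))"
    using w(2)[of "Suc k"] by (simp add: distinct_adj_append_iff)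
  from F[OF _ this w(4)] show "\<nu> ((x * y) ^ Suc k) = 0"
    unfolding w(1) by (simp add: alternating_word_def)
  have "set (alternating_word x y k @ [(True, x)]) \<subseteq> {(True, x), (False, y)}" using w(4)[of k] by simp
  from F[OF _ w(2) this] show "\<nu> ((x * y) ^ k * x) = 0" by (simp add: w(1))
  have "set ((False, y) # alternating_word x y k) \<subseteq> {(True, x), (False, y)}" using w(4)[of k] by simp
  from F[OF _ w(3) this] show "\<nu> (y * (x * y) ^ k) = 0" by (simp add: w(1))
qed

text \<open>The traces of the approximants tend to 0, so subtracting them changes neither the limit
  nor the membership in the subalgebra.\<close>

lemma centered_approximation:
  assumes "x \<in> closure (generated_subalgebra S)" and "\<nu> x = 0"
  obtains f where "\<And>m. f m \<in> generated_subalgebra S" and "\<And>m. \<nu> (f m) = 0" and "f \<longlonglongrightarrow> x"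
proof -
  obtain f where f: "\<And>m. f m \<in> generated_subalgebra S" "f \<longlonglongrightarrow> x"
    using assms unfolding closure_sequential by blast
  define g where "g m = f m + scaleC (- \<nu> (f m)) 1" for m
  show ?thesis
  proof (rule that)
    show "g m \<in> generated_subalgebra S" for m
      unfolding g_def by (intro generated_subalgebra_closed f)
    show "\<nu> (g m) = 0" for m by (simp add: g_def nu_add nu_scaleC)
    have "(\<lambda>m. norm (\<nu> (f m))) \<longlonglongrightarrow> 0"
      using tendsto_norm[OF tendsto_nu[OF f(2)]] assms by simp
    then have "(\<lambda>m. scaleC (- \<nu> (f m)) 1 :: 'a) \<longlonglongrightarrow> 0"
      by (subst tendsto_norm_zero_iff[symmetric]) (simp add: norm_scaleC)
    from tendsto_add[OF f(2) this] show "g \<longlonglongrightarrow> x" by (simp add: g_def[abs_def])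
  qed
qed

lemma free_words_closure:
  assumes free: "freely_independent \<nu> a b"
    and x: "x \<in> closure (generated_subalgebra {a})" "\<nu> x = 0"
    and y: "y \<in> closure (generated_subalgebra {b})" "\<nu> y = 0"
  shows "\<nu> ((x * y) ^ Suc k) = 0" and "\<nu> ((x * y) ^ k * x) = 0" and "\<nu> (y * (x * y) ^ k) = 0"
proof -
  obtain f where f: "\<And>m. f m \<in> generated_subalgebra {a}" "\<And>m. \<nu> (f m) = 0" "f \<longlonglongrightarrow> x"
    using centered_approximation[OF x] by blast
  obtain g where g: "\<And>m. g m \<in> generated_subalgebra {b}" "\<And>m. \<nu> (g m) = 0" "g \<longlonglongrightarrow> y"
    using centered_approximation[OF y] by blast
  note words = free_words[OF free f(1,2) g(1,2)]
  have "(\<lambda>m. \<nu> ((f m * g m) ^ Suc k)) \<longlonglongrightarrow> \<nu> ((x * y) ^ Suc k)"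
    by (intro tendsto_nu tendsto_power tendsto_mult f g)
  then show "\<nu> ((x * y) ^ Suc k) = 0"
    unfolding words by (simp add: LIMSEQ_const_iff)
  have "(\<lambda>m. \<nu> ((f m * g m) ^ k * f m)) \<longlonglongrightarrow> \<nu> ((x * y) ^ k * x)"
    by (intro tendsto_nu tendsto_power tendsto_mult f g)
  then show "\<nu> ((x * y) ^ k * x) = 0"
    unfolding words by (simp add: LIMSEQ_const_iff)
  have "(\<lambda>m. \<nu> (g m * (f m * g m) ^ k)) \<longlonglongrightarrow> \<nu> (y * (x * y) ^ k)"
    by (intro tendsto_nu tendsto_power tendsto_mult f g)
  then show "\<nu> (y * (x * y) ^ k) = 0"
    unfolding words by (simp add: LIMSEQ_const_iff)
qed

lemma free_nu_mult:
  assumes "freely_independent \<nu> a b"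
  shows "\<nu> (a * b) = \<nu> a * \<nu> b"
proof -
  have gen: "c \<in> generated_subalgebra {c}" for c :: 'a
    using generated_subalgebra_superset[of "{c}"] by simp
  have "\<nu> (((a + scaleC (- \<nu> a) 1) * (b + scaleC (- \<nu> b) 1)) ^ Suc 0) = 0"
    by (rule free_words(1)[OF assms]) (auto intro!: generated_subalgebra_closed gen simp: nu_add nu_scaleC)
  then show ?thesis
    by (simp add: algebra_simps scaleC_mult_left scaleC_mult_right nu_add nu_diff nu_scaleC scaleC_minus_left)
qed

lemma moment_series_resolvent:
  assumes "cmod z * norm a < 1"
  shows "\<nu> (neumann_series (scaleC z a)) = 1 + moment_series \<nu> a z"
proof -
  have n: "norm (scaleC z a) < 1" using assms by (simp add: norm_scaleC)
  note s = summable_neumann[OF n]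
  have eq: "\<nu> (scaleC z a ^ k) = \<nu> (a ^ k) * z ^ k" for k
    by (simp add: scaleC_power nu_scaleC)
  have "\<nu> (neumann_series (scaleC z a)) = (\<Sum>k. \<nu> (a ^ k) * z ^ k)"
    unfolding neumann_series_def bounded_linear.suminf[OF bounded_linear_nu s] eq ..
  also have "\<dots> = \<nu> (a ^ 0) * z ^ 0 + moment_series \<nu> a z"
    using suminf_split_head[OF bounded_linear.summable[OF bounded_linear_nu s, unfolded eq]]
    by (simp add: moment_series_def)
  finally show ?thesis by simp
qed

text \<open>Haagerup's argument: if \<open>A\<close> and \<open>B\<close> are the resolvents of \<open>a\<close> and \<open>b\<close> at points where the
  moment series both equal \<open>u\<close>, and \<open>x\<close>, \<open>y\<close> are their centered parts, then
  \<open>A (1 - w a b) B = (1 + u) (1 - x y / (u (1 + u)))\<close>, and inverting the right-hand side by a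
  Neumann series produces only alternating words in \<open>x\<close> and \<open>y\<close>.\<close>

theorem moment_series_free_product:
  assumes free: "freely_independent \<nu> a b"
    and u: "u \<noteq> 0" "cmod u \<le> 1/2"
    and \<alpha>: "cmod \<alpha> * norm a \<le> 1/2" "moment_series \<nu> a \<alpha> = u"
    and \<beta>: "cmod \<beta> * norm b \<le> 1/2" "moment_series \<nu> b \<beta> = u"
    and w: "w = (1 + u) * \<alpha> * \<beta> / u" "144 * cmod w * (norm a * norm b) < 1"
  shows "moment_series \<nu> (a * b) w = u"
proof -
  have "cmod (1 + u) \<ge> 1 - cmod u" using norm_diff_ineq[of 1 u] by simp
  then have u1: "cmod (1 + u) \<ge> 1/2" using u by linarith
  then have u1': "1 + u \<noteq> 0" by force
  define A where "A = neumann_series (scaleC \<alpha> a)"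
  define B where "B = neumann_series (scaleC \<beta> b)"
  have na: "norm (scaleC \<alpha> a) \<le> 1/2" "norm (scaleC \<alpha> a) < 1"
    and nb: "norm (scaleC \<beta> b) \<le> 1/2" "norm (scaleC \<beta> b) < 1" using \<alpha> \<beta> by (auto simp: norm_scaleC)
  have \<nu>A: "\<nu> A = 1 + u" using moment_series_resolvent[of \<alpha> a] \<alpha> by (simp add: A_def)
  have \<nu>B: "\<nu> B = 1 + u" using moment_series_resolvent[of \<beta> b] \<beta> by (simp add: B_def)
  define x where "x = A + scaleC (- (1 + u)) 1"
  define y where "y = B + scaleC (- (1 + u)) 1"
  have x: "x \<in> closure (generated_subalgebra {a})" "\<nu> x = 0"
    unfolding x_def A_def
    by (intro closure_generated_add_scalar neumann_series_in_closure na)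
      (use \<nu>A in \<open>simp add: A_def nu_add nu_scaleC\<close>)
  have y: "y \<in> closure (generated_subalgebra {b})" "\<nu> y = 0"
    unfolding y_def B_def
    by (intro closure_generated_add_scalar neumann_series_in_closure nb)
      (use \<nu>B in \<open>simp add: B_def nu_add nu_scaleC\<close>)
  note words = free_words_closure[OF free x y]
  \<comment> \<open>The constant is 2 + 4: \<open>R - 1\<close> has norm at most 2 |c| norm d, and
    its trace \<open>u\<close> is at most twice that in modulus.\<close>
  have norm_centered: "norm (R + scaleC (- (1 + u)) 1) \<le> 6 * (cmod c * norm d)"
    if "R = neumann_series (scaleC c d)" "norm (scaleC c d) \<le> 1/2" "\<nu> R = 1 + u" for R c d
  proof -
    have 1: "norm (R - 1) \<le> 2 * (cmod c * norm d)"
      using norm_neumann_minus_1[OF that(2)] that(1) by (simp add: norm_scaleC)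
    have "\<nu> (R - 1) = u" using that by (simp add: nu_diff)
    then have 2: "cmod u \<le> 2 * norm (R - 1)" using norm_nu_le[of "R - 1"] by simp
    have "R + scaleC (- (1 + u)) 1 = R - 1 - scaleC u 1"
      by (simp add: scaleC_minus_left scaleC_diff_left scaleC_add_left)
    moreover have "norm (R - 1 - scaleC u 1) \<le> norm (R - 1) + cmod u"
      using norm_triangle_ineq4[of "R - 1" "scaleC u 1"] by (simp add: norm_scaleC)
    ultimately have "norm (R + scaleC (- (1 + u)) 1) \<le> norm (R - 1) + cmod u" by (simp only:)
    with 1 2 show ?thesis by linarith
  qed
  define \<delta> where "\<delta> = 1 / (u * (1 + u))"
  have small: "norm (scaleC \<delta> (x * y)) < 1"
  proof -
    have "norm (x * y) \<le> (6 * (cmod \<alpha> * norm a)) * (6 * (cmod \<beta> * norm b))"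
      unfolding x_def y_def
      by (rule order_trans[OF norm_mult_ineq])
        (intro mult_mono norm_centered A_def B_def na nb \<nu>A \<nu>B; simp)
    then have "norm (scaleC \<delta> (x * y)) \<le> cmod \<delta> * ((6 * (cmod \<alpha> * norm a)) * (6 * (cmod \<beta> * norm b)))"
      by (simp add: norm_scaleC mult_left_mono)
    also have "\<dots> = 36 * cmod w * (norm a * norm b) / (cmod (1 + u))\<^sup>2"
      using u u1' by (simp add: \<delta>_def w norm_mult norm_divide power2_eq_square)
    \<comment> \<open>Two factors 6 give 36, and |1 + u| \<ge> 1/2 costs a further factor 4: this is
      the origin of 144.\<close>
    also have "\<dots> \<le> 36 * cmod w * (norm a * norm b) / (1/2)\<^sup>2"
      using u1 by (intro divide_left_mono power_mono) (auto simp: u1')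
    also have "\<dots> < 1" using w(2) by (simp add: power2_eq_square)
    finally show ?thesis .
  qed
  define T where "T = neumann_series (scaleC \<delta> (x * y))"
  define D where "D = 1 - scaleC \<delta> (x * y)"
  have DT: "D * T = 1" unfolding D_def T_def by (rule one_minus_mult_neumann[OF small])
  \<comment> \<open>Since A (\<alpha> a) = A - 1 and (\<beta> b) B = B - 1, the product A Z B equals
    A B - \<kappa> (A - 1)(B - 1). This value of \<kappa> is the one that cancels the terms linear
    in \<open>x\<close> and \<open>y\<close>.\<close>
  define \<kappa> where "\<kappa> = (1 + u) / u"
  define Z where "Z = 1 - scaleC w (a * b)"
  have AB: "A * B = scaleC ((1 + u)\<^sup>2) 1 + scaleC (1 + u) x + scaleC (1 + u) y + x * y"
  proof -
    have "A = scaleC (1 + u) 1 + x" "B = scaleC (1 + u) 1 + y"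
      unfolding x_def y_def scaleC_minus_left by simp_all
    then show ?thesis by (simp only: add_scalar_mult_add_scalar)
  qed
  have AB1: "(A - 1) * (B - 1) = scaleC (u\<^sup>2) 1 + scaleC u x + scaleC u y + x * y"
  proof -
    have "A - 1 = scaleC u 1 + x" "B - 1 = scaleC u 1 + y"
      unfolding x_def y_def scaleC_minus_left scaleC_add_left by simp_all
    then show ?thesis by (simp only: add_scalar_mult_add_scalar)
  qed
  have AZB: "A * Z * B = scaleC (1 + u) D"
  proof -
    have Aa: "A * scaleC \<alpha> a = A - 1"
      using neumann_mult_one_minus[OF na(2)] by (simp add: A_def algebra_simps)
    have Bb: "scaleC \<beta> b * B = B - 1"
      using one_minus_mult_neumann[OF nb(2)] by (simp add: B_def algebra_simps)
    have "scaleC w (a * b) = scaleC \<kappa> (scaleC \<alpha> a * scaleC \<beta> b)"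
      by (simp add: w \<kappa>_def scaleC_mult_left scaleC_mult_right scaleC_scaleC mult_ac)
    then have "A * Z * B = A * B - A * scaleC \<kappa> (scaleC \<alpha> a * scaleC \<beta> b) * B"
      by (simp add: Z_def algebra_simps)
    also have "A * scaleC \<kappa> (scaleC \<alpha> a * scaleC \<beta> b) * B = scaleC \<kappa> ((A * scaleC \<alpha> a) * (scaleC \<beta> b * B))"
      by (simp only: scaleC_mult_left scaleC_mult_right mult.assoc)
    also have "\<dots> = scaleC (\<kappa> * u\<^sup>2) 1 + scaleC (\<kappa> * u) x + scaleC (\<kappa> * u) y + scaleC \<kappa> (x * y)"
      unfolding Aa Bb AB1 scaleC_add_right scaleC_scaleC ..
    finally have "A * Z * B = A * B - (scaleC (\<kappa> * u\<^sup>2) 1 + scaleC (\<kappa> * u) x + scaleC (\<kappa> * u) y + scaleC \<kappa> (x * y))" .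
    also have "\<kappa> * u = 1 + u" using u by (simp add: \<kappa>_def)
    also have "A * B - (scaleC (\<kappa> * u\<^sup>2) 1 + scaleC (1 + u) x + scaleC (1 + u) y + scaleC \<kappa> (x * y)) =
        scaleC ((1 + u)\<^sup>2 - \<kappa> * u\<^sup>2) 1 - scaleC (\<kappa> - 1) (x * y)"
      unfolding AB scaleC_diff_left scaleC_one by (simp add: algebra_simps)
    also have "(1 + u)\<^sup>2 - \<kappa> * u\<^sup>2 = 1 + u"
      using u by (simp add: \<kappa>_def power2_eq_square field_simps)
    also have "\<kappa> - 1 = (1 + u) * \<delta>"
    proof -
      have "\<kappa> - 1 = 1 / u" using u by (simp add: \<kappa>_def add_divide_distrib)
      also have "\<dots> = (1 + u) * \<delta>" using u1' by (simp add: \<delta>_def)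
      finally show ?thesis .
    qed
    finally show ?thesis by (simp add: D_def scaleC_diff_right scaleC_scaleC)
  qed
  \<comment> \<open>The inverse of \<open>Z\<close> suggested by A Z B = (1 + u) D and D T =
    1.\<close>
  define E where "E = scaleC (1 / (1 + u)) (B * T * A)"
  have "Z * E = 1"
  proof -
    have "A * (Z * E) = scaleC (1 / (1 + u)) (A * Z * B * (T * A))"
      by (simp add: E_def scaleC_mult_right mult.assoc)
    also have "\<dots> = D * T * A"
      unfolding AZB using u1' by (simp add: scaleC_mult_left scaleC_scaleC mult.assoc)
    finally have "A * (Z * E) = A" by (simp add: DT)
    then have "(1 - scaleC \<alpha> a) * A * (Z * E) = (1 - scaleC \<alpha> a) * A" by (simp add: mult.assoc)
    then show ?thesis using one_minus_mult_neumann[OF na(2)] by (simp add: A_def)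
  qed
  moreover have w_small: "cmod w * norm (a * b) < 1"
  proof -
    have "cmod w * norm (a * b) \<le> cmod w * (norm a * norm b)"
      by (intro mult_left_mono norm_mult_ineq) auto
    also have "\<dots> \<le> 144 * cmod w * (norm a * norm b)" by simp
    finally show ?thesis using w(2) by linarith
  qed
  ultimately have E: "E = neumann_series (scaleC w (a * b))"
    by (intro neumann_series_unique) (auto simp: Z_def norm_scaleC)
  have nuT: "\<nu> (T * z) = \<nu> z" if z: "\<And>k. \<nu> ((x * y) ^ Suc k * z) = 0" for z
  proof -
    note s = summable_neumann[OF small]
    have "\<nu> (T * z) = (\<Sum>k. \<nu> (scaleC \<delta> (x * y) ^ k * z))"
      unfolding T_def neumann_series_def suminf_mult2[OF s]
      by (rule bounded_linear.suminf[OF bounded_linear_nu summable_mult2[OF s]])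
    also have "\<dots> = (\<Sum>k\<in>{0}. \<nu> (scaleC \<delta> (x * y) ^ k * z))"
    proof (rule suminf_finite)
      show "\<nu> (scaleC \<delta> (x * y) ^ k * z) = 0" if k0: "k \<notin> {0}" for k
      proof -
        obtain j where k: "k = Suc j" using k0 by (cases k) auto
        show ?thesis unfolding scaleC_power scaleC_mult_left nu_scaleC k z by simp
      qed
    qed simp
    finally show ?thesis by simp
  qed
  \<comment> \<open>The trace property brings \<open>A\<close> and \<open>B\<close> together; by
    freeness only the scalar term of their expanded product contributes.\<close>
  have "\<nu> (B * T * A) = \<nu> (T * (A * B))"
    using nu_commute[of B "T * A"] by (simp add: mult.assoc)
  also have "\<dots> = (1 + u)\<^sup>2 * \<nu> (T * 1) + (1 + u) * \<nu> (T * x) + (1 + u) * \<nu> (T * y) + \<nu> (T * (x * y))"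
    unfolding AB by (simp add: distrib_left scaleC_mult_right nu_add nu_scaleC)
  also have "\<nu> (T * 1) = 1" using nuT[of 1] words(1) by simp
  also have "\<nu> (T * x) = 0" using nuT[of x] words(2)[of "Suc _"] x by simp
  also have "\<nu> (T * y) = 0"
    using nuT[of y] words(3)[of "Suc _"] y by (simp add: nu_commute[of _ y])
  also have "\<nu> (T * (x * y)) = 0"
    using nuT[of "x * y", folded power_Suc2, OF words(1)] words(1)[of 0] by simp
  finally have "\<nu> (B * T * A) = (1 + u)\<^sup>2" by simp
  then have "\<nu> E = 1 + u" using u1' by (simp add: E_def nu_scaleC power2_eq_square)
  then show ?thesis
    using moment_series_resolvent[OF w_small] by (simp add: E)
qed

end

section \<open>Local inverses of moment series\<close>

lemma local_inverse_exists:
  fixes f :: "complex \<Rightarrow> complex"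
  assumes f: "f holomorphic_on ball 0 R" "0 < R" and f0: "f 0 = 0" and f': "deriv f 0 \<noteq> 0"
  obtains l where "l analytic_on {0}" and "l 0 = 0"
    and "\<forall>\<^sub>F z in nhds 0. l (f z) = z \<and> f (l z) = z"
proof -
  obtain r where r: "0 < r" "ball (0::complex) r \<subseteq> ball 0 R" "inj_on f (ball 0 r)"
    by (rule has_complex_derivative_locally_injective[OF f(1) centre_in_ball[THEN iffD2, OF f(2)] open_ball f'])
  have hol: "f holomorphic_on ball 0 r" by (rule holomorphic_on_subset[OF f(1) r(2)])
  obtain g where g: "g holomorphic_on f ` ball 0 r"
    "\<And>z. z \<in> ball 0 r \<Longrightarrow> deriv f z * deriv g (f z) = 1" "\<And>z. z \<in> ball 0 r \<Longrightarrow> g (f z) = z"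
    using holomorphic_has_inverse[OF hol open_ball r(3)] by metis
  have op: "open (f ` ball 0 r)" by (rule open_mapping_thm3[OF hol open_ball r(3)])
  have "f 0 \<in> f ` ball 0 r" using r(1) by (intro imageI) simp
  then have mem: "0 \<in> f ` ball 0 r" unfolding f0 .
  show ?thesis
  proof (rule that)
    show "g analytic_on {0}" using g(1) op mem by (auto simp: analytic_at)
    show "g 0 = 0" using g(3)[of 0] r(1) f0 by simp
    have "\<forall>\<^sub>F z in nhds 0. z \<in> ball 0 r" using r(1) by (intro eventually_nhds_in_open) auto
    moreover have "\<forall>\<^sub>F z in nhds 0. z \<in> f ` ball 0 r" using mem op by (intro eventually_nhds_in_open)
    ultimately show "\<forall>\<^sub>F z in nhds 0. g (f z) = z \<and> f (g z) = z"
      by eventually_elim (use g(3) in auto)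
  qed
qed

text \<open>For small w the points \<open>L (f w)\<close> and \<open>w\<close> have the same image
  under \<open>f\<close>, and both lie in a disc on which \<open>f\<close> is injective. Punctured
  neighbourhoods suffice, and they are needed because the candidate inverse below involves a
  division by \<open>u\<close>.\<close>

lemma local_right_inverse_is_left_inverse:
  fixes f L :: "complex \<Rightarrow> complex"
  assumes f: "f holomorphic_on ball 0 R" "0 < R" and f0: "f 0 = 0" and f': "deriv f 0 \<noteq> 0"
    and L: "(L \<longlongrightarrow> 0) (at 0)" and fL: "\<forall>\<^sub>F u in at 0. f (L u) = u"
  shows "filterlim f (at 0) (at 0)" and "\<forall>\<^sub>F w in at 0. L (f w) = w"
proof -
  obtain r where r: "0 < r" "ball (0::complex) r \<subseteq> ball 0 R" "inj_on f (ball 0 r)"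
    by (rule has_complex_derivative_locally_injective[OF f(1) centre_in_ball[THEN iffD2, OF f(2)] open_ball f'])
  have ball: "\<forall>\<^sub>F w in at 0. w \<in> ball 0 r"
    using r(1) by (intro eventually_at_in_open') auto
  have "isCont f 0"
    using holomorphic_on_imp_continuous_on[OF f(1)] continuous_on_eq_continuous_at[OF open_ball, of 0 R f] f(2)
    by simp
  then have "(f \<longlongrightarrow> 0) (at 0)" using f0 by (simp add: isCont_def)
  moreover have "\<forall>\<^sub>F w in at 0. f w \<noteq> 0"
    using ball eventually_neq_at_within[of 0 0 UNIV]
  proof eventually_elim
    case (elim w)
    then show ?case using r(1) f0 inj_onD[OF r(3), of w 0] by auto
  qed
  ultimately show lim: "filterlim f (at 0) (at 0)" by (rule filterlim_atI)
  have "\<forall>\<^sub>F u in at 0. L u \<in> ball 0 r"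
    using topological_tendstoD[OF L, of "ball 0 r"] r(1) by simp
  then have "\<forall>\<^sub>F w in at 0. L (f w) \<in> ball 0 r"
    by (rule eventually_compose_filterlim[OF _ lim])
  moreover have "\<forall>\<^sub>F w in at 0. f (L (f w)) = f w"
    by (rule eventually_compose_filterlim[OF fL lim])
  ultimately show "\<forall>\<^sub>F w in at 0. L (f w) = w"
    using ball by eventually_elim (use inj_onD[OF r(3)] in auto)
qed

lemma tendsto_analytic_at_0:
  assumes "l analytic_on {0}"
  shows "(l \<longlongrightarrow> l 0) (at 0)" and "((\<lambda>u. (l u - l 0) / u) \<longlongrightarrow> deriv l 0) (at 0)"
proof -
  have d: "(l has_field_derivative deriv l 0) (at 0)"
    using analytic_on_imp_differentiable_at[OF assms] by (simp add: field_differentiable_derivI)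
  show "(l \<longlongrightarrow> l 0) (at 0)" using DERIV_isCont[OF d] by (simp add: isCont_def)
  show "((\<lambda>u. (l u - l 0) / u) \<longlongrightarrow> deriv l 0) (at 0)"
    using d by (simp add: DERIV_def)
qed

context faithful_trace
begin

lemma moment_series_0 [simp]: "moment_series \<nu> a 0 = 0"
  by (simp add: moment_series_def)

lemma moment_series_holomorphic:
  shows "moment_series \<nu> a holomorphic_on ball 0 (1 / (norm a + 1))"
    and "deriv (moment_series \<nu> a) 0 = \<nu> a"
proof -
  define R where "R = 1 / (norm a + 1)"
  have pos: "norm a + 1 > 0" using norm_ge_zero[of a] by linarith
  \<comment> \<open>Splitting off the factor \<open>z\<close> makes the derivative at 0 the constant
    term \<open>k 0\<close>, which is \<open>\<nu> a\<close>.\<close>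
  define k where "k z = (\<Sum>j. \<nu> (a ^ Suc j) * z ^ j)" for z
  have summable: "summable (\<lambda>j. \<nu> (a ^ Suc j) * z ^ j)" if z: "z \<in> ball 0 R" for z
  proof (rule summable_comparison_test)
    have small: "norm a * cmod z < 1"
    proof -
      have "norm a * cmod z \<le> (norm a + 1) * cmod z" by (simp add: algebra_simps)
      also have "\<dots> < 1" using z pos by (simp add: R_def field_simps)
      finally show ?thesis .
    qed
    then show "summable (\<lambda>j. 2 * norm a * (norm a * cmod z) ^ j)"
      by (intro summable_mult summable_geometric) simp
    have "norm (\<nu> (a ^ Suc j) * z ^ j) \<le> 2 * norm a * (norm a * cmod z) ^ j" for j
    proof -
      have "cmod (\<nu> (a ^ Suc j)) \<le> 2 * norm a ^ Suc j"
        using norm_nu_le[of "a ^ Suc j"] norm_power_ineq[of a "Suc j"] by linarith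
      then have "cmod (\<nu> (a ^ Suc j)) * cmod z ^ j \<le> 2 * norm a ^ Suc j * cmod z ^ j"
        by (rule mult_right_mono) simp
      then show ?thesis by (simp add: norm_mult norm_power power_mult_distrib mult_ac)
    qed
    then show "\<exists>N. \<forall>j\<ge>N. norm (\<nu> (a ^ Suc j) * z ^ j) \<le> 2 * norm a * (norm a * cmod z) ^ j" by blast
  qed
  have hol: "k holomorphic_on ball 0 R"
  proof (rule power_series_holomorphic)
    fix z :: complex assume "z \<in> ball 0 R"
    from summable_sums[OF summable[OF this]]
    show "(\<lambda>j. \<nu> (a ^ Suc j) * (z - 0) ^ j) sums k z" by (simp add: k_def)
  qed
  have eq: "moment_series \<nu> a z = z * k z" if "z \<in> ball 0 R" for z
    unfolding moment_series_def k_def suminf_mult[OF summable[OF that], symmetric]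
    by (simp add: mult_ac)
  have "(\<lambda>z. z * k z) holomorphic_on ball 0 R" by (intro holomorphic_intros hol)
  then show "moment_series \<nu> a holomorphic_on ball 0 (1 / (norm a + 1))"
    unfolding R_def[symmetric] by (rule holomorphic_transform) (simp add: eq)
  have R: "R > 0" using pos by (simp add: R_def)
  have "(k has_field_derivative deriv k 0) (at 0)"
    using hol R by (intro holomorphic_derivI[OF hol open_ball]) simp
  then have "((\<lambda>z. z * k z) has_field_derivative k 0) (at 0)"
    by (auto intro!: derivative_eq_intros)
  then have "(moment_series \<nu> a has_field_derivative k 0) (at 0)"
    by (rule has_field_derivative_transform_within_open[of _ _ _ "ball 0 R"]) (use R eq in auto)
  then show "deriv (moment_series \<nu> a) 0 = \<nu> a"
    by (simp add: DERIV_imp_deriv k_def powser_zero)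
qed

lemma eventually_moment_series_integral:
  assumes "has_law \<nu> a \<mu>"
  shows "\<forall>\<^sub>F w in nhds 0. (\<integral>x. 1 / (1 - complex_of_real x * w) \<partial>\<mu>) = 1 + moment_series \<nu> a w"
proof -
  obtain R where rd: "real_distribution \<mu>" and supp: "AE x in \<mu>. \<bar>x\<bar> \<le> R"
    and moment: "\<And>k. \<nu> (a ^ k) = complex_of_real (\<integral>x. x ^ k \<partial>\<mu>)"
    using assms by (auto simp: has_law_def)
  interpret real_distribution \<mu> by fact
  \<comment> \<open>\<open>has_law\<close> bounds the support by some \<open>R\<close> that is not
    tied to \<open>norm a\<close>, so the radius respects both: \<open>R\<close> for the integral
    and \<open>norm a\<close> for the Neumann series.\<close>
  have pos: "\<bar>R\<bar> + norm a + 1 > 0" using norm_ge_zero[of a] by linarith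
  have "\<forall>\<^sub>F w in nhds 0. w \<in> ball 0 (1 / (\<bar>R\<bar> + norm a + 1))"
    using pos by (intro eventually_nhds_in_open) auto
  then show ?thesis
  proof eventually_elim
    case (elim w)
    then have w: "cmod w * (\<bar>R\<bar> + norm a + 1) < 1" using pos by (simp add: field_simps)
    have Rw: "\<bar>R\<bar> * cmod w < 1" and aw: "cmod w * norm a < 1"
      using w by (auto simp: algebra_simps intro: le_less_trans[rotated]) 
    define f where "f k x = (complex_of_real x * w) ^ k" for k x
    have bound: "AE x in \<mu>. norm (f k x) \<le> (\<bar>R\<bar> * cmod w) ^ k" for k
      using supp
    proof eventually_elim
      case (elim x)
      then have "\<bar>x\<bar> * cmod w \<le> \<bar>R\<bar> * cmod w" by (intro mult_right_mono) auto
      then show ?case unfolding f_def by (simp add: norm_power norm_mult power_mono)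
    qed
    have [measurable]: "f k \<in> borel_measurable \<mu>" for k unfolding f_def by measurable
    have int: "integrable \<mu> (f k)" for k
      by (rule integrable_const_bound[OF bound]) simp
    have small: "AE x in \<mu>. norm (complex_of_real x * w) < 1"
      using bound[of 1] by eventually_elim (use Rw in \<open>simp add: f_def\<close>)
    have int_f: "(\<integral>x. f k x \<partial>\<mu>) = \<nu> (a ^ k) * w ^ k" for k
    proof -
      have "(\<integral>x. f k x \<partial>\<mu>) = (\<integral>x. complex_of_real (x ^ k) * w ^ k \<partial>\<mu>)"
        by (simp add: f_def power_mult_distrib)
      also have "\<dots> = (\<integral>x. complex_of_real (x ^ k) \<partial>\<mu>) * w ^ k"
        by (rule integral_mult_left_zero)
      also have "(\<integral>x. complex_of_real (x ^ k) \<partial>\<mu>) = \<nu> (a ^ k)"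
        by (simp only: integral_complex_of_real moment)
      finally show ?thesis .
    qed
    have "(\<integral>x. 1 / (1 - complex_of_real x * w) \<partial>\<mu>) = (\<integral>x. (\<Sum>k. f k x) \<partial>\<mu>)"
    proof (rule integral_cong_AE)
      show "AE x in \<mu>. 1 / (1 - complex_of_real x * w) = (\<Sum>k. f k x)"
        using small by eventually_elim (simp add: f_def suminf_geometric)
    qed measurable
    also have "\<dots> = (\<Sum>k. \<integral>x. f k x \<partial>\<mu>)"
    proof (rule integral_suminf[OF int])
      show "AE x in \<mu>. summable (\<lambda>k. norm (f k x))"
        using small by eventually_elim (simp add: f_def norm_power summable_geometric)
      show "summable (\<lambda>k. \<integral>x. norm (f k x) \<partial>\<mu>)"
      proof (rule summable_comparison_test)
        show "summable (\<lambda>k. (\<bar>R\<bar> * cmod w) ^ k)" using Rw by (intro summable_geometric) simp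
        have "(\<integral>x. norm (f k x) \<partial>\<mu>) \<le> (\<integral>x. (\<bar>R\<bar> * cmod w) ^ k \<partial>\<mu>)" for k
          using int bound by (intro integral_mono_AE) auto
        then have "norm (\<integral>x. norm (f k x) \<partial>\<mu>) \<le> (\<bar>R\<bar> * cmod w) ^ k" for k
          using prob_space by simp
        then show "\<exists>N. \<forall>k\<ge>N. norm (\<integral>x. norm (f k x) \<partial>\<mu>) \<le> (\<bar>R\<bar> * cmod w) ^ k" by blast
      qed
    qed
    also have "\<dots> = (\<Sum>k. \<nu> (scaleC w a ^ k))"
      unfolding int_f by (simp add: scaleC_power nu_scaleC mult.commute)
    also have "\<dots> = 1 + moment_series \<nu> a w"
      using moment_series_resolvent[OF aw] aw
      by (simp add: neumann_series_def norm_scaleC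
          bounded_linear.suminf[OF bounded_linear_nu summable_neumann])
    finally show ?case .
  qed
qed

lemma at_infinity_via_inverse:
  "(\<forall>\<^sub>F w in at 0. Q (inverse w :: complex)) \<Longrightarrow> (\<forall>\<^sub>F z in at_infinity. Q z)"
  by (simp add: at_to_infinity eventually_filtermap)

lemma eventually_stieltjes:
  assumes "has_law \<nu> a \<mu>"
  shows "\<forall>\<^sub>F w in at 0. stieltjes \<mu> (inverse w) = w * (1 + moment_series \<nu> a w)"
proof -
  have "\<forall>\<^sub>F w in at 0. (\<integral>x. 1 / (1 - complex_of_real x * w) \<partial>\<mu>) = 1 + moment_series \<nu> a w"
    using eventually_moment_series_integral[OF assms]
    unfolding eventually_at_filter by eventually_elim simp
  then show ?thesis
    using eventually_neq_at_within[of 0 0 UNIV]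
  proof eventually_elim
    case (elim w)
    have "stieltjes \<mu> (inverse w) = (\<integral>x. w * (1 / (1 - complex_of_real x * w)) \<partial>\<mu>)"
      unfolding stieltjes_def using elim(2) by (intro Bochner_Integration.integral_cong) (auto simp: field_simps)
    also have "\<dots> = w * (\<integral>x. 1 / (1 - complex_of_real x * w) \<partial>\<mu>)" by (rule integral_mult_right_zero)
    finally show ?case using elim(1) by simp
  qed
qed

lemma nu_sandwich_power:
  assumes "r * r = s"
  shows "\<nu> ((r * a * r) ^ k) = \<nu> ((a * s) ^ k)"
proof (cases k)
  case (Suc j)
  have "(r * a * r) ^ Suc j = r * ((a * s) ^ j * (a * r))"
  proof (induction j)
    case (Suc j)
    have "(r * a * r) ^ Suc (Suc j) = (r * a * r) * (r * ((a * s) ^ j * (a * r)))"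
      using Suc by simp
    also have "\<dots> = r * ((a * s) * (a * s) ^ j * (a * r))"
      by (simp add: assms[symmetric] mult.assoc)
    finally show ?case by simp
  qed (simp add: mult.assoc)
  then have "\<nu> ((r * a * r) ^ Suc j) = \<nu> ((a * s) ^ j * (a * r) * r)"
    by (simp only: nu_commute[of r])
  also have "(a * s) ^ j * (a * r) * r = (a * s) ^ Suc j"
    by (simp add: mult.assoc assms power_Suc2 del: power_Suc)
  finally show ?thesis by (simp add: Suc)
qed simp

text \<open>The moment series of \<open>a * s\<close> has the local inverse \<open>(1 + u) / u * la u * ls u\<close>, which is
  the multiplicativity of the \<open>S\<close>-transform.\<close>

theorem stieltjes_free_product:
  assumes a: "self_adjoint a" "\<nu> a \<noteq> 0" and s: "self_adjoint s" "\<nu> s \<noteq> 0"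
    and r: "self_adjoint r" "r * r = s" and free: "freely_independent \<nu> a s"
    and la: "la analytic_on {0}" "la 0 = 0" "\<forall>\<^sub>F u in at 0. moment_series \<nu> a (la u) = u"
    and law: "has_law \<nu> s \<mu>" "has_law \<nu> (r * a * r) \<rho>"
  shows "filterlim (\<lambda>z. z * stieltjes \<rho> z - 1) (at 0) at_infinity"
    and "\<forall>\<^sub>F z in at_infinity. stieltjes \<rho> z =
      (\<integral>x. 1 / (z - complex_of_real x * ((z * stieltjes \<rho> z - 1) /
        ((1 + (z * stieltjes \<rho> z - 1)) * la (z * stieltjes \<rho> z - 1)))) \<partial>\<mu>)"
proof -
  define \<psi> where "\<psi> = moment_series \<nu> (a * s)"
  have radius: "0 < 1 / (norm b + 1)" for b :: 'a
    using norm_ge_zero[of b] by (simp add: add_nonneg_pos)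
  have \<psi>': "deriv \<psi> 0 \<noteq> 0"
    using a s by (simp add: \<psi>_def moment_series_holomorphic(2) free_nu_mult[OF free])
  have \<psi>_eq: "moment_series \<nu> (r * a * r) = \<psi>"
    unfolding \<psi>_def moment_series_def nu_sandwich_power[OF r(2)] ..
  have "deriv (moment_series \<nu> s) 0 \<noteq> 0" using s by (simp add: moment_series_holomorphic(2))
  then obtain ls where ls: "ls analytic_on {0}" "ls 0 = 0"
    and ls': "\<forall>\<^sub>F z in nhds 0. ls (moment_series \<nu> s z) = z \<and> moment_series \<nu> s (ls z) = z"
    by (rule local_inverse_exists[OF moment_series_holomorphic(1) radius moment_series_0])
  from ls' have ls_inv: "\<forall>\<^sub>F u in at 0. moment_series \<nu> s (ls u) = u"
    unfolding eventually_at_filter by eventually_elim simp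
  define L where "L u = (1 + u) * la u * ls u / u" for u
  have la0: "(la \<longlongrightarrow> 0) (at 0)" and ls0: "(ls \<longlongrightarrow> 0) (at 0)"
    and ls1: "((\<lambda>u. ls u / u) \<longlongrightarrow> deriv ls 0) (at 0)"
    using tendsto_analytic_at_0[OF la(1)] tendsto_analytic_at_0[OF ls(1)] la ls by simp_all
  \<comment> \<open>The division by \<open>u\<close> is absorbed by \<open>ls\<close>, whose
    difference quotient converges, while \<open>la\<close> tends to 0.\<close>
  have "((\<lambda>u. (1 + u) * la u * (ls u / u)) \<longlongrightarrow> (1 + 0) * 0 * deriv ls 0) (at 0)"
    by (intro tendsto_intros la0 ls1)
  then have L0: "(L \<longlongrightarrow> 0) (at 0)" by (simp add: L_def[abs_def])
  have small: "\<forall>\<^sub>F u in at 0. cmod (f u) * C < e" if "(f \<longlongrightarrow> 0) (at 0)" "e > 0" for f :: "complex \<Rightarrow> complex" and C e :: real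
  proof -
    have "((\<lambda>u. cmod (f u) * C) \<longlongrightarrow> cmod 0 * C) (at 0)" by (intro tendsto_intros that)
    then show ?thesis using that(2) by (intro order_tendstoD) simp_all
  qed
  have half: "(0::real) < 1/2" and small_const: "(0::real) < 1/144" by simp_all
  have "\<forall>\<^sub>F u in at 0. \<psi> (L u) = u"
    using la(3) ls_inv small[OF la0 half, of "norm a"] small[OF ls0 half, of "norm s"]
      small[OF L0 small_const, of "norm a * norm s"] small[OF tendsto_ident_at half, of 1]
      eventually_neq_at_within[of 0 0 UNIV]
  proof eventually_elim
    case (elim u)
    show ?case
      unfolding \<psi>_def
      by (rule moment_series_free_product[OF free, of u "la u" "ls u"]) (use elim in \<open>auto simp: L_def\<close>)
  qed
  note inverse = local_right_inverse_is_left_inverse[OF moment_series_holomorphic(1) radius moment_series_0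
      \<psi>'[unfolded \<psi>_def] L0 this[unfolded \<psi>_def], folded \<psi>_def]
  have st: "\<forall>\<^sub>F w in at 0. stieltjes \<rho> (inverse w) = w * (1 + \<psi> w)"
    using eventually_stieltjes[OF law(2)] by (simp add: \<psi>_eq)
  have u: "\<forall>\<^sub>F w in at 0. inverse w * stieltjes \<rho> (inverse w) - 1 = \<psi> w"
    using st eventually_neq_at_within[of 0 0 UNIV] by eventually_elim (simp add: field_simps)
  have "filterlim (\<lambda>w. inverse w * stieltjes \<rho> (inverse w) - 1) (at 0) (at 0)"
    by (rule filterlim_cong[THEN iffD2, OF refl refl u inverse(1)])
  then show "filterlim (\<lambda>z. z * stieltjes \<rho> z - 1) (at 0) at_infinity"
    by (simp add: at_to_infinity filterlim_filtermap)
  show "\<forall>\<^sub>F z in at_infinity. stieltjes \<rho> z =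
      (\<integral>x. 1 / (z - complex_of_real x * ((z * stieltjes \<rho> z - 1) /
        ((1 + (z * stieltjes \<rho> z - 1)) * la (z * stieltjes \<rho> z - 1)))) \<partial>\<mu>)"
  proof (rule at_infinity_via_inverse)
    have int: "\<forall>\<^sub>F u in at 0. (\<integral>x. 1 / (1 - complex_of_real x * ls u) \<partial>\<mu>) = 1 + moment_series \<nu> s (ls u)"
      by (rule eventually_compose_filterlim[OF eventually_moment_series_integral[OF law(1)] ls0])
    show "\<forall>\<^sub>F w in at 0. stieltjes \<rho> (inverse w) =
      (\<integral>x. 1 / (inverse w - complex_of_real x * ((inverse w * stieltjes \<rho> (inverse w) - 1) /
        ((1 + (inverse w * stieltjes \<rho> (inverse w) - 1)) * la (inverse w * stieltjes \<rho> (inverse w) - 1)))) \<partial>\<mu>)"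
      using eventually_compose_filterlim[OF int inverse(1)] eventually_compose_filterlim[OF la(3) inverse(1)]
        eventually_compose_filterlim[OF ls_inv inverse(1)]
        eventually_compose_filterlim[OF small[OF tendsto_ident_at half, of 1] inverse(1)]
        eventually_compose_filterlim[OF eventually_neq_at_within[of 0 0 UNIV] inverse(1)]
        inverse(2) st u eventually_neq_at_within[of 0 0 UNIV]
    proof eventually_elim
      case (elim w)
      define u where "u = \<psi> w"
      have "1 + u \<noteq> 0"
      proof
        assume "1 + u = 0"
        then have "u = - 1" by (simp add: eq_neg_iff_add_eq_0 add.commute)
        then show False using elim(4) by (simp add: u_def)
      qed
      moreover have "la u \<noteq> 0"
        using elim(2,5) by (auto simp: u_def)
      ultimately have nz: "(1 + u) * la u \<noteq> 0" by simp
      have w: "w = (1 + u) * la u * ls u / u" and "u \<noteq> 0" "w \<noteq> 0"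
        using elim by (simp_all add: u_def L_def)
      \<comment> \<open>Solving w = L(u) for \<open>ls u\<close> gives w / S(u), with S(u) = (1 + u)
        la(u) / u the S-transform of \<open>a\<close>.\<close>
      then have "ls u * ((1 + u) * la u) = w * u" by (simp add: mult_ac)
      then have ls: "ls u = w * (u / ((1 + u) * la u))"
        using nonzero_eq_divide_eq[OF nz] by (simp only: times_divide_eq_right)
      have "1 / (inverse w - complex_of_real x * (u / ((1 + u) * la u))) = w * (1 / (1 - complex_of_real x * ls u))" for x
      proof -
        have "inverse w - complex_of_real x * (u / ((1 + u) * la u)) = inverse w * (1 - complex_of_real x * ls u)"
          unfolding ls right_diff_distrib using \<open>w \<noteq> 0\<close> by simp
        then show ?thesis by (simp add: inverse_eq_divide)
      qed
      then have "(\<integral>x. 1 / (inverse w - complex_of_real x * (u / ((1 + u) * la u))) \<partial>\<mu>) = w * (\<integral>x. 1 / (1 - complex_of_real x * ls u) \<partial>\<mu>)"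
        by (simp only: integral_mult_right_zero)
      also have "\<dots> = w * (1 + u)" using elim by (simp add: u_def)
      also have "\<dots> = stieltjes \<rho> (inverse w)" using elim by (simp add: u_def)
      finally show ?case using elim(8) by (simp only: u_def)
    qed
  qed
qed

lemma S_transform_exists:
  assumes "\<nu> a \<noteq> 0"
  shows "\<exists>S. is_S_transform \<nu> a S"
proof -
  have radius: "0 < 1 / (norm a + 1)"
    using norm_ge_zero[of a] by (simp add: add_nonneg_pos)
  have "deriv (moment_series \<nu> a) 0 \<noteq> 0" using assms by (simp add: moment_series_holomorphic(2))
  then obtain l where l: "l analytic_on {0}" "l 0 = 0"
    and inv: "\<forall>\<^sub>F z in nhds 0. l (moment_series \<nu> a z) = z \<and> moment_series \<nu> a (l z) = z"
    by (rule local_inverse_exists[OF moment_series_holomorphic(1) radius moment_series_0])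
  obtain U where U: "open U" "0 \<in> U" "l holomorphic_on U"
    using l(1) by (auto simp: analytic_at)
  \<comment> \<open>The value at 0 removes the singularity of \<open>l z / z\<close>; the
    differences with 0 match the form of \<open>pole_lemma\<close>.\<close>
  define S where "S z = (1 + z) * (if z = 0 then deriv l 0 else (l z - l 0) / (z - 0))" for z
  have "S holomorphic_on U"
    unfolding S_def using U by (intro holomorphic_intros pole_lemma) (auto simp: interior_open)
  then have "S analytic_on {0}" using U by (auto simp: analytic_at)
  moreover have "\<forall>\<^sub>F z in at 0. S z = (1 + z) / z * l z"
    using eventually_neq_at_within[of 0 0 UNIV] by eventually_elim (simp add: S_def l)
  ultimately show ?thesis
    using l inv unfolding is_S_transform_def by blast
qed

lemma is_S_transform_S_transform: "\<nu> a \<noteq> 0 \<Longrightarrow> is_S_transform \<nu> a (S_transform \<nu> a)"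
  unfolding S_transform_def by (rule someI_ex[OF S_transform_exists])

end

section \<open>The harmonic law\<close>

text \<open>Two geometric series with ratios q e^(i \<theta>) and q e^(-i \<theta>) are subtracted
  and divided by 2i; as \<open>q\<close> is complex, taking imaginary parts of one series would not
  do. The denominator is the product of the two single denominators, hence nonzero.\<close>

lemma sine_power_series_sums:
  fixes q :: complex
  assumes q: "cmod q < 1"
  shows "(\<lambda>j. q ^ j * complex_of_real (sin (real (Suc j) * \<theta>))) sums
      (complex_of_real (sin \<theta>) / (1 - 2 * q * complex_of_real (cos \<theta>) + q\<^sup>2))"
    and "1 - 2 * q * complex_of_real (cos \<theta>) + q\<^sup>2 \<noteq> 0"
proof -
  have ne: "1 - q * cis t \<noteq> 0" for t
  proof
    assume "1 - q * cis t = 0"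
    then have "cmod (q * cis t) = 1" by simp
    then show False using q by (simp add: norm_mult)
  qed
  have prod: "(1 - q * cis \<theta>) * (1 - q * cis (- \<theta>)) = 1 - 2 * q * complex_of_real (cos \<theta>) + q\<^sup>2"
  proof -
    have "cis \<theta> * cis (- \<theta>) = 1" by (simp add: cis_mult)
    moreover have "cis \<theta> + cis (- \<theta>) = 2 * complex_of_real (cos \<theta>)" by (simp add: complex_eq_iff)
    moreover have "(1 - q * cis \<theta>) * (1 - q * cis (- \<theta>)) =
        1 - q * (cis \<theta> + cis (- \<theta>)) + q\<^sup>2 * (cis \<theta> * cis (- \<theta>))"
      by (simp add: algebra_simps power2_eq_square)
    ultimately show ?thesis by simp
  qed
  show nz: "1 - 2 * q * complex_of_real (cos \<theta>) + q\<^sup>2 \<noteq> 0"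
    unfolding prod[symmetric] using ne by simp
  have geometric: "(\<lambda>j. cis t * (q * cis t) ^ j) sums (cis t * (1 / (1 - q * cis t)))" for t
    using q by (intro sums_mult geometric_sums) (simp add: norm_mult)
  have "(\<lambda>j. (cis \<theta> * (q * cis \<theta>) ^ j - cis (- \<theta>) * (q * cis (- \<theta>)) ^ j) / (2 * \<i>)) sums
      ((cis \<theta> * (1 / (1 - q * cis \<theta>)) - cis (- \<theta>) * (1 / (1 - q * cis (- \<theta>)))) / (2 * \<i>))"
    by (intro sums_divide sums_diff geometric)
  also have "(\<lambda>j. (cis \<theta> * (q * cis \<theta>) ^ j - cis (- \<theta>) * (q * cis (- \<theta>)) ^ j) / (2 * \<i>)) =
      (\<lambda>j. q ^ j * complex_of_real (sin (real (Suc j) * \<theta>)))"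
  proof
    fix j
    have 1: "cis t * (q * cis t) ^ j = q ^ j * cis (real (Suc j) * t)" for t
    proof -
      have DM: "cis t * cis t ^ j = cis (real (Suc j) * t)" using Complex.DeMoivre[of t "Suc j"] by simp
      then show ?thesis by (simp only: power_mult_distrib DM[symmetric] mult.left_commute)
    qed
    have 2: "cis t - cis (- t) = 2 * \<i> * complex_of_real (sin t)" for t
      by (simp add: complex_eq_iff)
    have 3: "cis \<theta> * (q * cis \<theta>) ^ j - cis (- \<theta>) * (q * cis (- \<theta>)) ^ j =
        q ^ j * (cis (real (Suc j) * \<theta>) - cis (- (real (Suc j) * \<theta>)))"
      unfolding 1 by (simp add: right_diff_distrib)
    show "(cis \<theta> * (q * cis \<theta>) ^ j - cis (- \<theta>) * (q * cis (- \<theta>)) ^ j) / (2 * \<i>) =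
        q ^ j * complex_of_real (sin (real (Suc j) * \<theta>))"
    proof -
      have "(a * (2 * \<i> * x)) / (2 * \<i>) = a * x" for a x :: complex
        by (subst divide_eq_eq) (simp add: mult_ac)
      then show ?thesis unfolding 3 2 .
    qed
  qed
  also have "(cis \<theta> * (1 / (1 - q * cis \<theta>)) - cis (- \<theta>) * (1 / (1 - q * cis (- \<theta>)))) / (2 * \<i>) =
      complex_of_real (sin \<theta>) / (1 - 2 * q * complex_of_real (cos \<theta>) + q\<^sup>2)"
  proof -
    have "cis \<theta> * (1 / (1 - q * cis \<theta>)) - cis (- \<theta>) * (1 / (1 - q * cis (- \<theta>))) =
        (cis \<theta> * (1 - q * cis (- \<theta>)) - cis (- \<theta>) * (1 - q * cis \<theta>)) / ((1 - q * cis \<theta>) * (1 - q * cis (- \<theta>)))"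
      using ne by (simp add: diff_frac_eq)
    also have "cis \<theta> * (1 - q * cis (- \<theta>)) - cis (- \<theta>) * (1 - q * cis \<theta>) = cis \<theta> - cis (- \<theta>)"
      by (simp add: algebra_simps)
    also have "\<dots> = 2 * \<i> * complex_of_real (sin \<theta>)" by (simp add: complex_eq_iff)
    finally have 1: "cis \<theta> * (1 / (1 - q * cis \<theta>)) - cis (- \<theta>) * (1 / (1 - q * cis (- \<theta>))) =
        2 * \<i> * complex_of_real (sin \<theta>) / ((1 - q * cis \<theta>) * (1 - q * cis (- \<theta>)))" .
    have "2 * \<i> \<noteq> 0" by simp
    from nonzero_mult_div_cancel_left[OF this]
    show ?thesis unfolding 1 prod times_divide_eq_right[symmetric] .
  qed
  finally show "(\<lambda>j. q ^ j * complex_of_real (sin (real (Suc j) * \<theta>))) sums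
      (complex_of_real (sin \<theta>) / (1 - 2 * q * complex_of_real (cos \<theta>) + q\<^sup>2))" .
qed

lemma integral_sin_mult_sin:
  "(\<integral>t. (sin (real (Suc j) * t) * sin t) * indicator {0..pi} t \<partial>lborel) = (if j = 0 then pi / 2 else 0)"
proof (cases "j = 0")
  case True
  have "(\<integral>t. (sin t * sin t) * indicator {0..pi} t \<partial>lborel) = (pi / 2 - sin (2 * pi) / 4) - (0 / 2 - sin (2 * 0) / 4)"
  proof (rule integral_FTC_Icc_real)
    fix x :: real
    have "cos (2 * x) = 1 - 2 * (sin x * sin x)" by (simp add: cos_double_sin power2_eq_square)
    then have "1 / 2 - cos (2 * x) * 2 / 4 = sin x * sin x" by linarith
    moreover have "DERIV (\<lambda>x. x / 2 - sin (2 * x) / 4) x :> 1 / 2 - cos (2 * x) * 2 / 4"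
      by (auto intro!: derivative_eq_intros)
    ultimately show "DERIV (\<lambda>x. x / 2 - sin (2 * x) / 4) x :> sin x * sin x" by (simp only:)
  qed (auto intro!: continuous_intros)
  then show ?thesis using True by simp
next
  case False
  \<comment> \<open>The product formula yields the frequencies j and j + 2. The antiderivative
    divides by both, which is why j = 0 is separate.\<close>
  define a b where "a = real j" and "b = real (Suc (Suc j))"
  have ab: "a \<noteq> 0" "b \<noteq> 0" using False by (auto simp: a_def b_def)
  define G where "G x = (sin (a * x) / a - sin (b * x) / b) / 2" for x
  have "(\<integral>t. (sin (real (Suc j) * t) * sin t) * indicator {0..pi} t \<partial>lborel) = G pi - G 0"
  proof (rule integral_FTC_Icc_real)
    fix x :: real
    have eq: "sin (real (Suc j) * x) * sin x = (cos (a * x) - cos (b * x)) / 2"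
      by (simp add: sin_times_sin a_def b_def algebra_simps)
    show "DERIV G x :> sin (real (Suc j) * x) * sin x"
      unfolding eq G_def using ab by (auto intro!: derivative_eq_intros)
  qed (auto intro!: continuous_intros)
  also have "G pi - G 0 = 0" by (simp add: G_def a_def b_def sin_npi del: of_nat_Suc)
  finally show ?thesis using False by simp
qed

text \<open>Up to normalisation this is the Stieltjes transform of the semicircle law. In its expansion in the
  Chebyshev polynomials \<open>sin ((j + 1) \<theta>) / sin \<theta>\<close> only the term \<open>j = 0\<close> survives integration.\<close>

lemma integral_sin_squared_kernel:
  fixes q :: complex
  assumes q: "cmod q < 1"
  shows "(LBINT \<theta>=0..pi. complex_of_real (sin \<theta> * sin \<theta>) / (1 - 2 * q * complex_of_real (cos \<theta>) + q\<^sup>2)) = pi / 2"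
proof -
  define f where "f j \<theta> = q ^ j * complex_of_real ((sin (real (Suc j) * \<theta>) * sin \<theta>) * indicator {0..pi} \<theta>)" for j and \<theta> :: real
  have real_int: "integrable lborel (\<lambda>\<theta>. (sin (real (Suc j) * \<theta>) * sin \<theta>) * indicator {0..pi} \<theta>)" for j
    by (rule borel_integrable_atLeastAtMost) (auto intro!: continuous_intros)
  then have int: "integrable lborel (f j)" for j
    unfolding f_def by (intro integrable_mult_right integrable_of_real)
  have int_f: "(\<integral>\<theta>. f j \<theta> \<partial>lborel) = (if j = 0 then complex_of_real (pi / 2) else 0)" for j
    unfolding f_def integral_mult_right_zero integral_complex_of_real integral_sin_mult_sin by simp
  have bound: "norm (f j \<theta>) \<le> cmod q ^ j * indicator {0..pi} \<theta>" for j \<theta>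
  proof -
    have "\<bar>sin (real (Suc j) * \<theta>) * sin \<theta>\<bar> \<le> 1"
      unfolding abs_mult by (intro mult_le_one) auto
    then show ?thesis
      by (auto simp: f_def norm_mult norm_power mult_left_le split: split_indicator simp del: of_nat_Suc)
  qed
  have "(LBINT \<theta>=0..pi. complex_of_real (sin \<theta> * sin \<theta>) / (1 - 2 * q * complex_of_real (cos \<theta>) + q\<^sup>2)) =
      (LBINT \<theta>:{0..pi}. complex_of_real (sin \<theta> * sin \<theta>) / (1 - 2 * q * complex_of_real (cos \<theta>) + q\<^sup>2))"
    unfolding zero_ereal_def by (rule interval_integral_Icc) simp
  also have "\<dots> = (\<integral>\<theta>. (\<Sum>j. f j \<theta>) \<partial>lborel)"
    unfolding set_lebesgue_integral_def
  proof (intro Bochner_Integration.integral_cong refl)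
    fix \<theta> :: real
    have "(\<lambda>j. q ^ j * complex_of_real (sin (real (Suc j) * \<theta>)) * complex_of_real (sin \<theta> * indicator {0..pi} \<theta>)) sums
        (complex_of_real (sin \<theta>) / (1 - 2 * q * complex_of_real (cos \<theta>) + q\<^sup>2) * complex_of_real (sin \<theta> * indicator {0..pi} \<theta>))"
      by (rule sums_mult2[OF sine_power_series_sums(1)[OF q]])
    then have "f sums (complex_of_real (sin \<theta>) / (1 - 2 * q * complex_of_real (cos \<theta>) + q\<^sup>2) * complex_of_real (sin \<theta> * indicator {0..pi} \<theta>))"
      if "f = (\<lambda>j. q ^ j * complex_of_real ((sin (real (Suc j) * \<theta>) * sin \<theta>) * indicator {0..pi} \<theta>))" for f
      unfolding that by (simp only: of_real_mult mult.assoc)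
    from sums_unique[OF this[of "\<lambda>j. f j \<theta>"]]
    show "indicator {0..pi} \<theta> *\<^sub>R (complex_of_real (sin \<theta> * sin \<theta>) / (1 - 2 * q * complex_of_real (cos \<theta>) + q\<^sup>2)) = (\<Sum>j. f j \<theta>)"
      by (simp add: f_def scaleR_conv_of_real mult_ac del: of_nat_Suc)
  qed
  also have "\<dots> = (\<Sum>j. \<integral>\<theta>. f j \<theta> \<partial>lborel)"
  proof (rule integral_suminf[OF int])
    show "AE \<theta> in lborel. summable (\<lambda>j. norm (f j \<theta>))"
    proof (intro AE_I2 summable_comparison_test[of "\<lambda>j. norm (f j \<theta>)" "\<lambda>j. cmod q ^ j * indicator {0..pi} \<theta>" for \<theta>] exI allI impI)
      show "norm (norm (f j \<theta>)) \<le> cmod q ^ j * indicator {0..pi} \<theta>" for j \<theta> using bound by simp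
      show "summable (\<lambda>j. cmod q ^ j * indicator {0..pi} \<theta> :: real)" for \<theta>
        using q by (intro summable_mult2 summable_geometric) simp
    qed
    show "summable (\<lambda>j. \<integral>\<theta>. norm (f j \<theta>) \<partial>lborel)"
    proof (rule summable_comparison_test)
      show "summable (\<lambda>j. cmod q ^ j * pi)"
        using q by (intro summable_mult2 summable_geometric) simp
      have "(\<integral>\<theta>. norm (f j \<theta>) \<partial>lborel) \<le> (\<integral>\<theta>. cmod q ^ j * indicator {0..pi} \<theta> \<partial>lborel)" for j
        using int bound by (intro integral_mono integrable_mult_right) auto
      then have "norm (\<integral>\<theta>. norm (f j \<theta>) \<partial>lborel) \<le> cmod q ^ j * pi" for j
        by simp
      then show "\<exists>N. \<forall>j\<ge>N. norm (\<integral>\<theta>. norm (f j \<theta>) \<partial>lborel) \<le> cmod q ^ j * pi" by blast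
    qed
  qed
  also have "\<dots> = (\<Sum>j\<in>{0}. \<integral>\<theta>. f j \<theta> \<partial>lborel)"
    by (rule suminf_finite) (auto simp: int_f)
  also have "\<dots> = pi / 2" by (simp add: int_f)
  finally show ?thesis .
qed

text \<open>The local inverse of the moment series of the harmonic law, for \<open>c = \<gamma> / n\<close> and \<open>d = 1 - \<gamma>\<close>.\<close>

definition harmonic_inverse :: "real \<Rightarrow> real \<Rightarrow> complex \<Rightarrow> complex" where
  "harmonic_inverse c d u = u / ((1 + u) * (of_real c * (1 + u) + of_real d))"

text \<open>Substituting \<open>x = (d + 2 c) - 2 sqrt (c (c + d)) cos \<theta>\<close> turns the resolvent of the
  harmonic law into the kernel above with \<open>q = - u * sqrt (c / (c + d))\<close>.\<close>

lemma harmonic_integral: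
  fixes u :: complex
  assumes c: "0 < c" and d: "0 < d" and u: "cmod u < 1"
    and den: "of_real c * (1 + u) + of_real d \<noteq> (0::complex)"
  defines "w \<equiv> harmonic_inverse c d u"
  defines "\<rho> \<equiv> 2 * (sqrt c * sqrt (d + c))"
  shows "(LBINT x=(d + 2 * c - \<rho>)..(d + 2 * c + \<rho>).
      complex_of_real (1 / (2 * pi * c) * sqrt ((d + 2 * c + \<rho> - x) * (x - (d + 2 * c - \<rho>)))) * (w / (1 - of_real x * w))) = u"
proof -
  have \<rho>: "\<rho> > 0" using c d by (simp add: \<rho>_def)
  have u1: "1 + u \<noteq> 0"
  proof
    assume "1 + u = 0"
    then have "u = - 1" by (simp add: eq_neg_iff_add_eq_0 add.commute)
    then show False using u by simp
  qed
  define D where "D = (1 + u) * (of_real c * (1 + u) + of_real d)"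
  have D: "D \<noteq> 0" using u1 den by (simp add: D_def)
  have w: "w = u / D" by (simp add: w_def harmonic_inverse_def D_def)
  define k where "k = sqrt c / sqrt (d + c)"
  define q where "q = - (u * of_real k)"
  have k: "0 \<le> k" "k \<le> 1" using c d by (auto simp: k_def)
  have kk: "k * k * (d + c) = c" and k\<rho>: "2 * k * (d + c) = \<rho>"
    using c d by (auto simp: k_def \<rho>_def field_simps real_sqrt_mult_self)
  have "cmod q \<le> cmod u * 1" unfolding q_def norm_minus_cancel norm_mult using k by (intro mult_left_mono) auto
  then have q: "cmod q < 1" using u by simp
  define g where "g \<theta> = d + 2 * c - \<rho> * cos \<theta>" for \<theta>
  define f where "f x = complex_of_real (1 / (2 * pi * c) * sqrt ((d + 2 * c + \<rho> - x) * (x - (d + 2 * c - \<rho>)))) * (w / (1 - of_real x * w))" for x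
  \<comment> \<open>Cleared of denominators this reads (d + c)(1 - 2 q cos \<theta> + q^2) = D -
    g(\<theta>) u. Comparing the terms in u^2 and in cos \<theta> dictates the choice of
    \<open>q\<close>.\<close>
  have kernel: "1 - of_real (g \<theta>) * w = (of_real (d + c) / D) * (1 - 2 * q * of_real (cos \<theta>) + q\<^sup>2)" for \<theta>
  proof -
    have q2: "of_real (d + c) * q\<^sup>2 = of_real c * u\<^sup>2"
      using arg_cong[OF kk, of complex_of_real]
      by (simp add: q_def power2_eq_square algebra_simps)
    have q1: "of_real (d + c) * (2 * q) = - of_real \<rho> * u"
      using arg_cong[OF k\<rho>, of complex_of_real] by (simp add: q_def algebra_simps)
    have "of_real (d + c) * (1 - 2 * q * of_real (cos \<theta>) + q\<^sup>2) =
        of_real (d + c) - of_real (d + c) * (2 * q) * of_real (cos \<theta>) + of_real (d + c) * q\<^sup>2"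
      by (simp add: algebra_simps)
    also have "\<dots> = D - of_real (g \<theta>) * u"
      unfolding q1 q2 by (simp add: D_def g_def algebra_simps power2_eq_square)
    finally show ?thesis using D by (simp add: w field_simps)
  qed
  have ne: "1 - of_real (g \<theta>) * w \<noteq> 0" for \<theta>
    unfolding kernel using D sine_power_series_sums(2)[OF q] c d by (simp flip: of_real_add)
  have "(LBINT \<theta>=ereal 0..ereal pi. (\<rho> * sin \<theta>) *\<^sub>R f (g \<theta>)) = (LBINT x=ereal (g 0)..ereal (g pi). f x)"
  proof (rule interval_integral_substitution_finite)
    show "(g has_real_derivative \<rho> * sin x) (at x within {0..pi})" for x
      unfolding g_def by (auto intro!: derivative_eq_intros)
    show "continuous_on (g ` {0..pi}) f"
      unfolding f_def using ne c by (intro continuous_intros) auto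
    show "continuous_on {0..pi} (\<lambda>x. \<rho> * sin x)" by (intro continuous_intros)
  qed simp
  moreover have "(LBINT \<theta>=ereal 0..ereal pi. (\<rho> * sin \<theta>) *\<^sub>R f (g \<theta>)) =
      (LBINT \<theta>=ereal 0..ereal pi. (of_real (\<rho>\<^sup>2 / (2 * pi * c)) * (w * D / of_real (d + c))) *
        (complex_of_real (sin \<theta> * sin \<theta>) / (1 - 2 * q * of_real (cos \<theta>) + q\<^sup>2)))"
  proof (rule interval_integral_cong)
    fix \<theta> assume "\<theta> \<in> einterval (min (ereal 0) (ereal pi)) (max (ereal 0) (ereal pi))"
    then have \<theta>: "0 \<le> \<theta>" "\<theta> \<le> pi" by (auto simp: einterval_iff min_def max_def split: if_splits)
    have "(d + 2 * c + \<rho> - g \<theta>) * (g \<theta> - (d + 2 * c - \<rho>)) = \<rho>\<^sup>2 * (1 - (cos \<theta>)\<^sup>2)"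
      by (simp add: g_def algebra_simps power2_eq_square)
    also have "\<dots> = (\<rho> * sin \<theta>)\<^sup>2" by (simp add: sin_squared_eq power_mult_distrib)
    finally have sqrt: "sqrt ((d + 2 * c + \<rho> - g \<theta>) * (g \<theta> - (d + 2 * c - \<rho>))) = \<rho> * sin \<theta>"
      using \<rho> sin_ge_zero[OF \<theta>] by simp
    show "(\<rho> * sin \<theta>) *\<^sub>R f (g \<theta>) =
      (of_real (\<rho>\<^sup>2 / (2 * pi * c)) * (w * D / of_real (d + c))) *
        (complex_of_real (sin \<theta> * sin \<theta>) / (1 - 2 * q * of_real (cos \<theta>) + q\<^sup>2))"
    proof -
      have "(\<rho> * x) *\<^sub>R (complex_of_real (1 / (2 * pi * c) * (\<rho> * x)) * (w / (e / D * K))) =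
          (of_real (\<rho>\<^sup>2 / (2 * pi * c)) * (w * D / e)) * (complex_of_real (x * x) / K)" for e K x
        by (simp add: scaleR_conv_of_real power2_eq_square mult_ac)
      then show ?thesis unfolding f_def kernel sqrt .
    qed
  qed
  moreover have "\<dots> = (of_real (\<rho>\<^sup>2 / (2 * pi * c)) * (w * D / of_real (d + c))) * (pi / 2)"
    unfolding interval_lebesgue_integral_mult_right integral_sin_squared_kernel[OF q, unfolded zero_ereal_def] ..
  moreover have "\<dots> = u"
  proof -
    have "\<rho>\<^sup>2 = 4 * c * (d + c)" using c d by (simp add: \<rho>_def power_mult_distrib)
    then have "\<rho>\<^sup>2 / (2 * pi * c) * (pi / 2) = d + c" using c by (simp add: field_simps)
    then have "complex_of_real (\<rho>\<^sup>2 / (2 * pi * c)) * of_real (pi / 2) = of_real (d + c)"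
      by (simp only: of_real_mult[symmetric])
    moreover have "w * D = u" using D by (simp add: w)
    moreover have "complex_of_real (d + c) \<noteq> 0" using c d by (simp flip: of_real_add)
    moreover have "A * (v / e) * B = u" if "A * B = e" "v = u" "e \<noteq> 0" for A B e v :: complex
      using that by auto
    ultimately show ?thesis by blast
  qed
  ultimately show ?thesis by (simp add: g_def f_def)
qed

lemma harmonic_inverse_0 [simp]: "harmonic_inverse c d 0 = 0"
  by (simp add: harmonic_inverse_def)

lemma harmonic_inverse_eq:
  fixes u z :: complex
  assumes "harmonic_inverse c d u = z" and "1 + u \<noteq> 0" and "of_real c * (1 + u) + of_real d \<noteq> 0"
  shows "z * ((1 + u) * (of_real c * (1 + u) + of_real d)) = u"
proof -
  have "(1 + u) * (of_real c * (1 + u) + of_real d) \<noteq> 0" using assms by simp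
  then show ?thesis
    unfolding assms(1)[symmetric] harmonic_inverse_def by (rule nonzero_eq_divide_eq[THEN iffD1, OF _ refl])
qed

lemma eventually_harmonic_den:
  assumes "c > 0" "d > 0"
  shows "\<forall>\<^sub>F u in at 0. of_real c * (1 + u) + of_real d \<noteq> (0::complex)"
    and "\<forall>\<^sub>F u in at 0. 1 + u \<noteq> (0::complex)"
proof -
  have "((\<lambda>u. of_real c * (1 + u) + of_real d) \<longlongrightarrow> of_real c * (1 + 0) + (of_real d :: complex)) (at 0)"
    by (intro tendsto_intros)
  moreover have "of_real c * (1 + 0) + (of_real d :: complex) \<noteq> 0"
    using assms by (simp flip: of_real_add)
  ultimately show "\<forall>\<^sub>F u in at 0. of_real c * (1 + u) + of_real d \<noteq> (0::complex)"
    by (rule tendsto_imp_eventually_ne)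
  have "((\<lambda>u. 1 + u) \<longlongrightarrow> 1 + (0::complex)) (at 0)" by (intro tendsto_intros)
  then show "\<forall>\<^sub>F u in at 0. 1 + u \<noteq> (0::complex)" by (rule tendsto_imp_eventually_ne) simp
qed

lemma harmonic_inverse_analytic:
  assumes "c > 0" "d > 0"
  shows "harmonic_inverse c d analytic_on {0}"
proof -
  have "of_real c + (of_real d :: complex) \<noteq> 0" using assms by (simp flip: of_real_add)
  then show ?thesis
    unfolding harmonic_inverse_def[abs_def] by (intro analytic_intros) auto
qed

text \<open>Integrability is what permits splitting the integral of 1 / (1 - x w) - 1.\<close>

lemma has_law_eventually_integrable:
  assumes "has_law \<nu> a \<mu>"
  shows "\<forall>\<^sub>F w in nhds 0. integrable \<mu> (\<lambda>x. 1 / (1 - complex_of_real x * w))"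
proof -
  obtain R where rd: "real_distribution \<mu>" and supp: "AE x in \<mu>. \<bar>x\<bar> \<le> R"
    using assms by (auto simp: has_law_def)
  interpret real_distribution \<mu> by fact
  have "\<forall>\<^sub>F w in nhds 0. w \<in> ball (0::complex) (1 / (2 * (\<bar>R\<bar> + 1)))"
    by (intro eventually_nhds_in_open) auto
  then show ?thesis
  proof eventually_elim
    case (elim w)
    have w: "cmod w * (2 * (\<bar>R\<bar> + 1)) < 1"
      using elim by (simp add: pos_less_divide_eq)
    show ?case
    proof (rule integrable_const_bound)
      show "AE x in \<mu>. norm (1 / (1 - complex_of_real x * w)) \<le> 2"
        using supp
      proof eventually_elim
        case (elim x)
        have "cmod (complex_of_real x * w) \<le> (\<bar>R\<bar> + 1) * cmod w"
          unfolding norm_mult norm_of_real using elim by (intro mult_right_mono) auto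
        moreover have "(\<bar>R\<bar> + 1) * cmod w < 1 / 2" using w by (simp add: algebra_simps)
        ultimately have "cmod (complex_of_real x * w) \<le> 1 / 2" by linarith
        then have "1 / 2 \<le> cmod (1 - complex_of_real x * w)"
          using norm_triangle_ineq2[of 1 "complex_of_real x * w"] by simp
        then show ?case by (simp add: norm_divide divide_le_eq)
      qed
    qed measurable
  qed
qed

section \<open>Moment series and S-transform under the harmonic law\<close>

context faithful_trace
begin

text \<open>The moment series is the integral of x w / (1 - x w). Its factor \<open>x\<close>
  cancels the 1/x of the density, so a pure semicircle kernel remains to be integrated.\<close>

lemma moment_series_harmonic_law:
  assumes \<gamma>: "0 < \<gamma>" "\<gamma> < 1" and n: "0 < n"
    and law: "has_law \<nu> h (harmonic_law \<gamma> n)"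
  defines "c \<equiv> \<gamma> / real n" and "d \<equiv> 1 - \<gamma>"
  shows "\<forall>\<^sub>F u in at 0. moment_series \<nu> h (harmonic_inverse c d u) = u"
proof -
  have c: "0 < c" and d: "0 < d" using \<gamma> n by (simp_all add: c_def d_def)
  define \<rho> where "\<rho> = 2 * (sqrt c * sqrt (d + c))"
  define \<mu> where "\<mu> = harmonic_law \<gamma> n"
  interpret real_distribution \<mu> using law by (simp add: has_law_def \<mu>_def)
  have \<rho>: "0 < \<rho>" "\<rho> < d + 2 * c"
  proof -
    show "0 < \<rho>" using c d by (simp add: \<rho>_def)
    \<comment> \<open>This square is the lower edge of the support, positive because \<gamma> < 1;
      so \<open>x\<close> never vanishes there.\<close>
    have "0 < (sqrt (d + c) - sqrt c)\<^sup>2" using c d by simp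
    then show "\<rho> < d + 2 * c" using c d by (simp add: \<rho>_def power2_diff mult.commute)
  qed
  define e_minus e_plus where "e_minus = d + 2 * c - \<rho>" and "e_plus = d + 2 * c + \<rho>"
  have edge: "harmonic_edge 1 \<gamma> n = e_plus" "harmonic_edge (-1) \<gamma> n = e_minus"
    by (simp_all add: harmonic_edge_def e_plus_def e_minus_def \<rho>_def c_def d_def)
  have e: "0 < e_minus" "e_minus \<le> e_plus" using \<rho> by (simp_all add: e_minus_def e_plus_def)
  define g where "g x = real n / (2 * pi * \<gamma> * x) * sqrt ((e_plus - x) * (x - e_minus)) * indicator {e_minus..e_plus} x" for x
  have \<mu>_eq: "\<mu> = density lborel (\<lambda>x. ennreal (g x))"
    by (simp add: \<mu>_def harmonic_law_def edge g_def Let_def)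
  have [measurable]: "g \<in> borel_measurable borel" unfolding g_def by measurable
  have g_nonneg: "0 \<le> g x" for x
    unfolding g_def using \<gamma> e by (auto split: split_indicator intro!: mult_nonneg_nonneg)
  define k where "k x = 1 / (2 * pi * c) * sqrt ((e_plus - x) * (x - e_minus))" for x
  have gk: "g x * x = k x * indicator {e_minus..e_plus} x" for x
    using e n by (auto simp: g_def k_def c_def split: split_indicator)
  have integral: "(\<integral>x. complex_of_real x * w / (1 - of_real x * w) \<partial>\<mu>) =
      (LBINT x=ereal e_minus..ereal e_plus. complex_of_real (k x) * (w / (1 - of_real x * w)))" for w
  proof -
    have "(\<integral>x. complex_of_real x * w / (1 - of_real x * w) \<partial>\<mu>) =
        (\<integral>x. g x *\<^sub>R (complex_of_real x * w / (1 - of_real x * w)) \<partial>lborel)"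
      unfolding \<mu>_eq using g_nonneg by (intro integral_density) auto
    also have "\<dots> = (\<integral>x. indicator {e_minus..e_plus} x *\<^sub>R (complex_of_real (k x) * (w / (1 - of_real x * w))) \<partial>lborel)"
    proof (intro Bochner_Integration.integral_cong refl)
      fix x
      have "g x *\<^sub>R (complex_of_real x * w / (1 - of_real x * w)) = complex_of_real (g x * x) * (w / (1 - of_real x * w))"
        by (simp add: scaleR_conv_of_real)
      then show "g x *\<^sub>R (complex_of_real x * w / (1 - of_real x * w)) =
          indicator {e_minus..e_plus} x *\<^sub>R (complex_of_real (k x) * (w / (1 - of_real x * w)))"
        unfolding gk by (simp add: scaleR_conv_of_real mult_ac)
    qed
    also have "\<dots> = (LBINT x=ereal e_minus..ereal e_plus. complex_of_real (k x) * (w / (1 - of_real x * w)))"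
      unfolding set_lebesgue_integral_def[symmetric] by (rule interval_integral_Icc[symmetric, OF e(2)])
    finally show ?thesis .
  qed
  have "\<forall>\<^sub>F w in nhds 0. (\<integral>x. complex_of_real x * w / (1 - of_real x * w) \<partial>\<mu>) = moment_series \<nu> h w"
  proof -
    obtain R where R: "AE x in \<mu>. \<bar>x\<bar> \<le> R" using law unfolding has_law_def \<mu>_def by blast
    have "\<forall>\<^sub>F w in nhds 0. w \<in> ball (0::complex) (1 / (\<bar>R\<bar> + 1))"
      by (intro eventually_nhds_in_open) auto
    then show ?thesis
      using has_law_eventually_integrable[OF law] eventually_moment_series_integral[OF law]
      unfolding \<mu>_def[symmetric]
    proof eventually_elim
      case (elim w)
      have "(\<integral>x. complex_of_real x * w / (1 - of_real x * w) \<partial>\<mu>) = (\<integral>x. 1 / (1 - complex_of_real x * w) - 1 \<partial>\<mu>)"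
      proof (rule integral_cong_AE)
        show "AE x in \<mu>. complex_of_real x * w / (1 - of_real x * w) = 1 / (1 - complex_of_real x * w) - 1"
          using R
        proof eventually_elim
          case (elim x)
          have "\<bar>x\<bar> * cmod w \<le> (\<bar>R\<bar> + 1) * cmod w" using elim by (intro mult_right_mono) auto
          also have "\<dots> < 1" using \<open>w \<in> _\<close> by (simp add: pos_less_divide_eq mult.commute)
          finally have "cmod (complex_of_real x * w) \<noteq> 1" by (simp add: norm_mult)
          then have "complex_of_real x * w \<noteq> 1" by (metis norm_one)
          then show ?case by (simp add: field_simps)
        qed
      qed measurable
      also have "\<dots> = (\<integral>x. 1 / (1 - complex_of_real x * w) \<partial>\<mu>) - (\<integral>x. 1 \<partial>\<mu>)"
        by (rule Bochner_Integration.integral_diff) (use elim in auto)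
      also have "\<dots> = moment_series \<nu> h w" using elim prob_space by simp
      finally show ?case .
    qed
  qed
  moreover have "((\<lambda>u. harmonic_inverse c d u) \<longlongrightarrow> 0) (at 0)"
    using tendsto_analytic_at_0(1)[OF harmonic_inverse_analytic[OF c d]] by simp
  ultimately have "\<forall>\<^sub>F u in at 0. (\<integral>x. complex_of_real x * harmonic_inverse c d u / (1 - of_real x * harmonic_inverse c d u) \<partial>\<mu>) =
      moment_series \<nu> h (harmonic_inverse c d u)"
    by (rule eventually_compose_filterlim)
  moreover have "\<forall>\<^sub>F u in at 0. u \<in> ball (0::complex) 1"
    by (intro eventually_at_in_open') auto
  ultimately show ?thesis
    using eventually_harmonic_den(1)[OF c d]
  proof eventually_elim
    case (elim u)
    show ?case
      using harmonic_integral[OF c d _ elim(3)] elim(1,2)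
      unfolding integral k_def e_minus_def e_plus_def \<rho>_def by simp
  qed
qed

lemma moment_series_translate:
  assumes l: "cmod l * norm (h - 1) < 1" and l1: "1 + l \<noteq> 0" and l2: "cmod (l / (1 + l)) * norm h < 1"
  shows "(1 + l) * (1 + moment_series \<nu> (h - 1) l) = 1 + moment_series \<nu> h (l / (1 + l))"
proof -
  define R where "R = neumann_series (scaleC (l / (1 + l)) h)"
  have n: "norm (scaleC (l / (1 + l)) h) < 1" using l2 by (simp add: norm_scaleC)
  have n': "norm (scaleC l (h - 1)) < 1" using l by (simp add: norm_scaleC)
  have "1 - scaleC l (h - 1) = scaleC (1 + l) (1 - scaleC (l / (1 + l)) h)"
    using l1 by (simp add: scaleC_diff_right scaleC_scaleC scaleC_add_left)
  then have "(1 - scaleC l (h - 1)) * scaleC (1 / (1 + l)) R = (1 - scaleC (l / (1 + l)) h) * R"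
    using l1 by (simp only: scaleC_mult_left scaleC_mult_right scaleC_scaleC) simp
  also have "\<dots> = 1" unfolding R_def by (rule one_minus_mult_neumann[OF n])
  finally have "scaleC (1 / (1 + l)) R = neumann_series (scaleC l (h - 1))"
    by (rule neumann_series_unique[OF n'])
  then have "1 / (1 + l) * \<nu> R = 1 + moment_series \<nu> (h - 1) l"
    using moment_series_resolvent[OF l] by (metis nu_scaleC)
  then show ?thesis
    using moment_series_resolvent[OF l2] l1 by (simp add: R_def field_simps)
qed

text \<open>The mean is read off from the inverse rather than from the density: derivatives of
  inverse functions at 0 are reciprocal, and that of \<open>harmonic_inverse\<close> is 1 / (c +
  d).\<close>

lemma nu_harmonic_law:
  assumes c: "0 < c" "0 < d" and inv: "\<forall>\<^sub>F u in at 0. moment_series \<nu> h (harmonic_inverse c d u) = u"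
  shows "\<nu> h = of_real (c + d)"
proof -
  have nz: "complex_of_real c + of_real d \<noteq> 0" using c by (simp flip: of_real_add)
  have radius: "0 < 1 / (norm h + 1)"
    using norm_ge_zero[of h] by (simp add: add_nonneg_pos)
  have "(moment_series \<nu> h has_field_derivative \<nu> h) (at 0)"
    using holomorphic_derivI[OF moment_series_holomorphic(1)[of h] open_ball, of 0] radius
    by (simp add: moment_series_holomorphic(2))
  then have 1: "((\<lambda>z. moment_series \<nu> h z / z) \<longlongrightarrow> \<nu> h) (at 0)"
    by (simp add: DERIV_def)
  have "((\<lambda>u. 1 / ((1 + u) * (of_real c * (1 + u) + of_real d))) \<longlongrightarrow> 1 / ((1 + 0) * (of_real c * (1 + 0) + complex_of_real d))) (at 0)"
    using nz by (intro tendsto_intros) auto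
  moreover have "\<forall>\<^sub>F u in at 0. 1 / ((1 + u) * (of_real c * (1 + u) + of_real d)) = harmonic_inverse c d u / u"
    using eventually_neq_at_within[of 0 0 UNIV] by eventually_elim (simp add: harmonic_inverse_def)
  ultimately have "((\<lambda>u. harmonic_inverse c d u / u) \<longlongrightarrow> 1 / ((1 + 0) * (of_real c * (1 + 0) + complex_of_real d))) (at 0)"
    by (rule Lim_transform_eventually)
  then have 2: "((\<lambda>u. harmonic_inverse c d u / u) \<longlongrightarrow> 1 / (of_real c + complex_of_real d)) (at 0)"
    by simp
  have ne: "\<forall>\<^sub>F u in at 0. harmonic_inverse c d u \<noteq> 0"
    using eventually_harmonic_den[OF c] eventually_neq_at_within[of 0 0 UNIV]
    by eventually_elim (simp add: harmonic_inverse_def)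
  have "(harmonic_inverse c d \<longlongrightarrow> 0) (at 0)"
    using tendsto_analytic_at_0(1)[OF harmonic_inverse_analytic[OF c]] by simp
  then have "filterlim (harmonic_inverse c d) (at 0) (at 0)"
    using ne by (rule filterlim_atI)
  from tendsto_mult[OF filterlim_compose[OF 1 this] 2]
  have "((\<lambda>u. moment_series \<nu> h (harmonic_inverse c d u) / harmonic_inverse c d u * (harmonic_inverse c d u / u)) \<longlongrightarrow>
      \<nu> h * (1 / (of_real c + of_real d))) (at 0)" .
  moreover have "\<forall>\<^sub>F u in at 0. moment_series \<nu> h (harmonic_inverse c d u) / harmonic_inverse c d u * (harmonic_inverse c d u / u) = 1"
    using inv ne eventually_neq_at_within[of 0 0 UNIV] by eventually_elim simp
  ultimately have "((\<lambda>u::complex. 1) \<longlongrightarrow> \<nu> h * (1 / (of_real c + of_real d))) (at 0)"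
    by (rule Lim_transform_eventually)
  then have "\<nu> h * (1 / (of_real c + of_real d)) = 1"
    by (simp add: tendsto_const_iff)
  then show ?thesis using nz by (simp add: field_simps)
qed

text \<open>The resolvents of \<open>h\<close> and \<open>h - 1\<close> are related by \<open>1 - l (h - 1) = (1 + l) (1 - l / (1 + l) h)\<close>.\<close>

lemma S_transform_quadratic:
  assumes c: "0 < c" "0 < d" and inv: "\<forall>\<^sub>F u in at 0. moment_series \<nu> h (harmonic_inverse c d u) = u"
    and S: "is_S_transform \<nu> (h - 1) S"
  shows "\<forall>\<^sub>F z in nhds 0. of_real c * z * (S z)\<^sup>2 + (of_real c * (1 + z) + of_real d - 1) * S z - 1 = 0"
proof -
  obtain l where l: "l analytic_on {0}" "l 0 = 0"
    and l_inv: "\<forall>\<^sub>F z in nhds 0. l (moment_series \<nu> (h - 1) z) = z \<and> moment_series \<nu> (h - 1) (l z) = z"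
    and S_an: "S analytic_on {0}" and S_eq: "\<forall>\<^sub>F z in at 0. S z = (1 + z) / z * l z"
    using S by (auto simp: is_S_transform_def)
  have radius: "0 < 1 / (norm h + 1)"
    using norm_ge_zero[of h] by (simp add: add_nonneg_pos)
  have W0: "(harmonic_inverse c d \<longlongrightarrow> 0) (at 0)"
    using tendsto_analytic_at_0(1)[OF harmonic_inverse_analytic[OF c]] by simp
  have "\<nu> h \<noteq> 0" using nu_harmonic_law[OF c inv] c by (simp del: of_real_add)
  then have "deriv (moment_series \<nu> h) 0 \<noteq> 0" by (simp add: moment_series_holomorphic(2))
  note W = local_right_inverse_is_left_inverse[OF moment_series_holomorphic(1) radius moment_series_0 this W0 inv]
  have l0: "(l \<longlongrightarrow> 0) (at 0)" using tendsto_analytic_at_0(1)[OF l(1)] l(2) by simp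
  have l_right: "\<forall>\<^sub>F z in at 0. moment_series \<nu> (h - 1) (l z) = z"
    using l_inv unfolding eventually_at_filter by eventually_elim simp
  have l_ne: "\<forall>\<^sub>F z in at 0. l z \<noteq> 0"
    using l_right eventually_neq_at_within[of 0 0 UNIV] by eventually_elim auto
  have l1_ne: "\<forall>\<^sub>F z in at 0. 1 + l z \<noteq> 0"
  proof -
    have "((\<lambda>z. 1 + l z) \<longlongrightarrow> 1 + 0) (at 0)" by (intro tendsto_intros l0)
    then show ?thesis by (rule tendsto_imp_eventually_ne) simp
  qed
  have "((\<lambda>z. l z / (1 + l z)) \<longlongrightarrow> 0 / (1 + 0)) (at 0)" by (intro tendsto_intros l0) simp
  then have \<zeta>0: "((\<lambda>z. l z / (1 + l z)) \<longlongrightarrow> 0) (at 0)" by simp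
  have "\<forall>\<^sub>F z in at 0. l z / (1 + l z) \<noteq> 0" using l_ne l1_ne by eventually_elim simp
  with \<zeta>0 have \<zeta>: "filterlim (\<lambda>z. l z / (1 + l z)) (at 0) (at 0)" by (rule filterlim_atI)
  have small: "\<forall>\<^sub>F u in at 0. cmod (f u) * C < 1" if "(f \<longlongrightarrow> 0) (at 0)" for f :: "complex \<Rightarrow> complex" and C :: real
  proof -
    have "((\<lambda>u. cmod (f u) * C) \<longlongrightarrow> cmod 0 * C) (at 0)" by (intro tendsto_intros that)
    from order_tendstoD(2)[OF this, of 1] show ?thesis by simp
  qed
  define Q where "Q z = of_real c * z * (S z)\<^sup>2 + (of_real c * (1 + z) + of_real d - 1) * S z - 1" for z
  have "\<forall>\<^sub>F z in at 0. Q z = 0"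
    using small[OF l0, of "norm (h - 1)"] small[OF \<zeta>0, of "norm h"] l1_ne l_right S_eq
      eventually_compose_filterlim[OF W(2) \<zeta>]
      eventually_compose_filterlim[OF eventually_harmonic_den(1)[OF c] filterlim_compose[OF W(1) \<zeta>]]
      eventually_compose_filterlim[OF eventually_harmonic_den(2)[OF c] filterlim_compose[OF W(1) \<zeta>]]
      eventually_neq_at_within[of 0 0 UNIV]
  proof eventually_elim
    case (elim u)
    \<comment> \<open>Translation gives (1 + L)(1 + u) = 1 + v, and the explicit inverse for
      \<open>h\<close> gives a second relation between L and v. Eliminating v and writing (1 + u) L
      = u s leaves \<open>u\<close> times the quadratic.\<close>
    define L v s where "L = l u" and "v = moment_series \<nu> h (L / (1 + L))" and "s = S u"
    have v: "(1 + L) * (1 + u) = 1 + v"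
      using moment_series_translate[of "l u" h] elim by (simp add: L_def v_def)
    have L1: "1 + L \<noteq> 0" using elim by (simp add: L_def)
    define Y where "Y = of_real c * (1 + v) + complex_of_real d"
    have "L / (1 + L) * ((1 + v) * Y) = v"
      unfolding L_def v_def Y_def by (rule harmonic_inverse_eq) (use elim in auto)
    then have "L * ((1 + v) * Y) = v * (1 + L)" using L1 by (simp add: divide_eq_eq)
    then have "(1 + L) * (L * ((1 + u) * Y)) = (1 + L) * v"
      unfolding v[symmetric] by (simp only: mult_ac)
    then have "L * ((1 + u) * Y) = v" using L1 by simp
    also have "v = (1 + L) * (1 + u) - 1" using v by simp
    also have "Y = of_real c * ((1 + L) * (1 + u)) + of_real d" by (simp only: Y_def v)
    finally have eq: "L * ((1 + u) * (of_real c * ((1 + L) * (1 + u)) + of_real d)) = (1 + L) * (1 + u) - 1" .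
    have sL: "(1 + u) * L = u * s" using elim by (simp add: s_def L_def)
    then have e1: "(1 + L) * (1 + u) = 1 + u + u * s" by (simp add: algebra_simps)
    have e2: "L * ((1 + u) * X) = u * s * X" for X
      unfolding sL[symmetric] by (simp only: mult_ac)
    have "u * s * (of_real c * (1 + u + u * s) + of_real d) = u + u * s"
      using eq unfolding e1 e2 by simp
    then have "u * Q u = 0"
      by (simp add: Q_def s_def[symmetric] algebra_simps power2_eq_square)
    then show ?case using elim by simp
  qed
  \<comment> \<open>Division by \<open>u\<close> excluded the point 0; continuity of
    \<open>S\<close> restores it.\<close>
  moreover have "(Q \<longlongrightarrow> Q 0) (at 0)"
    unfolding Q_def using tendsto_analytic_at_0(1)[OF S_an] by (intro tendsto_intros)
  ultimately have "((\<lambda>z::complex. 0) \<longlongrightarrow> Q 0) (at 0)"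
    by (rule Lim_transform_eventually[rotated])
  then have "Q 0 = 0" by (simp add: tendsto_const_iff)
  with \<open>\<forall>\<^sub>F z in at 0. Q z = 0\<close> have "\<forall>\<^sub>F z in nhds 0. Q z = 0"
    by (simp add: eventually_nhds_conv_at)
  then show ?thesis by (simp add: Q_def)
qed

lemma nu_pos_law:
  assumes law: "has_law \<nu> s \<mu>" and pos: "AE x in \<mu>. 0 < x"
  shows "\<nu> s \<noteq> 0"
proof
  assume "\<nu> s = 0"
  obtain R where rd: "real_distribution \<mu>" and supp: "AE x in \<mu>. \<bar>x\<bar> \<le> R"
    and moment: "\<And>k. \<nu> (s ^ k) = complex_of_real (\<integral>x. x ^ k \<partial>\<mu>)"
    using law by (auto simp: has_law_def)
  interpret real_distribution \<mu> by fact
  have "integrable \<mu> (\<lambda>x. x)" by (rule integrable_const_bound[of _ R]) (use supp in auto)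
  moreover have "(\<integral>x. x \<partial>\<mu>) = 0" using moment[of 1] \<open>\<nu> s = 0\<close> by simp
  moreover have "AE x in \<mu>. 0 \<le> x" using pos by eventually_elim simp
  ultimately have "AE x in \<mu>. x = 0" by (simp add: integral_nonneg_eq_0_iff_AE)
  with pos have "AE x in \<mu>. False" by eventually_elim simp
  then show False by simp
qed

end

section \<open>The fixed point equations\<close>

lemma freely_independent_translate:
  "freely_independent \<nu> (h - 1) s \<longleftrightarrow> freely_independent \<nu> h s"
proof -
  have "(\<lambda>i::bool. generated_subalgebra {if i then h - 1 else s}) = (\<lambda>i. generated_subalgebra {if i then h else s})"
  proof
    fix i :: bool
    show "generated_subalgebra {if i then h - 1 else s} = generated_subalgebra {if i then h else s}"
      by (cases i) (simp_all add: generated_subalgebra_translate)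
  qed
  then show ?thesis unfolding freely_independent_def by simp
qed

theorem theorem2p2:
  fixes \<gamma> K :: real and n :: nat and P N :: "nat \<Rightarrow> nat"
    and M :: "'w measure" and X :: "nat \<Rightarrow> nat \<Rightarrow> 'w \<Rightarrow> complex mat"
    and H :: "nat \<Rightarrow> 'w \<Rightarrow> complex mat" and Cov :: "nat \<Rightarrow> complex mat"
    and \<nu> :: "'a::cstar_algebra \<Rightarrow> complex" and h s :: 'a and F :: "real \<Rightarrow> real"
  assumes "0 < \<gamma>" and "\<gamma> < 1" and "2 \<le> n" and "0 < K"
    and "strict_mono P" and "\<And>k. 0 < P k" and "\<And>k. 0 < N k"
    and "\<And>k. \<bar>real (P k) / real (N k) - \<gamma>\<bar> \<le> K / (real (P k))\<^sup>2"
    and "prob_space M"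
    and "\<And>k. iid_gaussian_matrices M n (P k) (N k) (X k)"
    and "\<And>k \<omega>. H k \<omega> = mat_harmonic_mean (P k) n (\<lambda>i. wishart (X k i \<omega>))"
    and "\<And>k. pos_def_mat (P k) (Cov k)"
    and "faithful_tracial_state \<nu>"
    and "self_adjoint h" and "self_adjoint s" and "freely_independent \<nu> h s"
    and "converges_in_distribution_as M P H (\<lambda>k _. Cov k) \<nu> h s"
    and "law \<nu> h = harmonic_law \<gamma> n"
    and "F = cdf (law \<nu> s)"
    and "weak_conv (\<lambda>k. spectral_cdf (Cov k)) F"
    and "AE x in interval_measure F. 0 < x"
  shows "let m_sh = stieltjes (law \<nu> (cstar_sqrt s * h * cstar_sqrt s));
             m_e = stieltjes (law \<nu> (cstar_sqrt s * (h - 1) * cstar_sqrt s));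
             S = S_transform \<nu> (h - 1)
         in (\<forall>\<^sub>F z in at_infinity.
               m_sh z = (LINT x:{0<..}|interval_measure F.
                 1 / (z - complex_of_real x *
                   (complex_of_real \<gamma> * z * m_sh z / of_nat n + 1 - complex_of_real \<gamma>)))) \<and>
            (\<forall>\<^sub>F z in at_infinity.
               m_e z = (LINT x:{0<..}|interval_measure F.
                 1 / (z - complex_of_real x / S (z * m_e z - 1)))) \<and>
            (\<forall>\<^sub>F z in nhds 0.
               complex_of_real \<gamma> * z / of_nat n * (S z)\<^sup>2
                 + complex_of_real \<gamma> * ((1 + z) / of_nat n - 1) * S z - 1 = 0)"
proof -
  interpret faithful_trace \<nu> by standard fact
  define c d where "c = \<gamma> / real n" and "d = 1 - \<gamma>"
  have c: "0 < c" "0 < d" using assms(1-3) by (simp_all add: c_def d_def)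
  define \<mu> where "\<mu> = law \<nu> s"
  have h: "has_law \<nu> h (harmonic_law \<gamma> n)"
    using has_law_law[OF \<open>self_adjoint h\<close>] assms by simp
  have s: "has_law \<nu> s \<mu>" unfolding \<mu>_def by (rule has_law_law) fact
  then interpret \<mu>: real_distribution \<mu> by (simp add: has_law_def)
  have F: "interval_measure F = \<mu>"
  proof (rule cdf_unique)
    have F_cdf: "F = cdf \<mu>" using \<open>F = cdf (law \<nu> s)\<close> by (simp add: \<mu>_def)
    show "real_distribution (interval_measure F)"
      unfolding F_cdf
      by (rule real_distribution_interval_measure)
        (auto intro: \<mu>.cdf_nondecreasing \<mu>.cdf_is_right_cont \<mu>.cdf_lim_at_bot \<mu>.cdf_lim_at_top_prob)
    show "cdf (interval_measure F) = cdf \<mu>"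
      unfolding F_cdf
      by (rule cdf_interval_measure)
        (auto intro: \<mu>.cdf_nondecreasing \<mu>.cdf_is_right_cont \<mu>.cdf_lim_at_bot)
  qed (rule \<mu>.real_distribution_axioms)
  have pos: "AE x in \<mu>. 0 < x" using assms(21) unfolding F .
  then have "AE x in \<mu>. 0 \<le> x" by eventually_elim simp
  note r = cstar_sqrt_square[OF \<open>self_adjoint s\<close> s this]
  \<comment> \<open>The law is concentrated on the positive reals, so restricting the integral to
    them changes nothing.\<close>
  have set_integral: "(LINT x:{0<..}|interval_measure F. 1 / (z - complex_of_real x * \<kappa>)) =
      (\<integral>x. 1 / (z - complex_of_real x * \<kappa>) \<partial>\<mu>)" for z \<kappa>
    unfolding F set_lebesgue_integral_def
  proof (rule integral_cong_AE)
    show "AE x in \<mu>. indicator {0<..} x *\<^sub>R (1 / (z - complex_of_real x * \<kappa>)) = 1 / (z - complex_of_real x * \<kappa>)"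
      using pos by eventually_elim simp
  qed measurable
  have sandwich: "self_adjoint (cstar_sqrt s * a * cstar_sqrt s)" if "self_adjoint a" for a
    using that r(1) by (simp add: self_adjoint_def star_mult mult.assoc)
  note free_product = stieltjes_free_product[OF _ _ \<open>self_adjoint s\<close> nu_pos_law[OF s pos] r _ _ _ _ s has_law_law[OF sandwich]]
  have inv: "\<forall>\<^sub>F u in at 0. moment_series \<nu> h (harmonic_inverse c d u) = u"
    unfolding c_def d_def using assms(1-3) by (intro moment_series_harmonic_law h) auto
  have nu_h: "\<nu> h = of_real (c + d)" by (rule nu_harmonic_law[OF c inv])
  then have nu_h_ne: "\<nu> h \<noteq> 0" using c by (simp del: of_real_add)
  \<comment> \<open>With n \<ge> 2 the mean c + d - 1 = \<gamma>/n - \<gamma> of h - 1 is nonzero,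
    so that its S-transform exists.\<close>
  have "c < \<gamma>" using assms(1,3) by (simp add: c_def divide_less_eq)
  then have "c + d \<noteq> 1" by (simp add: d_def)
  then have nu_h1: "\<nu> (h - 1) \<noteq> 0" by (simp add: nu_diff nu_h del: of_real_add)
  define S where "S = S_transform \<nu> (h - 1)"
  have S: "is_S_transform \<nu> (h - 1) S" unfolding S_def by (rule is_S_transform_S_transform[OF nu_h1])
  then obtain l where l: "l analytic_on {0}" "l 0 = 0"
    and l_inv: "\<forall>\<^sub>F z in nhds 0. l (moment_series \<nu> (h - 1) z) = z \<and> moment_series \<nu> (h - 1) (l z) = z"
    and S_eq: "\<forall>\<^sub>F z in at 0. S z = (1 + z) / z * l z"
    by (auto simp: is_S_transform_def)
  have l_right: "\<forall>\<^sub>F z in at 0. moment_series \<nu> (h - 1) (l z) = z"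
    using l_inv unfolding eventually_at_filter by eventually_elim simp
  have h1: "self_adjoint (h - 1)" "freely_independent \<nu> (h - 1) s"
    using assms by (simp_all add: freely_independent_translate self_adjoint_diff self_adjoint_1)
  \<comment> \<open>For \<open>h\<close> the explicit inverse is inserted, for \<open>h - 1\<close>
    the germ \<open>l\<close> that comes with the chosen S-transform; only a right inverse is asked
    for.\<close>
  note sh = free_product[OF \<open>self_adjoint h\<close> nu_h_ne \<open>freely_independent \<nu> h s\<close>
      harmonic_inverse_analytic[OF c] harmonic_inverse_0 inv \<open>self_adjoint h\<close>]
  note e = free_product[OF h1(1) nu_h1 h1(2) l l_right h1(1)]
  define m_sh where "m_sh = stieltjes (law \<nu> (cstar_sqrt s * h * cstar_sqrt s))"
  define m_e where "m_e = stieltjes (law \<nu> (cstar_sqrt s * (h - 1) * cstar_sqrt s))"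
  note sh = sh[folded m_sh_def] and e = e[folded m_e_def]
  have "\<forall>\<^sub>F z in at_infinity. m_sh z = (LINT x:{0<..}|interval_measure F.
      1 / (z - complex_of_real x * (complex_of_real \<gamma> * z * m_sh z / of_nat n + 1 - complex_of_real \<gamma>)))"
    using sh(2) eventually_compose_filterlim[OF eventually_harmonic_den(1)[OF c] sh(1)]
      eventually_compose_filterlim[OF eventually_harmonic_den(2)[OF c] sh(1)]
      eventually_compose_filterlim[OF eventually_neq_at_within[of 0 0 UNIV] sh(1)]
  proof eventually_elim
    case (elim z)
    define u where "u = z * m_sh z - 1"
    have u: "u \<noteq> 0" "1 + u \<noteq> 0" "of_real c * (1 + u) + complex_of_real d \<noteq> 0"
      using elim by (simp_all add: u_def)
    \<comment> \<open>This is 1 / S(u) for \<open>h\<close>, and 1 + u = z m(z) turns it into the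
      factor in the statement.\<close>
    have "u / ((1 + u) * harmonic_inverse c d u) = of_real c * (1 + u) + of_real d"
      using u by (simp add: harmonic_inverse_def)
    also have "\<dots> = complex_of_real \<gamma> * z * m_sh z / of_nat n + 1 - complex_of_real \<gamma>"
      by (simp add: u_def c_def d_def)
    finally show ?case using elim(1) unfolding set_integral u_def by simp
  qed
  moreover have "\<forall>\<^sub>F z in at_infinity. m_e z = (LINT x:{0<..}|interval_measure F.
      1 / (z - complex_of_real x / S (z * m_e z - 1)))"
    using e(2) eventually_compose_filterlim[OF S_eq e(1)]
  proof eventually_elim
    case (elim z)
    have eq: "complex_of_real x / S (z * m_e z - 1) = complex_of_real x * ((z * m_e z - 1) /
        ((1 + (z * m_e z - 1)) * l (z * m_e z - 1)))" for x
      unfolding elim(2) by simp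
    show ?case unfolding eq set_integral by (rule elim(1))
  qed
  moreover have "\<forall>\<^sub>F z in nhds 0. complex_of_real \<gamma> * z / of_nat n * (S z)\<^sup>2
      + complex_of_real \<gamma> * ((1 + z) / of_nat n - 1) * S z - 1 = 0"
    using S_transform_quadratic[OF c inv S]
    by eventually_elim (simp add: c_def d_def algebra_simps)
  ultimately show ?thesis
    unfolding Let_def m_sh_def[symmetric] m_e_def[symmetric] S_def[symmetric] by blast
qed

end
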